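(* Let $\mathcal B$, $Q$, $\phi_1,\dots,\phi_m$, $L(\Phi,\mathcal B)$ and the game between Players I and II be as in the context. The optimal strategy of the game for Player II is the pure strategy $u^{\mathrm{II}}=\mathbb E_{\xi\sim\mathcal N(0,Q)}[\xi\mid\sigma(\Phi)]$ corresponding to the mixed strategy $\xi\sim\mathcal N(0,Q)$ of Player I, which is a worst case (weak) measure (in the sense described in the context). In particular, the function $u^{\mathrm{II}}\in L(\Phi,\mathcal B)$ defined by $$u^{\mathrm{II}}(u)=\mathbb E_{\xi\sim\mathcal N(0,Q)}\big[\xi\,\big|\,[\phi_i,\xi]=[\phi_i,u]\text{ for }i=1,\dots,m\big],\qquad u\in\mathcal B,$$ is the optimal minmax solution of $$\inf_{v\in L(\Phi,\mathcal B)}\ \sup_{u\in\mathcal B}\frac{\|u-v(u)\|}{\|u\|}.$$ Moreover, the gamblets $\psi_i:=\sum_{j=1}^m\Theta^{-1}_{i,j}Q\phi_j$, $i=1,\dots,m$, have the representation $$\psi_i=\mathbb E_{\xi\sim\mathcal N(0,Q)}\big[\xi\,\big|\,[\phi_j,\xi]=\delta_{i,j},\ j=1,\dots,m\big].$$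
   Context: $\mathcal B$ is a reflexive separable Banach space with (a realization of) its dual $\mathcal B^*$ and dual pairing $[\cdot,\cdot]$; $Q:\mathcal B^*\to\mathcal B$ is a positive symmetric linear bijection and $\mathcal B$ carries the inner product $\langle u_1,u_2\rangle=[Q^{-1}u_1,u_2]$ and norm $\|\cdot\|$. $\phi_1,\dots,\phi_m\in\mathcal B^*$ are linearly independent, $\Phi=\operatorname{span}\{\phi_1,\dots,\phi_m\}$, $\Theta_{i,j}=[\phi_i,Q\phi_j]$. $L(\Phi,\mathcal B)$ is the set of functions $v:\mathcal B\to\mathcal B$ that are measurable from the $\sigma$-algebra $\sigma(\Phi)$ generated by $\phi_1,\dots,\phi_m$ to the Borel $\sigma$-algebra; equivalently $v(u)=G([\phi_1,u],\dots,[\phi_m,u])$ with $G:\mathbb R^m\to\mathcal B$ Borel. Game: Player I chooses $u^{\mathrm I}\in\mathcal B$ and maximizes, Player II chooses $u^{\mathrm{II}}\in L(\Phi,\mathcal B)$ and minimizes, the loss $\|u^{\mathrm I}-u^{\mathrm{II}}(u^{\mathrm I})\|/\|u^{\mathrm I}\|$. A mixed strategy of Player I is a (weak) probability distribution on $\mathcal B$. Gaussian field: $\xi\sim\mathcal N(0,Q)$ is a linear isometry $\varphi\mapsto[\varphi,\xi]$ from $\mathcal B^*$ (with inner product $[\varphi_1,Q\varphi_2]$) into an $L^2$ space of a probability space, whose image consists of centered Gaussian random variables; thus $\mathbb E[[\varphi_1,\xi][\varphi_2,\xi]]=[\varphi_1,Q\varphi_2]$. It is identified with the Gaussian cylinder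 measure $\mu_Q$. For $c\in\mathbb R^m$, $\mathbb E[\xi\mid[\phi_i,\xi]=c_i,\ i=1,\dots,m]$ denotes the element $v\in\mathcal B$ such that for every $\varphi\in\mathcal B^*$, $[\varphi,v]$ is the value at $c$ of the (continuous) regression function of $[\varphi,\xi]$ given $([\phi_1,\xi],\dots,[\phi_m,\xi])$; $\mathbb E[\xi\mid\sigma(\Phi)]$ is the resulting function of the values of $\phi_1,\dots,\phi_m$. Worst case measures. $\mathcal M_2(\mathcal B)$ is the set of Borel probability measures on $\mathcal B$ with finite second moments; $\Psi(v,\mu):=\int\|x-v(x)\|^2d\mu(x)\big/\int\|x\|^2d\mu(x)$ for $v\in L(\Phi,\mathcal B)$, $\mu\in\mathcal M_2(\mathcal B)$. A measure is a worst case measure if it is the second component of a saddle point of $\Psi$, where saddle points are extended to cylinder measures as follows. $(v^*,\mu^* )\in L(\Phi,\mathcal B)\times\mathcal M_2(\mathcal B)$ is an $\epsilon$-saddle point if $\Psi(v^*,\mu)-\epsilon\le\Psi(v^*,\mu^* )\le\Psi(v,\mu^* )+\epsilon$ for all $v\in L(\Phi,\mathcal B)$, $\mu\in\mathcal M_2(\mathcal B)$. A cylinder measure is a finitely additive set function on the cylinder sets of $\mathcal B$ whose push-forward $F_*\mu$ by every continuous linear map $F$ to a finite-dimensional space is a probability measure; $\mu_n\to\mu$ in the weak cylinder measure topology if $F_*\mu_n\to F_*\mu$ weakly for every continuous linear finite-rank projection $F$ on $\mathcal B$. $(v^*,\mu^* )$ with $\mu^*$ a cylinder measure is a saddle point of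 $\Psi$ if there are $\mu^*_n\in\mathcal M_2(\mathcal B)$ converging to $\mu^*$ in this topology such that $(v^*,\mu^*_n)$ is a $\frac1n$-saddle point for every $n$. The Gaussian cylinder measure $\mu_T$ with covariance $T:\mathcal B^*\to\mathcal B$ is the one for which each $\varphi\in\mathcal B^*$ has law $\mathcal N(0,[\varphi,T\varphi])$. The measure $\mu_Q$, i.e. $\mathcal N(0,Q)$, is called a (universal) worst case measure in that, whatever the measurement functions, it generates the worst case measure $\mu_{\Phi^\perp(Q)}$ through shorting, where the short $\Phi^\perp(Q)$ is the symmetric operator with $[s,\Phi^\perp(Q)s]=\inf_{t\in\Phi}[s+t,Q(s+t)]$, $s\in\mathcal B^*$; when $\dim\mathcal B=\infty$, $\mu_Q$ is also itself the component of a saddle point. *)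

theory Defs
  imports "HOL-Probability.Probability"
begin

type_synonym 'b dual = "'b \<Rightarrow>\<^sub>L real"

abbreviation pairing :: "'b::real_normed_vector dual \<Rightarrow> 'b \<Rightarrow> real"  (infixl "\<cdot>" 70)
  where "f \<cdot> u \<equiv> blinfun_apply f u"

definition reflexive_space :: "'b::real_normed_vector itself \<Rightarrow> bool" where
  "reflexive_space _ \<longleftrightarrow> (\<forall>J :: 'b dual \<Rightarrow>\<^sub>L real. \<exists>u::'b. \<forall>f::'b dual. blinfun_apply J f = f \<cdot> u)"

definition infinite_dimensional :: "'b::real_vector itself \<Rightarrow> bool" where
  "infinite_dimensional _ \<longleftrightarrow> \<not> (\<exists>S::'b set. finite S \<and> span S = UNIV)"

definition qinner :: "('b::real_normed_vector dual \<Rightarrow> 'b) \<Rightarrow> 'b \<Rightarrow> 'b \<Rightarrow> real" where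
  "qinner Q u w = inv Q u \<cdot> w"

definition qnorm :: "('b::real_normed_vector dual \<Rightarrow> 'b) \<Rightarrow> 'b \<Rightarrow> real" where
  "qnorm Q u = sqrt (qinner Q u u)"


section \<open>Measurements and the deterministic game\<close>

definition measure_vec :: "('m::finite \<Rightarrow> 'b::real_normed_vector dual) \<Rightarrow> 'b \<Rightarrow> real ^ 'm" where
  "measure_vec phi u = (\<chi> i. phi i \<cdot> u)"

definition sigma_Phi :: "('m::finite \<Rightarrow> 'b::real_normed_vector dual) \<Rightarrow> 'b measure" where
  "sigma_Phi phi = sigma UNIV {blinfun_apply (phi i) -` A | i A. A \<in> sets borel}"

definition L_Phi :: "('m::finite \<Rightarrow> 'b::real_normed_vector dual) \<Rightarrow> ('b \<Rightarrow> 'b) set" where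
  "L_Phi phi = measurable (sigma_Phi phi) borel"

text \<open>
  The worst case loss takes values in \<open>[0, \<infinity>]\<close>, since it is infinite for some admissible
  strategies.  The point \<open>u = 0\<close>, where the loss is not defined, is left out.
\<close>

definition worst_loss :: "('b::real_normed_vector dual \<Rightarrow> 'b) \<Rightarrow> ('b \<Rightarrow> 'b) \<Rightarrow> ennreal" where
  "worst_loss Q v = (SUP u\<in>-{0}. ennreal (qnorm Q (u - v u) / qnorm Q u))"

definition minmax_optimal ::
  "('b::real_normed_vector dual \<Rightarrow> 'b) \<Rightarrow> ('m::finite \<Rightarrow> 'b dual) \<Rightarrow> ('b \<Rightarrow> 'b) \<Rightarrow> bool" where
  "minmax_optimal Q phi v \<longleftrightarrow>
     v \<in> L_Phi phi \<and> worst_loss Q v = (INF w\<in>L_Phi phi. worst_loss Q w)"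

definition Theta ::
  "('b::real_normed_vector dual \<Rightarrow> 'b) \<Rightarrow> ('m::finite \<Rightarrow> 'b dual) \<Rightarrow> real ^ 'm ^ 'm" where
  "Theta Q phi = (\<chi> i j. phi i \<cdot> Q (phi j))"

definition gamblet ::
  "('b::real_normed_vector dual \<Rightarrow> 'b) \<Rightarrow> ('m::finite \<Rightarrow> 'b dual) \<Rightarrow> 'm \<Rightarrow> 'b" where
  "gamblet Q phi i = (\<Sum>j\<in>UNIV. (matrix_inv (Theta Q phi) $ i $ j) *\<^sub>R Q (phi j))"


section \<open>Gaussian fields and their conditional expectations\<close>

text \<open>The parameter is the variance; variance 0 gives the Dirac measure at 0.\<close>

definition centered_normal :: "real \<Rightarrow> real measure" where
  "centered_normal s =
     (if s = 0 then return borel 0 else density lborel (\<lambda>x. ennreal (normal_density 0 (sqrt s) x)))"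

text \<open>
  Elements of \<open>L\<^sup>2\<close> are represented by functions, so that linearity of the field holds almost
  everywhere only.
\<close>

definition gaussian_field ::
  "('b::real_normed_vector dual \<Rightarrow> 'b) \<Rightarrow> 'w measure \<Rightarrow> ('b dual \<Rightarrow> 'w \<Rightarrow> real) \<Rightarrow> bool" where
  "gaussian_field Q M \<xi> \<longleftrightarrow>
     prob_space M \<and>
     (\<forall>f. \<xi> f \<in> borel_measurable M \<and> integrable M (\<lambda>\<omega>. (\<xi> f \<omega>)\<^sup>2)) \<and>
     (\<forall>a b f g. AE \<omega> in M. \<xi> (a *\<^sub>R f + b *\<^sub>R g) \<omega> = a * \<xi> f \<omega> + b * \<xi> g \<omega>) \<and>
     (\<forall>f g :: 'b dual. (\<integral>\<omega>. \<xi> f \<omega> * \<xi> g \<omega> \<partial>M) = f \<cdot> Q g) \<and>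
     (\<forall>f. \<exists>s\<ge>0. distr M borel (\<xi> f) = centered_normal s)"

definition continuous_regression ::
  "'w measure \<Rightarrow> ('w \<Rightarrow> real ^ 'm::finite) \<Rightarrow> ('w \<Rightarrow> real) \<Rightarrow> (real ^ 'm \<Rightarrow> real) \<Rightarrow> bool" where
  "continuous_regression M X Y r \<longleftrightarrow>
     continuous_on UNIV r \<and>
     (AE \<omega> in M. real_cond_exp M (vimage_algebra (space M) X borel) Y \<omega> = r (X \<omega>))"

definition is_field_cond_exp ::
  "'w measure \<Rightarrow> ('b::real_normed_vector dual \<Rightarrow> 'w \<Rightarrow> real) \<Rightarrow> ('m::finite \<Rightarrow> 'b dual)
     \<Rightarrow> real ^ 'm \<Rightarrow> 'b \<Rightarrow> bool" where
  "is_field_cond_exp M \<xi> phi c v \<longleftrightarrow>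
     (\<forall>f :: 'b dual. \<exists>r. continuous_regression M (\<lambda>\<omega>. \<chi> i. \<xi> (phi i) \<omega>) (\<xi> f) r \<and> f \<cdot> v = r c)"

definition field_cond_exp ::
  "'w measure \<Rightarrow> ('b::real_normed_vector dual \<Rightarrow> 'w \<Rightarrow> real) \<Rightarrow> ('m::finite \<Rightarrow> 'b dual)
     \<Rightarrow> real ^ 'm \<Rightarrow> 'b" where
  "field_cond_exp M \<xi> phi c = (THE v. is_field_cond_exp M \<xi> phi c v)"

definition u_II ::
  "'w measure \<Rightarrow> ('b::real_normed_vector dual \<Rightarrow> 'w \<Rightarrow> real) \<Rightarrow> ('m::finite \<Rightarrow> 'b dual)
     \<Rightarrow> 'b \<Rightarrow> 'b" where
  "u_II M \<xi> phi u = field_cond_exp M \<xi> phi (measure_vec phi u)"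


section \<open>Cylinder measures\<close>

text \<open>
  Up to a linear isomorphism of the target, the continuous linear maps into finite-dimensional
  spaces are the maps \<open>coords k f\<close> into \<open>\<real>\<^sup>k\<close>, here the product space over \<open>{..<k}\<close>.
\<close>

definition coords :: "nat \<Rightarrow> (nat \<Rightarrow> 'b::real_normed_vector dual) \<Rightarrow> 'b \<Rightarrow> (nat \<Rightarrow> real)" where
  "coords k f u = (\<lambda>i\<in>{..<k}. f i \<cdot> u)"

abbreviation euclid :: "nat \<Rightarrow> (nat \<Rightarrow> real) measure" where
  "euclid k \<equiv> Pi\<^sub>M {..<k} (\<lambda>_. borel)"

definition cylinder_sets :: "'b::real_normed_vector set set" where
  "cylinder_sets = {coords k f -` A | k f A. A \<in> sets (euclid k)}"

text \<open>Values outside of \<^const>\<open>cylinder_sets\<close> are irrelevant.\<close>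

definition cylinder_measure :: "('b::real_normed_vector set \<Rightarrow> ennreal) \<Rightarrow> bool" where
  "cylinder_measure \<mu> \<longleftrightarrow>
     additive cylinder_sets \<mu> \<and>
     (\<forall>k f. measure_space (space (euclid k)) (sets (euclid k)) (\<lambda>A. \<mu> (coords k f -` A))) \<and>
     \<mu> UNIV = 1"

text \<open>
  Used only for continuous linear \<open>F\<close> of finite rank, for which preimages of Borel sets are
  cylinder sets.
\<close>

definition push :: "('b::real_normed_vector \<Rightarrow> 'c::topological_space) \<Rightarrow> ('b set \<Rightarrow> ennreal)
    \<Rightarrow> 'c measure" where
  "push F \<mu> = measure_of UNIV (sets borel) (\<lambda>A. \<mu> (F -` A))"

definition finite_rank_projection :: "('b::real_normed_vector \<Rightarrow>\<^sub>L 'b) \<Rightarrow> bool" where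
  "finite_rank_projection F \<longleftrightarrow>
     F o\<^sub>L F = F \<and> (\<exists>S. finite S \<and> range (blinfun_apply F) \<subseteq> span S)"

definition weakly_converges :: "(nat \<Rightarrow> 'c::topological_space measure) \<Rightarrow> 'c measure \<Rightarrow> bool" where
  "weakly_converges Ms M \<longleftrightarrow>
     (\<forall>g::'c \<Rightarrow> real. continuous_on UNIV g \<longrightarrow> bounded (range g) \<longrightarrow>
        (\<lambda>n. \<integral>x. g x \<partial>(Ms n)) \<longlonglongrightarrow> (\<integral>x. g x \<partial>M))"

definition cylinder_converges ::
  "(nat \<Rightarrow> 'b::real_normed_vector set \<Rightarrow> ennreal) \<Rightarrow> ('b set \<Rightarrow> ennreal) \<Rightarrow> bool" where
  "cylinder_converges \<mu>s \<mu> \<longleftrightarrow>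
     (\<forall>F :: 'b \<Rightarrow>\<^sub>L 'b. finite_rank_projection F \<longrightarrow>
        weakly_converges (\<lambda>n. push (blinfun_apply F) (\<mu>s n)) (push (blinfun_apply F) \<mu>))"

definition gaussian_cylinder_measure ::
  "('b::real_normed_vector dual \<Rightarrow> 'b) \<Rightarrow> ('b set \<Rightarrow> ennreal) \<Rightarrow> bool" where
  "gaussian_cylinder_measure T \<mu> \<longleftrightarrow>
     cylinder_measure \<mu> \<and> (\<forall>f::'b dual. push (blinfun_apply f) \<mu> = centered_normal (f \<cdot> T f))"

definition is_short ::
  "('b::real_normed_vector dual \<Rightarrow> 'b) \<Rightarrow> 'b dual set \<Rightarrow> ('b dual \<Rightarrow> 'b) \<Rightarrow> bool" where
  "is_short Q \<Phi> T \<longleftrightarrow>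
     linear T \<and> (\<forall>f g :: 'b dual. f \<cdot> T g = g \<cdot> T f) \<and>
     (\<forall>s :: 'b dual. s \<cdot> T s = (INF t\<in>\<Phi>. (s + t) \<cdot> Q (s + t)))"

definition short :: "('b::real_normed_vector dual \<Rightarrow> 'b) \<Rightarrow> 'b dual set \<Rightarrow> ('b dual \<Rightarrow> 'b)" where
  "short Q \<Phi> = (THE T. is_short Q \<Phi> T)"


section \<open>Saddle points\<close>

definition second_moment :: "('b::real_normed_vector dual \<Rightarrow> 'b) \<Rightarrow> 'b measure \<Rightarrow> ennreal" where
  "second_moment Q \<mu> = (\<integral>\<^sup>+x. ennreal ((qnorm Q x)\<^sup>2) \<partial>\<mu>)"

definition M2 :: "('b::real_normed_vector dual \<Rightarrow> 'b) \<Rightarrow> 'b measure set" where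
  "M2 Q = {\<mu>. prob_space \<mu> \<and> sets \<mu> = sets borel \<and> second_moment Q \<mu> < \<infinity>}"

text \<open>The quotient below is not defined for the Dirac measure at 0.\<close>

definition Psi_dom :: "('b::real_normed_vector dual \<Rightarrow> 'b) \<Rightarrow> 'b measure set" where
  "Psi_dom Q = {\<mu> \<in> M2 Q. second_moment Q \<mu> \<noteq> 0}"

text \<open>Extended values are needed: the numerator is infinite for some \<open>v\<close>.\<close>

definition Psi ::
  "('b::real_normed_vector dual \<Rightarrow> 'b) \<Rightarrow> ('b \<Rightarrow> 'b) \<Rightarrow> 'b measure \<Rightarrow> ennreal" where
  "Psi Q v \<mu> = (\<integral>\<^sup>+x. ennreal ((qnorm Q (x - v x))\<^sup>2) \<partial>\<mu>) / second_moment Q \<mu>"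

definition eps_saddle_point ::
  "('b::real_normed_vector dual \<Rightarrow> 'b) \<Rightarrow> ('m::finite \<Rightarrow> 'b dual) \<Rightarrow> real
     \<Rightarrow> ('b \<Rightarrow> 'b) \<Rightarrow> 'b measure \<Rightarrow> bool" where
  "eps_saddle_point Q phi \<epsilon> v' \<mu>' \<longleftrightarrow>
     v' \<in> L_Phi phi \<and> \<mu>' \<in> Psi_dom Q \<and>
     (\<forall>\<mu>\<in>Psi_dom Q. Psi Q v' \<mu> \<le> Psi Q v' \<mu>' + ennreal \<epsilon>) \<and>
     (\<forall>v\<in>L_Phi phi. Psi Q v' \<mu>' \<le> Psi Q v \<mu>' + ennreal \<epsilon>)"

definition saddle_point ::
  "('b::real_normed_vector dual \<Rightarrow> 'b) \<Rightarrow> ('m::finite \<Rightarrow> 'b dual)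
     \<Rightarrow> ('b \<Rightarrow> 'b) \<Rightarrow> ('b set \<Rightarrow> ennreal) \<Rightarrow> bool" where
  "saddle_point Q phi v' \<mu>' \<longleftrightarrow>
     v' \<in> L_Phi phi \<and> cylinder_measure \<mu>' \<and>
     (\<exists>\<mu>s. cylinder_converges (\<lambda>n. emeasure (\<mu>s n)) \<mu>' \<and>
           (\<forall>n\<ge>1. eps_saddle_point Q phi (1 / real n) v' (\<mu>s n)))"

end

(*
  In the inner product induced by Q, the candidate strategy is the orthogonal projection P onto the
  span of the elements Q phi_i: the Gaussian regression of [f, xi] on the measurements is linear, with
  coefficients f (psi_i).  A strategy depends on the measurements only, hence it cannot distinguish x
  from its reflection 2 P x - x; by the parallelogram law its mean square loss under a measure that is
  invariant under this reflection is at least that of P.  This gives both the minmax property (for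
  the two-point measures on {k, -k} with k in the kernel of P) and the inequality for Player II at a
  saddle point, without any integrability considerations.  The inequality for Player I only asks
  that the measure puts almost all of its second moment on the kernel of P: this holds for centered
  Gaussians on the kernel, and, in infinite dimension, for Gaussians on large finite-dimensional
  subspaces, because the trace of P is finite.

  Multivariate Gaussian laws are identified, and weak limits obtained, by testing against
  trigonometric polynomials; these are determined by the one-dimensional laws and, by
  Stone-Weierstrass, approximate bounded continuous functions on compact sets.
*)
theory Submission
  imports Defs
begin

text \<open>Gaussian cylinder measures need not be countably additive, so they are approximated by
  the laws of finite sums \<open>\<Sum>k. \<omega> k *\<^sub>R d k\<close> with independent standard
  normal \<open>\<omega> k\<close>, and both saddle point claims become a choice of vectors
  \<open>d k\<close>. If every \<open>d k\<close> lies in the kernel or in the range of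
  \<open>P\<close>, the reflection only changes the signs of some \<open>d k\<close> and therefore
  preserves the law; this is why basis vectors are replaced by their components. Convergence
  concerns only \<open>\<Sum>k. (h \<cdot> d k)\<^sup>2\<close>, and the second moment is the sum of
  the squared norms of the \<open>d k\<close>. The value of the game is 1 unless \<open>P\<close> is
  the identity; then it is 0, the short vanishes and the limit is the Dirac measure at 0, which
  \<open>Psi_dom\<close> excludes, so shrinking Gaussians stand in for it. On the probabilistic
  side, a conditional expectation is determined almost everywhere only; its value at a single
  \<open>c\<close> makes sense because the law of the measurements charges every nonempty open set,
  so that the continuous version is unique.\<close>

no_notation HLD_nxt (infixr \<open>\<cdot>\<close> 65)

section \<open>One-dimensional Gaussians and trigonometric polynomials\<close>

lemma real_distribution_centered_normal: "s \<ge> 0 \<Longrightarrow> real_distribution (centered_normal s)"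
proof (cases "s = 0")
  case False
  assume "s \<ge> 0"
  with False have "prob_space (density lborel (\<lambda>x. ennreal (normal_density 0 (sqrt s) x)))"
    by (intro prob_space_normal_density) simp
  then show ?thesis
    using False by (auto simp: centered_normal_def real_distribution_def real_distribution_axioms_def)
qed (auto simp: centered_normal_def real_distribution_def real_distribution_axioms_def
      intro!: prob_space_return)

text \<open>Scaling a standard normal variable by \<open>sqrt s\<close> also covers
  \<open>s = 0\<close>, where the image is the Dirac measure; moments and characteristic functions
  then need no case distinction.\<close>

lemma centered_normal_eq_distr:
  assumes "s \<ge> 0"
  shows "centered_normal s = distr std_normal_distribution borel (\<lambda>z. sqrt s * z)"
proof (cases "s = 0")
  case True
  interpret real_distribution std_normal_distribution by (rule real_dist_normal_dist)
  show ?thesis using True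
    by (simp add: centered_normal_def distr_const)
next
  case False
  interpret real_distribution std_normal_distribution by (rule real_dist_normal_dist)
  have "distributed std_normal_distribution lborel (\<lambda>x. x) (\<lambda>x. ennreal (std_normal_density x))"
    by (auto simp: distributed_def distr_id2)
  from normal_density_affine[OF this, of "sqrt s" 0]
  have "distributed std_normal_distribution lborel (\<lambda>x. sqrt s * x)
      (\<lambda>x. ennreal (normal_density 0 (sqrt s) x))"
    using False assms by simp
  then show ?thesis
    using False by (auto simp: distributed_def centered_normal_def cong: distr_cong)
qed

lemma char_centered_normal:
  assumes "s \<ge> 0"
  shows "char (centered_normal s) t = of_real (exp (- (t\<^sup>2 * s) / 2))"
proof -
  have "char (centered_normal s) t = char std_normal_distribution (t * sqrt s)"
    unfolding centered_normal_eq_distr[OF assms] char_def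
    by (subst integral_distr) (auto simp: mult.assoc)
  then show ?thesis
    using assms by (simp add: char_std_normal_distribution power_mult_distrib)
qed

lemma centered_normal_second_moment:
  assumes "s \<ge> 0"
  shows "integrable (centered_normal s) (\<lambda>x. x\<^sup>2)" "(\<integral>x. x\<^sup>2 \<partial>centered_normal s) = s"
proof -
  have i: "integrable std_normal_distribution (\<lambda>x. (sqrt s * x)\<^sup>2)"
    unfolding power_mult_distrib
    by (intro integrable_mult_right integrable_std_normal_distribution_moment)
  have "(\<integral>x. (sqrt s * x)\<^sup>2 \<partial>std_normal_distribution) = s"
    using std_normal_distribution_even_moments(1)[of 1] assms
    by (simp add: power_mult_distrib)
  with i show "integrable (centered_normal s) (\<lambda>x. x\<^sup>2)" "(\<integral>x. x\<^sup>2 \<partial>centered_normal s) = s"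
    unfolding centered_normal_eq_distr[OF assms]
    by (auto simp: integrable_distr_eq integral_distr)
qed

lemma nn_integral_centered_normal:
  assumes "s \<ge> 0"
  shows "(\<integral>\<^sup>+x. ennreal (x\<^sup>2) \<partial>centered_normal s) = ennreal s"
  using centered_normal_second_moment[OF assms] by (subst nn_integral_eq_integral) auto

text \<open>This is the real part of \<open>iexp b\<close> times the characteristic function at 1.
  Unit frequency suffices, since a frequency can be absorbed into the functional whose law is
  considered; the phase \<open>b\<close> covers the sine as well.\<close>

lemma integral_cos_centered_normal:
  assumes "s \<ge> 0"
  shows "(\<integral>x. cos (x + b) \<partial>centered_normal s) = cos b * exp (- s / 2)"
proof -
  interpret real_distribution "centered_normal s"
    by (rule real_distribution_centered_normal[OF assms])
  have i: "integrable (centered_normal s) (\<lambda>x. iexp b * iexp (1 * x))"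
    by (intro integrable_const_bound[where B=1]) (auto simp: norm_mult)
  have "cos (x + b) = Re (iexp b * iexp (1 * x))" for x
    by (simp add: cos_add Re_exp Im_exp mult.commute)
  then have "(\<integral>x. cos (x + b) \<partial>centered_normal s) = Re (CLINT x|centered_normal s. iexp b * iexp (1 * x))"
    using i by (simp only: integral_Re)
  also have "\<dots> = Re (iexp b * char (centered_normal s) 1)"
    by (simp add: char_def)
  finally show ?thesis
    using assms by (simp add: char_centered_normal Re_exp)
qed

lemma prob_space_distr_centered_normal:
  assumes "distr M borel X = centered_normal s" "s \<ge> 0" "X \<in> borel_measurable M"
  shows "integrable M (\<lambda>x. (X x)\<^sup>2)" "(\<integral>x. (X x)\<^sup>2 \<partial>M) = s" "(\<integral>\<^sup>+x. ennreal ((X x)\<^sup>2) \<partial>M) = ennreal s"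
    "(\<integral>x. cos (X x + b) \<partial>M) = cos b * exp (- s / 2)"
proof -
  have *: "integrable (distr M borel X) (\<lambda>x. x\<^sup>2)" "(\<integral>x. x\<^sup>2 \<partial>distr M borel X) = s"
    "(\<integral>\<^sup>+x. ennreal (x\<^sup>2) \<partial>distr M borel X) = ennreal s"
    "(\<integral>x. cos (x + b) \<partial>distr M borel X) = cos b * exp (- s / 2)"
    unfolding assms(1)
    using centered_normal_second_moment nn_integral_centered_normal integral_cos_centered_normal assms(2) by auto
  show "integrable M (\<lambda>x. (X x)\<^sup>2)" using *(1) assms(3) by (simp add: integrable_distr_eq)
  show "(\<integral>x. (X x)\<^sup>2 \<partial>M) = s" using *(2) assms(3) by (simp add: integral_distr)
  show "(\<integral>\<^sup>+x. ennreal ((X x)\<^sup>2) \<partial>M) = ennreal s" using *(3) assms(3) by (simp add: nn_integral_distr)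
  show "(\<integral>x. cos (X x + b) \<partial>M) = cos b * exp (- s / 2)" using *(4) assms(3) by (simp add: integral_distr)
qed

section \<open>Trigonometric polynomials as an algebra of test functions\<close>

inductive trig :: "('a::real_normed_vector \<Rightarrow> real) \<Rightarrow> bool" where
  wave: "trig (\<lambda>x. a * cos (f \<cdot> x + b))"
| add: "trig p \<Longrightarrow> trig q \<Longrightarrow> trig (\<lambda>x. p x + q x)"

lemma trig_const: "trig (\<lambda>_. c)"
  using trig.wave[of c 0 0] by simp

lemma trig_continuous: "trig p \<Longrightarrow> continuous_on UNIV p"
  by (induction rule: trig.induct) (auto intro!: continuous_intros)

text \<open>The product formula for cosines writes a product of two waves as a sum of two waves with
  the difference and the sum of the functionals. With it the sums of waves form an algebra, as
  Stone-Weierstrass demands.\<close>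

lemma trig_mult:
  assumes "trig p" "trig q"
  shows "trig (\<lambda>x. p x * q x)"
  using assms(1)
proof (induction rule: trig.induct)
  case (wave a f b)
  show ?case using assms(2)
  proof (induction rule: trig.induct)
    case (wave c g d)
    have "(\<lambda>x. a * cos (f \<cdot> x + b) * (c * cos (g \<cdot> x + d))) =
      (\<lambda>x. a * c / 2 * cos ((f - g) \<cdot> x + (b - d)) + a * c / 2 * cos ((f + g) \<cdot> x + (b + d)))"
    proof
      fix x
      have "(f - g) \<cdot> x + (b - d) = (f \<cdot> x + b) - (g \<cdot> x + d)"
           "(f + g) \<cdot> x + (b + d) = (f \<cdot> x + b) + (g \<cdot> x + d)"
        by (simp_all add: blinfun.diff_left blinfun.add_left)
      then show "a * cos (f \<cdot> x + b) * (c * cos (g \<cdot> x + d)) =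
        a * c / 2 * cos ((f - g) \<cdot> x + (b - d)) + a * c / 2 * cos ((f + g) \<cdot> x + (b + d))"
        by (simp only: cos_add cos_diff) (simp add: algebra_simps)
    qed
    then show ?case by (simp only:) (intro trig.intros)
  next
    case (add p q)
    then show ?case by (simp add: distrib_left trig.add)
  qed
next
  case (add p q)
  then show ?case by (simp add: distrib_right trig.add)
qed

lemma trig_real_polynomial_function:
  assumes "real_polynomial_function q" "trig p"
  shows "trig (\<lambda>x. q (p x))"
  using assms(1)
proof (induction rule: real_polynomial_function.induct)
  case (linear f)
  then obtain c where "f = (\<lambda>x. x * c)" using real_bounded_linear by blast
  then show ?case using trig_mult[OF assms(2) trig_const] by simp
qed (auto intro: trig_const trig.add trig_mult)

lemma trig_separates:
  assumes "f \<cdot> x \<noteq> f \<cdot> y"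
  shows "\<exists>p. trig p \<and> p x \<noteq> p y"
proof -
  \<comment> \<open>The frequency is chosen so that the phases at \<open>x\<close> and
    \<open>y\<close> are 0 and \<open>pi\<close>, where the cosine takes the values 1 and
    -1.\<close>
  define c where "c = pi / (f \<cdot> y - f \<cdot> x)"
  define p where "p z = 1 * cos ((c *\<^sub>R f) \<cdot> z + - c * (f \<cdot> x))" for z
  have "trig p" unfolding p_def by (rule trig.wave)
  moreover have "p x = 1" by (simp add: p_def blinfun.scaleR_left)
  moreover have "(c *\<^sub>R f) \<cdot> y + - c * (f \<cdot> x) = c * (f \<cdot> y - f \<cdot> x)"
    by (simp add: blinfun.scaleR_left algebra_simps)
  then have "p y = -1" using assms by (simp add: p_def c_def)
  ultimately show ?thesis by (intro exI[of _ p]) auto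
qed

text \<open>Stone-Weierstrass alone does not control \<open>p\<close> outside of \<open>K\<close>; composing with a polynomial
  that approximates the truncation at height \<open>C\<close> does.\<close>

lemma trig_approximation:
  fixes g :: "'a::real_normed_vector \<Rightarrow> real"
  assumes sep: "\<And>x y :: 'a. x \<noteq> y \<Longrightarrow> \<exists>f::'a dual. f \<cdot> x \<noteq> f \<cdot> y"
    and K: "compact K" and g: "continuous_on K g" "\<And>x. \<bar>g x\<bar> \<le> C" and e: "e > 0"
  obtains p where "trig p" "\<And>x. \<bar>p x\<bar> \<le> C + e" "\<And>x. x \<in> K \<Longrightarrow> \<bar>g x - p x\<bar> < e"
proof -
  have "C \<ge> 0" using g(2)[of undefined] by linarith
  obtain p0 where p0: "trig p0" "\<And>x. x \<in> K \<Longrightarrow> \<bar>g x - p0 x\<bar> < e / 2"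
  proof -
    have "\<exists>p. trig p \<and> p x \<noteq> p y" if "x \<noteq> y" for x y :: 'a
      using sep[OF that] trig_separates by blast
    then have "\<exists>p. trig p \<and> (\<forall>x\<in>K. \<bar>g x - p x\<bar> < e / 2)"
      using K g e
      by (intro Stone_Weierstrass_HOL)
         (auto intro: trig_const trig.add trig_mult continuous_on_subset[OF trig_continuous])
    then show ?thesis using that by blast
  qed
  \<comment> \<open>A global bound on \<open>p0\<close> confines its values to a compact interval,
    on which one polynomial can approximate the truncation.\<close>
  have "\<exists>B. \<forall>x. \<bar>p0 x\<bar> \<le> B" using p0(1)
  proof (induction rule: trig.induct)
    case (wave a f b)
    have "\<bar>a * cos (f \<cdot> x + b)\<bar> \<le> \<bar>a\<bar>" for x
      using mult_left_mono[OF abs_cos_le_one[of "f \<cdot> x + b"], of "\<bar>a\<bar>"] by (simp add: abs_mult)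
    then show ?case by blast
  next
    case (add p q)
    then obtain A B where "\<And>x. \<bar>p x\<bar> \<le> A" "\<And>x. \<bar>q x\<bar> \<le> B" by blast
    then have "\<bar>p x + q x\<bar> \<le> A + B" for x by (rule order_trans[OF abs_triangle_ineq add_mono])
    then show ?case by blast
  qed
  then obtain B where B: "\<And>x. \<bar>p0 x\<bar> \<le> B" by blast
  define h where "h y = max (- C) (min C y)" for y :: real
  have "continuous_on {-B..B} h" unfolding h_def by (intro continuous_intros)
  then obtain q where q: "real_polynomial_function q" "\<And>y. y \<in> {-B..B} \<Longrightarrow> \<bar>h y - q y\<bar> < e / 2"
    using Stone_Weierstrass_real_polynomial_function[of "{-B..B}" h "e / 2"] e by auto
  have q': "\<bar>h (p0 x) - q (p0 x)\<bar> < e / 2" for x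
    using q(2)[of "p0 x"] B[of x] by (auto simp: abs_le_iff)
  show ?thesis
  proof (rule that)
    show "trig (\<lambda>x. q (p0 x))" by (rule trig_real_polynomial_function[OF q(1) p0(1)])
    show "\<bar>q (p0 x)\<bar> \<le> C + e" for x
      using q'[of x] \<open>C \<ge> 0\<close> e unfolding h_def by (auto simp: abs_if max_def min_def split: if_splits)
    show "\<bar>g x - q (p0 x)\<bar> < e" if "x \<in> K" for x
    proof -
      \<comment> \<open>Since \<open>g\<close> takes values between \<open>- C\<close> and
        \<open>C\<close>, truncating \<open>p0\<close> to this interval cannot increase its distance
        from \<open>g\<close>.\<close>
      have "\<bar>g x - h (p0 x)\<bar> \<le> \<bar>g x - p0 x\<bar>"
        using g(2)[of x] unfolding h_def by (auto simp: abs_if max_def min_def split: if_splits)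
      with p0(2)[OF that] q'[of x] show ?thesis by linarith
    qed
  qed
qed

section \<open>Weak convergence through trigonometric polynomials\<close>

lemma trig_integrable:
  assumes "finite_measure m" "sets m = sets borel" "trig p" "\<And>x. \<bar>p x\<bar> \<le> C"
  shows "integrable m p"
proof -
  interpret finite_measure m by fact
  have "p \<in> borel_measurable m"
    using borel_measurable_continuous_onI[OF trig_continuous[OF assms(3)]] assms(2)
    by (simp cong: measurable_cong_sets)
  then show ?thesis using assms(4) by (intro integrable_const_bound[of _ C]) auto
qed

text \<open>On \<open>K\<close>, of mass at most \<open>B\<close>, the integrands differ by less
  than \<open>e\<close>; on the complement, of mass at most \<open>d\<close>, they differ by at most
  \<open>2 * C + e\<close>.\<close>

lemma integral_diff_le_off_compact:
  fixes g p :: "'a::metric_space \<Rightarrow> real"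
  assumes m: "finite_measure m" "sets m = sets borel" "measure m UNIV \<le> B" "measure m (- K) \<le> d"
    and K: "compact K" and gp: "continuous_on UNIV g" "continuous_on UNIV p"
    and C: "\<And>x. \<bar>g x\<bar> \<le> C" "\<And>x. \<bar>p x\<bar> \<le> C + e" and e: "\<And>x. x \<in> K \<Longrightarrow> \<bar>g x - p x\<bar> < e" "e > 0"
  shows "\<bar>(\<integral>x. g x \<partial>m) - (\<integral>x. p x \<partial>m)\<bar> \<le> e * B + (2 * C + e) * d"
proof -
  interpret finite_measure m by fact
  have sp: "space m = UNIV" using sets_eq_imp_space_eq[OF m(2)] by simp
  have C0: "C \<ge> 0" using C(1)[of undefined] by linarith
  have [measurable]: "K \<in> sets m" "g \<in> borel_measurable m" "p \<in> borel_measurable m"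
    using K gp m(2) by (auto intro: borel_compact borel_measurable_continuous_onI cong: measurable_cong_sets)
  have K'[measurable]: "- K \<in> sets m"
    using sets.compl_sets[of K m] sp by (simp add: Compl_eq_Diff_UNIV)
  have ig: "integrable m g" "integrable m p"
    using C by (intro integrable_const_bound[where B = C], auto)
      (use C in \<open>intro integrable_const_bound[where B = "C + e"], auto\<close>)
  have "\<bar>(\<integral>x. g x \<partial>m) - (\<integral>x. p x \<partial>m)\<bar> = \<bar>\<integral>x. g x - p x \<partial>m\<bar>"
    using ig by simp
  also have "\<dots> \<le> (\<integral>x. \<bar>g x - p x\<bar> \<partial>m)"
    by (rule integral_abs_bound)
  also have "\<dots> \<le> (\<integral>x. e + (2 * C + e) * indicator (- K) x \<partial>m)"
  proof (rule integral_mono)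
    show "integrable m (\<lambda>x. e + (2 * C + e) * indicator (- K) x)"
      by (intro Bochner_Integration.integrable_add integrable_mult_right integrable_const
          integrable_real_indicator) (auto simp: less_top[symmetric])
    show "\<bar>g x - p x\<bar> \<le> e + (2 * C + e) * indicator (- K) x" for x
      using C(1)[of x] C(2)[of x] e(1)[of x] e(2) by (auto simp: indicator_def)
  qed (use ig in auto)
  also have "\<dots> = e * measure m UNIV + (2 * C + e) * measure m (- K)"
    by (subst Bochner_Integration.integral_add)
       (auto simp: less_top[symmetric] sp intro!: integrable_real_indicator)
  also have "\<dots> \<le> e * B + (2 * C + e) * d"
    using m(3,4) e(2) C0 by (intro add_mono mult_left_mono) auto
  finally show ?thesis .
qed

text \<open>A form of Levy's continuity theorem: on a space whose dual separates points, the integrals of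
  trigonometric polynomials play the role of the characteristic function.\<close>

lemma weakly_converges_trig:
  fixes \<nu> :: "nat \<Rightarrow> 'a::real_normed_vector measure"
  assumes sep: "\<And>x y :: 'a. x \<noteq> y \<Longrightarrow> \<exists>f::'a dual. f \<cdot> x \<noteq> f \<cdot> y"
    and fin: "\<And>n. finite_measure (\<nu> n)" "finite_measure \<nu>0"
    and sets: "\<And>n. sets (\<nu> n) = sets borel" "sets \<nu>0 = sets borel"
    and B: "\<And>n. measure (\<nu> n) UNIV \<le> B" "measure \<nu>0 UNIV \<le> B"
    and tight: "\<And>d. d > 0 \<Longrightarrow> \<exists>K. compact K \<and> (\<forall>n. measure (\<nu> n) (- K) \<le> d) \<and> measure \<nu>0 (- K) \<le> d"
    and conv: "\<And>p. trig p \<Longrightarrow> (\<lambda>n. \<integral>x. p x \<partial>\<nu> n) \<longlonglongrightarrow> (\<integral>x. p x \<partial>\<nu>0)"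
  shows "weakly_converges \<nu> \<nu>0"
  unfolding weakly_converges_def
proof (intro allI impI)
  fix g :: "'a \<Rightarrow> real"
  assume g: "continuous_on UNIV g" "bounded (range g)"
  obtain C where C: "\<And>x. \<bar>g x\<bar> \<le> C" using g(2) by (auto simp: bounded_iff)
  have C0: "C \<ge> 0" using C[of undefined] by linarith
  have B0: "B \<ge> 0" using B(2) measure_nonneg order_trans by blast
  show "(\<lambda>n. \<integral>x. g x \<partial>\<nu> n) \<longlonglongrightarrow> (\<integral>x. g x \<partial>\<nu>0)"
  proof (rule LIMSEQ_I)
    fix r :: real assume r: "r > 0"
    \<comment> \<open>With \<open>d\<close> as below, the error off the compact set is
      \<open>(2 * C + e) * d = e\<close>, so the total is \<open>e * (B + 1) = r / 4\<close>. Three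
      such errors, two of approximation and one of convergence, stay below \<open>r\<close>.\<close>
    define e where "e = r / (4 * (B + 1))"
    have e: "e > 0" using r B0 by (simp add: e_def)
    define d where "d = e / (2 * C + e)"
    have d: "d > 0" using e C0 by (simp add: d_def)
    have tot: "e * B + (2 * C + e) * d = r / 4"
    proof -
      have "(2 * C + e) * d = e" using e C0 by (simp add: d_def)
      then have "e * B + (2 * C + e) * d = e * (B + 1)" by (simp add: algebra_simps)
      also have "\<dots> = r / 4" using B0 by (simp add: e_def divide_simps)
      finally show ?thesis .
    qed
    obtain K where K: "compact K" "\<And>n. measure (\<nu> n) (- K) \<le> d" "measure \<nu>0 (- K) \<le> d"
      using tight[OF d] by blast
    obtain p where p: "trig p" "\<And>x. \<bar>p x\<bar> \<le> C + e" "\<And>x. x \<in> K \<Longrightarrow> \<bar>g x - p x\<bar> < e"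
      using trig_approximation[OF sep K(1) continuous_on_subset[OF g(1)] C e] by blast
    have 1: "\<bar>(\<integral>x. g x \<partial>\<nu> n) - (\<integral>x. p x \<partial>\<nu> n)\<bar> \<le> r / 4" for n
      using integral_diff_le_off_compact[OF fin(1) sets(1) B(1) K(2) K(1) g(1) trig_continuous[OF p(1)] C p(2,3) e] tot
      by simp
    have 2: "\<bar>(\<integral>x. g x \<partial>\<nu>0) - (\<integral>x. p x \<partial>\<nu>0)\<bar> \<le> r / 4"
      using integral_diff_le_off_compact[OF fin(2) sets(2) B(2) K(3) K(1) g(1) trig_continuous[OF p(1)] C p(2,3) e] tot
      by simp
    obtain N where "\<And>n. n \<ge> N \<Longrightarrow> norm ((\<integral>x. p x \<partial>\<nu> n) - (\<integral>x. p x \<partial>\<nu>0)) < r / 4"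
      using LIMSEQ_D[OF conv[OF p(1)], of "r / 4"] r by auto
    then have "norm ((\<integral>x. g x \<partial>\<nu> n) - (\<integral>x. g x \<partial>\<nu>0)) < r" if "n \<ge> N" for n
      using 1[of n] 2 that by (fastforce simp: abs_if split: if_splits)
    then show "\<exists>N. \<forall>n\<ge>N. norm ((\<integral>x. g x \<partial>\<nu> n) - (\<integral>x. g x \<partial>\<nu>0)) < r" by blast
  qed
qed

section \<open>Measures determined by their integrals\<close>

lemma finite_measure_eqI_closed:
  fixes m1 m2 :: "'a::metric_space measure"
  assumes fin: "finite_measure m1" "finite_measure m2"
    and sets: "sets m1 = sets borel" "sets m2 = sets borel"
    and eq: "\<And>C. closed C \<Longrightarrow> measure m1 C = measure m2 C"
  shows "m1 = m2"
proof (rule measure_eqI_generator_eq[of "Collect closed" UNIV _ _ "\<lambda>_. UNIV"])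
  interpret m1: finite_measure m1 by fact
  interpret m2: finite_measure m2 by fact
  have *: "sets borel = sigma_sets UNIV (Collect closed :: 'a set set)"
    by (subst borel_eq_closed) (rule sets_measure_of, simp)
  show "sets m1 = sigma_sets UNIV (Collect closed)" "sets m2 = sigma_sets UNIV (Collect closed)"
    using sets * by auto
  show "emeasure m1 X = emeasure m2 X" if "X \<in> Collect closed" for X
    using eq[of X] that by (simp add: m1.emeasure_eq_measure m2.emeasure_eq_measure)
  show "emeasure m1 UNIV \<noteq> \<infinity>" for i :: nat by (simp add: m1.emeasure_eq_measure)
qed (auto simp: Int_stable_def)

text \<open>The indicator of a closed set is the bounded pointwise limit of continuous functions
  that decrease linearly with the distance from the set, and closed sets form an intersection-stable
  generator of the Borel sets.\<close>

lemma finite_measure_eqI_bounded_continuous: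
  fixes m1 m2 :: "'a::metric_space measure"
  assumes fin: "finite_measure m1" "finite_measure m2"
    and sets: "sets m1 = sets borel" "sets m2 = sets borel"
    and eq: "\<And>g::'a \<Rightarrow> real. continuous_on UNIV g \<Longrightarrow> bounded (range g) \<Longrightarrow> (\<integral>x. g x \<partial>m1) = (\<integral>x. g x \<partial>m2)"
  shows "m1 = m2"
proof (rule finite_measure_eqI_closed[OF fin sets])
  fix C :: "'a set" assume C: "closed C"
  show "measure m1 C = measure m2 C"
  \<comment> \<open>By convention \<open>infdist\<close> from the empty set is 0, so the functions
    \<open>g n\<close> would be constantly 1 there.\<close>
  proof (cases "C = {}")
    case False
    define g where "g n x = max 0 (1 - real n * infdist x C)" for n x
    have g: "continuous_on UNIV (g n)" "\<bar>g n x\<bar> \<le> 1" for n x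
      unfolding g_def by (auto intro!: continuous_intros simp: infdist_nonneg)
    have lim: "(\<lambda>n. g n x) \<longlonglongrightarrow> indicator C x" for x
    proof (cases "x \<in> C")
      case True
      then show ?thesis by (simp add: g_def)
    next
      case False
      then have pos: "infdist x C > 0"
        using C \<open>C \<noteq> {}\<close> in_closed_iff_infdist_zero[OF C \<open>C \<noteq> {}\<close>, of x] infdist_nonneg[of x C] by linarith
      obtain N :: nat where N: "1 / infdist x C < N" using reals_Archimedean2 by blast
      have "g n x = 0" if "n \<ge> N" for n
      proof -
        have "1 / infdist x C \<le> real n" using N that by linarith
        then show ?thesis using pos by (simp add: g_def field_simps)
      qed
      then show ?thesis
        using False by (auto intro!: tendsto_eventually eventually_sequentiallyI[of N])
    qed
    have conv: "(\<lambda>n. \<integral>x. g n x \<partial>m) \<longlonglongrightarrow> measure m C" if m: "finite_measure m" "sets m = sets borel" for m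
    proof -
      interpret finite_measure m by fact
      have [measurable]: "C \<in> sets m" "\<And>n. g n \<in> borel_measurable m"
        using m(2) C g(1) by (auto intro: borel_measurable_continuous_onI cong: measurable_cong_sets)
      have "(\<lambda>n. \<integral>x. g n x \<partial>m) \<longlonglongrightarrow> (\<integral>x. indicator C x \<partial>m)"
        by (rule integral_dominated_convergence[where w = "\<lambda>_. 1"]) (use g(2) lim in auto)
      then show ?thesis using sets_eq_imp_space_eq[OF m(2)] by simp
    qed
    have "(\<integral>x. g n x \<partial>m1) = (\<integral>x. g n x \<partial>m2)" for n
      using g by (intro eq boundedI[of _ 1]) auto
    then have "(\<lambda>n. \<integral>x. g n x \<partial>m1) \<longlonglongrightarrow> measure m2 C"
      using conv[OF fin(2) sets(2)] by simp
    with conv[OF fin(1) sets(1)] show ?thesis by (rule LIMSEQ_unique)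
  qed auto
qed

text \<open>Equal integrals of trigonometric polynomials make the constant sequence
  \<open>m1\<close> converge weakly to \<open>m2\<close>; a constant sequence of reals has only one
  limit.\<close>

lemma finite_measure_eqI_trig:
  fixes m1 m2 :: "'a::real_normed_vector measure"
  assumes sep: "\<And>x y :: 'a. x \<noteq> y \<Longrightarrow> \<exists>f::'a dual. f \<cdot> x \<noteq> f \<cdot> y"
    and fin: "finite_measure m1" "finite_measure m2"
    and sets: "sets m1 = sets borel" "sets m2 = sets borel"
    and tight: "\<And>d. d > 0 \<Longrightarrow> \<exists>K. compact K \<and> measure m1 (- K) \<le> d \<and> measure m2 (- K) \<le> d"
    and eq: "\<And>p. trig p \<Longrightarrow> (\<integral>x. p x \<partial>m1) = (\<integral>x. p x \<partial>m2)"
  shows "m1 = m2"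
proof (rule finite_measure_eqI_bounded_continuous[OF fin sets])
  have "weakly_converges (\<lambda>_. m1) m2"
    by (rule weakly_converges_trig[OF sep fin sets, of "max (measure m1 UNIV) (measure m2 UNIV)"])
       (use tight eq in auto)
  then show "(\<integral>x. g x \<partial>m1) = (\<integral>x. g x \<partial>m2)" if "continuous_on UNIV g" "bounded (range g)" for g :: "'a \<Rightarrow> real"
    using that unfolding weakly_converges_def by (blast dest: LIMSEQ_unique[OF tendsto_const])
qed

section \<open>Gaussian laws carried by a fixed finite-dimensional subspace\<close>

lemma compact_combinations:
  fixes b :: "nat \<Rightarrow> 'a::real_normed_vector"
  shows "compact {\<Sum>i<k. c i *\<^sub>R b i | c. \<forall>i<k. \<bar>c i\<bar> \<le> R}"
proof (induction k)
  case (Suc k)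
  let ?K = "\<lambda>k. {\<Sum>i<k. c i *\<^sub>R b i | c. \<forall>i<k. \<bar>c i\<bar> \<le> R}"
  have "?K (Suc k) = (\<lambda>(x, t). x + t *\<^sub>R b k) ` (?K k \<times> {-R..R})" (is "_ = ?I")
  proof (intro equalityI subsetI)
    fix y assume "y \<in> ?K (Suc k)"
    then obtain c where c: "y = (\<Sum>i<Suc k. c i *\<^sub>R b i)" "\<forall>i<Suc k. \<bar>c i\<bar> \<le> R" by blast
    then have "((\<Sum>i<k. c i *\<^sub>R b i), c k) \<in> ?K k \<times> {-R..R}" by (auto simp: abs_le_iff)
    then show "y \<in> ?I" by (rule rev_image_eqI) (simp add: c(1))
  next
    fix y assume "y \<in> ?I"
    then obtain c t where c: "y = (\<Sum>i<k. c i *\<^sub>R b i) + t *\<^sub>R b k" "\<forall>i<k. \<bar>c i\<bar> \<le> R" "\<bar>t\<bar> \<le> R"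
      by (auto simp: abs_le_iff)
    then have "y = (\<Sum>i<Suc k. (c(k := t)) i *\<^sub>R b i)" "\<forall>i<Suc k. \<bar>(c(k := t)) i\<bar> \<le> R"
      by (auto simp: less_Suc_eq intro!: sum.cong)
    then show "y \<in> ?K (Suc k)" by blast
  qed
  moreover have "compact ?I"
    by (intro compact_continuous_image compact_Times Suc) (auto intro!: continuous_intros simp: case_prod_beta)
  ultimately show ?case by simp
qed simp

text \<open>Chebyshev bounds the probability that one coordinate reaches \<open>R\<close> by
  \<open>S / R\<^sup>2\<close>, and the union bound adds this up over \<open>k\<close> coordinates.
  The sets are boxes in the span of the \<open>b i\<close>, because balls of the ambient space need
  not be compact.\<close>

lemma tail_bound_combinations:
  fixes b :: "nat \<Rightarrow> 'a::real_normed_vector" and f :: "nat \<Rightarrow> 'a dual"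
  assumes m: "prob_space m" "sets m = sets borel"
    and law: "\<And>i. i < k \<Longrightarrow> distr m borel (blinfun_apply (f i)) = centered_normal (s i)"
    and s: "\<And>i. i < k \<Longrightarrow> 0 \<le> s i \<and> s i \<le> S" and rep: "AE x in m. x = (\<Sum>i<k. (f i \<cdot> x) *\<^sub>R b i)"
    and R: "R > 0"
  shows "measure m (- {\<Sum>i<k. c i *\<^sub>R b i | c. \<forall>i<k. \<bar>c i\<bar> \<le> R}) \<le> real k * S / R\<^sup>2"
proof -
  interpret prob_space m by fact
  let ?K = "{\<Sum>i<k. c i *\<^sub>R b i | c. \<forall>i<k. \<bar>c i\<bar> \<le> R}"
  have sp: "space m = UNIV" using sets_eq_imp_space_eq[OF m(2)] by simp
  have f[measurable]: "blinfun_apply (f i) \<in> borel_measurable m" for i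
    using m(2) by (auto intro!: borel_measurable_continuous_onI continuous_intros cong: measurable_cong_sets)
  have 1: "measure m {x. R\<^sup>2 \<le> (f i \<cdot> x)\<^sup>2} \<le> S / R\<^sup>2" if "i < k" for i
  proof -
    note int = prob_space_distr_centered_normal[OF law[OF that] _ f] 
    have "measure m {x\<in>space m. (f i \<cdot> x)\<^sup>2 \<ge> R\<^sup>2} \<le> (\<integral>x. (f i \<cdot> x)\<^sup>2 \<partial>m) / R\<^sup>2"
      using int(1) s[OF that] R by (intro integral_Markov_inequality_measure[where A = "space m"]) auto
    also have "\<dots> \<le> S / R\<^sup>2" using int(2) s[OF that] by (simp add: divide_right_mono)
    finally show ?thesis using sp by simp
  qed
  have "AE x in m. x \<notin> ?K \<longrightarrow> x \<in> (\<Union>i<k. {x. R\<^sup>2 \<le> (f i \<cdot> x)\<^sup>2})"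
    using rep
  proof eventually_elim
    case (elim x)
    show ?case
    proof (intro impI)
      assume "x \<notin> ?K"
      have "x \<in> ?K" if "\<forall>i<k. \<bar>f i \<cdot> x\<bar> \<le> R"
        using elim that by (intro CollectI exI[of _ "\<lambda>i. f i \<cdot> x"] conjI)
      with \<open>x \<notin> ?K\<close> have "\<not> (\<forall>i<k. \<bar>f i \<cdot> x\<bar> \<le> R)" by blast
      then obtain i where "i < k" "R \<le> \<bar>f i \<cdot> x\<bar>" by force
      then show "x \<in> (\<Union>i<k. {x. R\<^sup>2 \<le> (f i \<cdot> x)\<^sup>2})"
        using R by (auto simp: abs_le_square_iff[symmetric])
    qed
  qed
  moreover have ms: "{x. R\<^sup>2 \<le> (f i \<cdot> x)\<^sup>2} \<in> sets m" for i
  proof -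
    have "{x \<in> space m. R\<^sup>2 \<le> (f i \<cdot> x)\<^sup>2} \<in> sets m" by measurable
    then show ?thesis by (simp add: sp)
  qed
  moreover have "?K \<in> sets m" using m(2) borel_compact[OF compact_combinations] by simp
  ultimately have "measure m (- ?K) \<le> measure m (\<Union>i<k. {x. R\<^sup>2 \<le> (f i \<cdot> x)\<^sup>2})"
    by (intro finite_measure_mono_AE) (auto intro!: sets.finite_UN)
  also have "\<dots> \<le> (\<Sum>i<k. measure m {x. R\<^sup>2 \<le> (f i \<cdot> x)\<^sup>2})"
    using ms by (intro finite_measure_subadditive_finite) auto
  also have "\<dots> \<le> (\<Sum>i<k. S / R\<^sup>2)" using 1 by (intro sum_mono) auto
  finally show ?thesis by simp
qed

text \<open>The integral of a wave depends on the variance of its functional alone, so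
  \<open>q\<close> alone decides about trigonometric polynomials. Tightness comes from the common
  representation by the coordinates \<open>f i\<close>, whose variances are bounded as convergent
  sequences.\<close>

lemma weakly_converges_gaussian:
  fixes \<nu> :: "nat \<Rightarrow> 'a::real_normed_vector measure" and f :: "nat \<Rightarrow> 'a dual"
  assumes sep: "\<And>x y :: 'a. x \<noteq> y \<Longrightarrow> \<exists>f::'a dual. f \<cdot> x \<noteq> f \<cdot> y"
    and prob: "\<And>n. prob_space (\<nu> n)" "prob_space \<nu>0"
    and sets: "\<And>n. sets (\<nu> n) = sets borel" "sets \<nu>0 = sets borel"
    and law: "\<And>n h. distr (\<nu> n) borel (blinfun_apply h) = centered_normal (q n h)"
      "\<And>h. distr \<nu>0 borel (blinfun_apply h) = centered_normal (q0 h)"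
    and q: "\<And>n h. q n h \<ge> 0" "\<And>h. q0 h \<ge> 0" "\<And>h. (\<lambda>n. q n h) \<longlonglongrightarrow> q0 h"
    and rep: "\<And>n. AE x in \<nu> n. x = (\<Sum>i<k. (f i \<cdot> x) *\<^sub>R b i)"
      "AE x in \<nu>0. x = (\<Sum>i<k. (f i \<cdot> x) *\<^sub>R b i)"
  shows "weakly_converges \<nu> \<nu>0"
proof (rule weakly_converges_trig[OF sep _ _ sets, where B = 1])
  show "finite_measure (\<nu> n)" "finite_measure \<nu>0" "measure (\<nu> n) UNIV \<le> 1" "measure \<nu>0 UNIV \<le> 1" for n
    using prob by (auto intro: prob_space.finite_measure prob_space.prob_le_1)
  show "\<exists>K. compact K \<and> (\<forall>n. measure (\<nu> n) (- K) \<le> d) \<and> measure \<nu>0 (- K) \<le> d" if d: "d > 0" for d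
  proof -
    have "\<exists>B. (\<forall>n. q n (f i) \<le> B) \<and> q0 (f i) \<le> B" for i
    proof -
      obtain B where "\<And>n. norm (q n (f i)) \<le> B"
        using convergent_imp_Bseq[OF convergentI[OF q(3)[of "f i"]]] unfolding Bseq_def by blast
      then show ?thesis by (intro exI[of _ "max B (q0 (f i))"]) (auto simp: le_max_iff_disj abs_le_iff)
    qed
    then obtain Bd where Bd: "\<And>i n. q n (f i) \<le> Bd i" "\<And>i. q0 (f i) \<le> Bd i" by metis
    define S where "S = (\<Sum>i<k. Bd i)"
    have Bd0: "Bd i \<ge> 0" for i using Bd(2)[of i] q(2)[of "f i"] by linarith
    have S: "Bd i \<le> S" if "i < k" for i
      unfolding S_def using that Bd0 by (intro member_le_sum) auto
    have S0: "S \<ge> 0" unfolding S_def by (intro sum_nonneg Bd0)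
    \<comment> \<open>The square root makes \<open>R\<^sup>2\<close> at least
      \<open>real k * S / d\<close>, as the tail bound requires; adding 1 keeps \<open>R\<close>
      positive when \<open>S\<close> vanishes.\<close>
    define R where "R = sqrt (real k * S / d) + 1"
    have R: "R > 0" "real k * S / R\<^sup>2 \<le> d"
    proof -
      have "real k * S / d \<ge> 0" using S0 d by simp
      then show R: "R > 0" unfolding R_def by (simp add: add_nonneg_pos)
      have "real k * S / d = (sqrt (real k * S / d))\<^sup>2" using \<open>real k * S / d \<ge> 0\<close> by simp
      also have "\<dots> \<le> R\<^sup>2" unfolding R_def using \<open>real k * S / d \<ge> 0\<close> by (intro power_mono) auto
      finally show "real k * S / R\<^sup>2 \<le> d" using d R by (simp add: field_simps)
    qed
    let ?K = "{\<Sum>i<k. c i *\<^sub>R b i | c. \<forall>i<k. \<bar>c i\<bar> \<le> R}"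
    have "measure (\<nu> n) (- ?K) \<le> real k * S / R\<^sup>2" for n
      using order_trans[OF Bd(1) S] q(1)
      by (intro tail_bound_combinations[OF prob(1) sets(1) law(1) _ rep(1) R(1)]) auto
    moreover have "measure \<nu>0 (- ?K) \<le> real k * S / R\<^sup>2"
      using order_trans[OF Bd(2) S] q(2)
      by (intro tail_bound_combinations[OF prob(2) sets(2) law(2) _ rep(2) R(1)]) auto
    ultimately show ?thesis using R(2) compact_combinations[where k = k and b = b and R = R] by (meson order_trans)
  qed
  have meas: "blinfun_apply h \<in> borel_measurable (\<nu> n)" "blinfun_apply h \<in> borel_measurable \<nu>0" for n h
    using sets by (auto intro!: borel_measurable_continuous_onI continuous_intros cong: measurable_cong_sets)
  show "(\<lambda>n. \<integral>x. p x \<partial>\<nu> n) \<longlonglongrightarrow> (\<integral>x. p x \<partial>\<nu>0)" if "trig p" for p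
  proof -
    have "(\<forall>n. integrable (\<nu> n) p) \<and> integrable \<nu>0 p \<and> (\<lambda>n. \<integral>x. p x \<partial>\<nu> n) \<longlonglongrightarrow> (\<integral>x. p x \<partial>\<nu>0)"
      using that
    proof (induction rule: trig.induct)
      case (wave a h c)
      have int: "integrable m (\<lambda>x. a * cos (h \<cdot> x + c))" if "prob_space m" "blinfun_apply h \<in> borel_measurable m" for m
      proof -
        interpret prob_space m by fact
        note that(2)[measurable]
        show ?thesis by (intro integrable_mult_right integrable_const_bound[of _ 1]) auto
      qed
      have "(\<lambda>n. a * (cos c * exp (- q n h / 2))) \<longlonglongrightarrow> a * (cos c * exp (- q0 h / 2))"
        by (intro tendsto_intros q) auto
      then have "(\<lambda>n. \<integral>x. a * cos (h \<cdot> x + c) \<partial>\<nu> n) \<longlonglongrightarrow> (\<integral>x. a * cos (h \<cdot> x + c) \<partial>\<nu>0)"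
        by (simp add: prob_space_distr_centered_normal(4)[OF law(1) q(1) meas(1)]
          prob_space_distr_centered_normal(4)[OF law(2) q(2) meas(2)])
      with int[OF prob(1) meas(1)] int[OF prob(2) meas(2)] show ?case by blast
    next
      case (add p r)
      then show ?case by (auto intro!: tendsto_add)
    qed
    then show ?thesis by blast
  qed
qed

lemma gaussian_measure_eqI:
  fixes m1 m2 :: "'a::real_normed_vector measure" and f :: "nat \<Rightarrow> 'a dual"
  assumes sep: "\<And>x y :: 'a. x \<noteq> y \<Longrightarrow> \<exists>f::'a dual. f \<cdot> x \<noteq> f \<cdot> y"
    and prob: "prob_space m1" "prob_space m2"
    and sets: "sets m1 = sets borel" "sets m2 = sets borel"
    and law: "\<And>h. distr m1 borel (blinfun_apply h) = centered_normal (q h)"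
      "\<And>h. distr m2 borel (blinfun_apply h) = centered_normal (q h)"
    and q: "\<And>h. q h \<ge> 0"
    and rep: "AE x in m1. x = (\<Sum>i<k. (f i \<cdot> x) *\<^sub>R b i)" "AE x in m2. x = (\<Sum>i<k. (f i \<cdot> x) *\<^sub>R b i)"
  shows "m1 = m2"
proof (rule finite_measure_eqI_bounded_continuous[OF _ _ sets])
  show "finite_measure m1" "finite_measure m2" using prob by (auto intro: prob_space.finite_measure)
  have "weakly_converges (\<lambda>_. m1) m2"
    by (rule weakly_converges_gaussian[OF sep prob sets law q q tendsto_const rep])
  then show "(\<integral>x. g x \<partial>m1) = (\<integral>x. g x \<partial>m2)" if "continuous_on UNIV g" "bounded (range g)" for g :: "'a \<Rightarrow> real"
    using that unfolding weakly_converges_def by (blast dest: LIMSEQ_unique[OF tendsto_const])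
qed

section \<open>The Hilbert space structure\<close>

locale covariance_operator =
  fixes Q :: "'b::{banach, second_countable_topology} dual \<Rightarrow> 'b"
  assumes Q_linear: "linear Q" and Q_bij: "bij Q"
    and Q_symmetric: "f \<cdot> Q g = g \<cdot> Q f"
    and Q_positive: "f \<noteq> 0 \<Longrightarrow> f \<cdot> Q f > 0"
begin

abbreviation ip :: "'b \<Rightarrow> 'b \<Rightarrow> real" where "ip \<equiv> qinner Q"

lemma Q_inv [simp]: "Q (inv Q u) = u" "inv Q (Q f) = f"
  using Q_bij by (simp_all add: bij_is_surj surj_f_inv_f bij_is_inj)

lemma ip_eq_pairing: "ip u w = inv Q u \<cdot> w" by (simp add: qinner_def)

lemma ip_Q [simp]: "ip (Q f) w = f \<cdot> w" by (simp add: qinner_def)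

lemma ip_commute: "ip u w = ip w u"
  using Q_symmetric[of "inv Q u" "inv Q w"] by (simp add: qinner_def)

lemma linear_ip_right: "linear (ip u)"
  by (simp add: ip_eq_pairing linear_iff blinfun.add_right blinfun.scaleR_right)

lemma ip_simps [simp]:
  "ip u (v + w) = ip u v + ip u w" "ip u (v - w) = ip u v - ip u w" "ip u (- v) = - ip u v"
  "ip u (a *\<^sub>R v) = a * ip u v" "ip u 0 = 0" "ip u (sum g I) = (\<Sum>i\<in>I. ip u (g i))"
  "ip (v + w) u = ip v u + ip w u" "ip (v - w) u = ip v u - ip w u" "ip (- v) u = - ip v u"
  "ip (a *\<^sub>R v) u = a * ip v u" "ip 0 u = 0" "ip (sum g I) u = (\<Sum>i\<in>I. ip (g i) u)"
  using linear_ip_right[of u]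
  by (simp_all add: ip_commute[of _ u] linear_add linear_diff linear_neg linear_scale linear_0 linear_sum)

lemma linear_inv_Q: "linear (inv Q)"
  by (rule linearI; metis Q_inv linear_add[OF Q_linear] linear_scale[OF Q_linear])

lemma ip_pos: "u \<noteq> 0 \<Longrightarrow> ip u u > 0"
  using Q_positive[of "inv Q u"] Q_inv(1)[of u] linear_0[OF Q_linear]
  unfolding qinner_def by metis

lemma ip_nonneg [simp]: "ip u u \<ge> 0"
  using ip_pos[of u] by (cases "u = 0") auto

lemma ip_eq_0_iff [simp]: "ip u u = 0 \<longleftrightarrow> u = 0"
  using ip_pos[of u] by (cases "u = 0") auto

lemma qnorm_nonneg [simp]: "qnorm Q u \<ge> 0" by (simp add: qnorm_def)

lemma qnorm_square [simp]: "(qnorm Q u)\<^sup>2 = ip u u" by (simp add: qnorm_def)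

lemma qnorm_pos: "u \<noteq> 0 \<Longrightarrow> qnorm Q u > 0" using ip_pos by (simp add: qnorm_def)

text \<open>The functional \<open>inv Q (x - y)\<close> separates, since its value at
  \<open>x - y\<close> is the positive square of the Q-norm.\<close>

lemma dual_separates: "x \<noteq> y \<Longrightarrow> \<exists>f::'b dual. f \<cdot> x \<noteq> f \<cdot> y"
  using ip_pos[of "x - y"] by (intro exI[of _ "inv Q (x - y)"]) (simp add: ip_eq_pairing blinfun.diff_right)

text \<open>By symmetry the functionals \<open>inv Q u\<close> with \<open>u\<close> in the unit ball are pointwise bounded, so
  this is an instance of the uniform boundedness principle.\<close>

lemma inv_Q_bounded: "\<exists>C. \<forall>u. norm (inv Q u) \<le> C * norm u"
proof -
  define F where "F n = {w. norm (inv Q w) \<le> real n}" for n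
  have F_alt: "F n = (\<Inter>u\<in>cball 0 1. {w. \<bar>inv Q u \<cdot> w\<bar> \<le> real n})" for n
  proof (intro equalityI subsetI INT_I CollectI)
    fix w u :: 'b assume "w \<in> F n" "u \<in> cball 0 1"
    have "\<bar>inv Q u \<cdot> w\<bar> = \<bar>inv Q w \<cdot> u\<bar>" using ip_commute by (simp add: qinner_def)
    also have "\<dots> \<le> norm (inv Q w) * norm u" using norm_blinfun[of "inv Q w" u] by simp
    also have "\<dots> \<le> real n * 1" using \<open>w \<in> F n\<close> \<open>u \<in> cball 0 1\<close> by (intro mult_mono) (auto simp: F_def)
    finally show "\<bar>inv Q u \<cdot> w\<bar> \<le> real n" by simp
  next
    fix w assume w: "w \<in> (\<Inter>u\<in>cball 0 1. {w. \<bar>inv Q u \<cdot> w\<bar> \<le> real n})"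
    have "norm (inv Q w \<cdot> x) \<le> real n * norm x" for x
    proof (cases "x = 0")
      case False
      have "inverse (norm x) *\<^sub>R x \<in> cball 0 1" using False by simp
      then have "\<bar>ip (inverse (norm x) *\<^sub>R x) w\<bar> \<le> real n" using w by (auto simp: qinner_def simp del: ip_simps)
      then have "\<bar>ip w x\<bar> \<le> real n * norm x"
        using False by (simp add: ip_commute abs_mult field_simps)
      then show ?thesis by (simp add: qinner_def)
    qed simp
    then show "w \<in> F n" unfolding F_def by (auto intro: norm_blinfun_bound)
  qed
  have cl: "closed (F n)" for n
    unfolding F_alt by (intro closed_INT ballI closed_Collect_le continuous_intros)
  \<comment> \<open>The closed sets \<open>F n\<close> cover a complete space, so by the Baire
    category theorem one of them has an interior point.\<close>
  have "\<exists>n. interior (F n) \<noteq> {}"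
  proof (rule ccontr)
    assume "\<nexists>n. interior (F n) \<noteq> {}"
    then have "euclidean interior_of (\<Union>(range F)) = {}"
      using cl by (intro Baire_category_alt disjI1 completely_metrizable_space_euclidean) auto
    moreover have "\<Union>(range F) = UNIV"
      using real_arch_simple unfolding F_def by blast
    ultimately show False by simp
  qed
  then obtain n w where "w \<in> interior (F n)" by blast
  then obtain r where r: "r > 0" "cball w r \<subseteq> F n" unfolding mem_interior_cball by blast
  have "norm (inv Q u) \<le> (2 * real n / r) * norm u" for u
  proof (cases "u = 0")
    case False
    \<comment> \<open>Rescaled to norm \<open>r\<close>, the vector keeps \<open>w + v\<close>
      inside the ball contained in \<open>F n\<close>; writing \<open>v\<close> as a difference of
      two members of \<open>F n\<close> produces the factor 2.\<close>
    define v where "v = (r / norm u) *\<^sub>R u"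
    have "w + v \<in> F n" "w \<in> F n" using r False by (auto simp: v_def dist_norm intro!: subsetD[OF r(2)])
    moreover have "inv Q v = inv Q (w + v) - inv Q w" using linear_add[OF linear_inv_Q] by simp
    ultimately have "norm (inv Q v) \<le> 2 * real n"
      using norm_triangle_ineq4[of "inv Q (w + v)" "inv Q w"] by (simp add: F_def)
    then have "r / norm u * norm (inv Q u) \<le> 2 * real n"
      using r(1) by (simp add: v_def linear_scale[OF linear_inv_Q])
    then show ?thesis using r(1) False by (simp add: field_simps)
  qed (simp add: linear_0[OF linear_inv_Q])
  then show ?thesis by blast
qed

lemma bounded_linear_inv_Q: "bounded_linear (inv Q)"
  using inv_Q_bounded linear_inv_Q
  by (auto simp: bounded_linear_def bounded_linear_axioms_def mult.commute)

lemma continuous_ip [continuous_intros]: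
  "continuous_on S f \<Longrightarrow> continuous_on S g \<Longrightarrow> continuous_on S (\<lambda>x. ip (f x) (g x))"
  unfolding qinner_def
  by (intro continuous_intros bounded_linear.continuous_on[OF bounded_linear_inv_Q])

lemma continuous_qnorm [continuous_intros]: "continuous_on S f \<Longrightarrow> continuous_on S (\<lambda>x. qnorm Q (f x))"
  unfolding qnorm_def by (intro continuous_intros)

section \<open>Orthonormal systems and expansions\<close>

definition orthosystem :: "(nat \<Rightarrow> 'b) \<Rightarrow> bool" where
  "orthosystem e \<longleftrightarrow> (\<forall>i j. i \<noteq> j \<longrightarrow> ip (e i) (e j) = 0) \<and> (\<forall>i. e i = 0 \<or> ip (e i) (e i) = 1)"

definition fourier_sum :: "(nat \<Rightarrow> 'b) \<Rightarrow> nat \<Rightarrow> 'b \<Rightarrow> 'b" where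
  "fourier_sum e n u = (\<Sum>k<n. ip (e k) u *\<^sub>R e k)"

lemma ip_residual: "orthosystem e \<Longrightarrow> j < n \<Longrightarrow> ip (e j) (u - fourier_sum e n u) = 0"
proof -
  assume e: "orthosystem e" and j: "j < n"
  have "(\<Sum>k<n. ip (e k) u * ip (e j) (e k)) = (\<Sum>k<n. if k = j then ip (e j) u else 0)"
  proof (intro sum.cong refl)
    fix k
    have "ip (e j) (e k) = 0" if "k \<noteq> j" using e that by (simp add: orthosystem_def)
    moreover have "e j = 0 \<or> ip (e j) (e j) = 1" using e by (simp add: orthosystem_def)
    ultimately show "ip (e k) u * ip (e j) (e k) = (if k = j then ip (e j) u else 0)"
      by (auto simp del: ip_eq_0_iff)
  qed
  then show ?thesis using j by (simp add: fourier_sum_def)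
qed

lemma ip_span_residual:
  assumes "orthosystem e" "y \<in> span (e ` {..<n})"
  shows "ip y (u - fourier_sum e n u) = 0"
  using assms(2) by (induction rule: span_induct_alt) (use ip_residual[OF assms(1)] in \<open>auto simp del: ip_simps(2)\<close>)

lemma fourier_sum_in_span: "fourier_sum e n u \<in> span (e ` {..<n})"
  unfolding fourier_sum_def by (intro span_sum span_scale span_base) auto

lemma norm_residual:
  assumes "orthosystem e"
  shows "ip (u - fourier_sum e n u) (u - fourier_sum e n u) = ip u u - (\<Sum>k<n. (ip (e k) u)\<^sup>2)"
proof -
  have "ip (u - fourier_sum e n u) (u - fourier_sum e n u) = ip u (u - fourier_sum e n u)"
    using ip_span_residual[OF assms fourier_sum_in_span, of n u u] by simp
  moreover have "ip u (fourier_sum e n u) = (\<Sum>k<n. (ip (e k) u)\<^sup>2)"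
    by (simp add: fourier_sum_def power2_eq_square ip_commute[of u "e _"])
  ultimately show ?thesis by simp
qed

text \<open>Pythagoras: \<open>u - y\<close> is the residual plus a vector of the span, and the
  residual is orthogonal to the span.\<close>

lemma residual_minimal:
  assumes "orthosystem e" "y \<in> span (e ` {..<n})"
  shows "ip (u - fourier_sum e n u) (u - fourier_sum e n u) \<le> ip (u - y) (u - y)"
proof -
  let ?r = "u - fourier_sum e n u" and ?z = "fourier_sum e n u - y"
  have z: "ip ?z ?r = 0"
    by (rule ip_span_residual[OF assms(1)]) (intro span_diff fourier_sum_in_span assms(2))
  have "ip (u - y) (u - y) = ip (?r + ?z) (?r + ?z)" by simp
  also have "\<dots> = ip ?r ?r + ip ?z ?z + 2 * ip ?z ?r"
    by (simp only: ip_simps(1,7)) (simp only: ip_commute[of ?r ?z])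
  finally show ?thesis using z ip_nonneg[of ?z] by linarith
qed

text \<open>A vector that depends on its predecessors has residual 0 and yields the vector 0.
  Instead of deleting such entries, \<open>orthosystem\<close> admits zero vectors, so that any
  sequence can be processed with its indexing intact.\<close>

function gram_schmidt :: "(nat \<Rightarrow> 'b) \<Rightarrow> nat \<Rightarrow> 'b" where
  "gram_schmidt d n =
    (let r = d n - (\<Sum>k\<in>{..<n}. ip (gram_schmidt d k) (d n) *\<^sub>R gram_schmidt d k)
     in inverse (qnorm Q r) *\<^sub>R r)"
  by pat_completeness auto
termination by (relation "Wellfounded.measure snd") auto

declare gram_schmidt.simps [simp del]

lemma gram_schmidt_residual:
  "gram_schmidt d n = inverse (qnorm Q (d n - fourier_sum (gram_schmidt d) n (d n))) *\<^sub>R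
     (d n - fourier_sum (gram_schmidt d) n (d n))"
  by (subst gram_schmidt.simps) (simp add: Let_def fourier_sum_def)

lemma orthosystem_gram_schmidt: "orthosystem (gram_schmidt d)"
proof -
  let ?e = "gram_schmidt d"
  have 1: "?e n = 0 \<or> ip (?e n) (?e n) = 1" for n
  proof (cases "d n - fourier_sum ?e n (d n) = 0")
    case False
    define r where "r = d n - fourier_sum ?e n (d n)"
    have "qnorm Q r > 0" using False by (simp add: r_def qnorm_pos)
    moreover have "ip r r = (qnorm Q r)\<^sup>2" by simp
    ultimately have "inverse (qnorm Q r) * (inverse (qnorm Q r) * ip r r) = 1"
      by (simp only:) (simp add: power2_eq_square field_simps)
    moreover have "?e n = inverse (qnorm Q r) *\<^sub>R r" unfolding r_def by (rule gram_schmidt_residual)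
    ultimately show ?thesis by simp
  next
    case True
    then show ?thesis using gram_schmidt_residual[of d n] by (simp only: True scaleR_zero_right simp_thms)
  qed
  have 2: "\<forall>i<n. \<forall>j<n. i \<noteq> j \<longrightarrow> ip (?e i) (?e j) = 0" for n
  proof (induction n)
    case (Suc n)
    \<comment> \<open>At this stage orthogonality is known below \<open>n\<close> only; padding with
      zeros gives a genuine \<open>orthosystem\<close> to which the facts on residuals
      apply.\<close>
    define e' where "e' k = (if k < n then ?e k else 0)" for k
    have "orthosystem e'" using Suc 1 by (auto simp: orthosystem_def e'_def)
    have "fourier_sum e' n (d n) = fourier_sum ?e n (d n)" unfolding fourier_sum_def e'_def by (intro sum.cong) auto
    then have "ip (?e j) (d n - fourier_sum ?e n (d n)) = 0" if "j < n" for j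
      using ip_residual[OF \<open>orthosystem e'\<close> that, of "d n"] that by (simp add: e'_def del: ip_simps(2))
    then have *: "ip (?e j) (?e n) = 0" if "j < n" for j
      using that by (subst (2) gram_schmidt_residual) (simp del: ip_simps(2))
    show ?case
    proof (intro allI impI)
      fix i j assume "i < Suc n" "j < Suc n" "i \<noteq> j"
      then show "ip (?e i) (?e j) = 0"
        using * Suc by (auto simp: less_Suc_eq ip_commute[of "?e n"])
    qed
  qed simp
  have "ip (?e i) (?e j) = 0" if "i \<noteq> j" for i j
    using 2[of "Suc (max i j)"] that by (auto simp: less_Suc_eq_le)
  with 1 show ?thesis by (auto simp: orthosystem_def)
qed

lemma gram_schmidt_span: "k < n \<Longrightarrow> d k \<in> span (gram_schmidt d ` {..<n})"
proof -
  assume k: "k < n"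
  let ?e = "gram_schmidt d"
  define r where "r = d k - fourier_sum ?e k (d k)"
  have e: "?e k = inverse (qnorm Q r) *\<^sub>R r" unfolding r_def by (rule gram_schmidt_residual)
  have "r = qnorm Q r *\<^sub>R ?e k"
    using qnorm_pos[of r] by (cases "r = 0") (auto simp: e)
  moreover have "?e k \<in> span (?e ` {..<n})" using k by (intro span_base) auto
  ultimately have "r \<in> span (?e ` {..<n})" by (metis span_scale)
  moreover have "fourier_sum ?e k (d k) \<in> span (?e ` {..<n})"
    using fourier_sum_in_span[of ?e k "d k"] span_mono[of "?e ` {..<k}" "?e ` {..<n}"] k by fastforce
  ultimately have "r + fourier_sum ?e k (d k) \<in> span (?e ` {..<n})" by (rule span_add)
  then show ?thesis by (simp add: r_def)
qed

text \<open>For \<open>x\<close> in the span, minimality of the residual compared with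
  \<open>y = x\<close> forces the residual to vanish. This supplies coordinates whenever a measure
  or a map lives on a finite-dimensional subspace.\<close>

lemma finite_orthonormal:
  assumes "finite S"
  obtains e k where "orthosystem e" "\<And>x. x \<in> span S \<Longrightarrow> x = (\<Sum>i<k. ip (e i) x *\<^sub>R e i)"
    "\<And>x. x \<in> span S \<Longrightarrow> ip x x = (\<Sum>i<k. (ip (e i) x)\<^sup>2)"
proof -
  obtain k :: nat and d where d: "S = d ` {..<k}"
    using assms finite_imp_nat_seg_image_inj_on[of S] by (metis lessThan_def)
  let ?e = "gram_schmidt d"
  have "span S \<subseteq> span (?e ` {..<k})"
    using d gram_schmidt_span[of _ k d] by (intro span_minimal) auto
  moreover have "x = fourier_sum ?e k x" if "x \<in> span (?e ` {..<k})" for x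
  proof -
    define r where "r = x - fourier_sum ?e k x"
    have "ip r r \<le> 0" using residual_minimal[OF orthosystem_gram_schmidt that, of x] by (simp add: r_def)
    then have "r = 0" using ip_pos[of r] by force
    then show ?thesis by (simp add: r_def)
  qed
  ultimately have *: "x = fourier_sum ?e k x" if "x \<in> span S" for x
    using that by blast
  have "ip x x = (\<Sum>i<k. (ip (?e i) x)\<^sup>2)" if "x \<in> span S" for x
    using norm_residual[OF orthosystem_gram_schmidt, of x d k] *[OF that] by simp
  with * show ?thesis
    using that[OF orthosystem_gram_schmidt[of d], of k] unfolding fourier_sum_def by blast
qed

text \<open>Gram-Schmidt is applied to a dense sequence \<open>d\<close>. After more than
  \<open>k\<close> steps the residual of \<open>u\<close> is no longer than \<open>u - d k\<close>,
  and by continuity of \<open>ip\<close> density in the original topology makes this arbitrarily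
  small in the Q-norm. If only finitely many \<open>e k\<close> were nonzero, Parseval would leave
  no residual and the space would be a finite span.\<close>

lemma exists_orthonormal_basis:
  obtains e where "orthosystem e" "\<And>u. (\<lambda>k. (ip (e k) u)\<^sup>2) sums ip u u"
    "infinite_dimensional TYPE('b) \<Longrightarrow> infinite {k. e k \<noteq> 0}"
proof -
  obtain D :: "'b set" where D: "countable D" "\<forall>X. open X \<longrightarrow> X \<noteq> {} \<longrightarrow> (\<exists>d\<in>D. d \<in> X)"
    using countable_dense_exists[where 'a = 'b] by auto
  have "D \<noteq> {}" using D(2) by auto
  define d where "d = from_nat_into D"
  have d: "\<exists>k. d k \<in> X" if "open X" "X \<noteq> {}" for X
    using D(2)[rule_format, OF that] from_nat_into_surj[OF D(1)] unfolding d_def by metis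
  let ?e = "gram_schmidt d"
  note o = orthosystem_gram_schmidt[of d]
  have sums: "(\<lambda>k. (ip (?e k) u)\<^sup>2) sums ip u u" for u
    unfolding sums_def
  proof (rule LIMSEQ_I)
    fix r :: real assume r: "r > 0"
    have "open {y. ip (u - y) (u - y) < r}"
      by (intro open_Collect_less continuous_intros)
    moreover have "u \<in> {y. ip (u - y) (u - y) < r}" using r by simp
    ultimately obtain k where k: "ip (u - d k) (u - d k) < r" using d by blast
    show "\<exists>N. \<forall>n\<ge>N. norm ((\<Sum>k<n. (ip (?e k) u)\<^sup>2) - ip u u) < r"
    proof (intro exI allI impI)
      fix n assume "n \<ge> Suc k"
      have "ip (u - fourier_sum ?e n u) (u - fourier_sum ?e n u) < r"
        using residual_minimal[OF o gram_schmidt_span[of k n d], of u] k \<open>n \<ge> Suc k\<close> by linarith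
      with norm_residual[OF o, of u n] ip_nonneg[of "u - fourier_sum ?e n u"]
      show "norm ((\<Sum>k<n. (ip (?e k) u)\<^sup>2) - ip u u) < r" by simp
    qed
  qed
  moreover have "infinite {k. ?e k \<noteq> 0}" if inf: "infinite_dimensional TYPE('b)"
  proof
    assume "finite {k. ?e k \<noteq> 0}"
    then obtain N where N: "\<And>k. ?e k \<noteq> 0 \<Longrightarrow> k < N"
      using finite_nat_set_iff_bounded[of "{k. ?e k \<noteq> 0}"] by blast
    have "u \<in> span (?e ` {..<N})" for u
    proof -
      have "(\<lambda>k. (ip (?e k) u)\<^sup>2) sums (\<Sum>k<N. (ip (?e k) u)\<^sup>2)"
        using N by (intro sums_finite) (auto, metis ip_simps(11))
      then have "ip u u = (\<Sum>k<N. (ip (?e k) u)\<^sup>2)" using sums sums_unique2 by blast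
      with norm_residual[OF o, of u N] have "u - fourier_sum ?e N u = 0"
        using ip_eq_0_iff[of "u - fourier_sum ?e N u"] by (simp del: ip_simps ip_eq_0_iff)
      then show ?thesis using fourier_sum_in_span[of ?e N u] by simp
    qed
    then have "finite (?e ` {..<N}) \<and> span (?e ` {..<N}) = UNIV" by auto
    with inf show False unfolding infinite_dimensional_def by blast
  qed
  ultimately show ?thesis using that[OF o] by blast
qed

end

section \<open>The orthogonal projection onto the measurements\<close>

text \<open>Every set in the sigma-algebra of the measurements contains both or neither of two
  points with equal measurements. Applied to the preimage of the point \<open>v x\<close>, this
  replaces a factorization of \<open>v\<close> through the measurement vector.\<close>

lemma L_Phi_cong:
  fixes v :: "'b::real_normed_vector \<Rightarrow> 'b"
  assumes v: "v \<in> L_Phi phi" and eq: "\<And>i. phi i \<cdot> x = phi i \<cdot> y"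
  shows "v x = v y"
proof -
  have sat: "x \<in> A \<longleftrightarrow> y \<in> A"
    if "A \<in> sigma_sets UNIV {blinfun_apply (phi i) -` A | i A. A \<in> sets borel}" for A
    using that by (induction rule: sigma_sets.induct) (auto simp: eq)
  have "v -` {v x} \<inter> space (sigma_Phi phi) \<in> sets (sigma_Phi phi)"
    using v unfolding L_Phi_def by (rule measurable_sets) simp
  then have "v -` {v x} \<in> sigma_sets UNIV {blinfun_apply (phi i) -` A | i A. A \<in> sets borel}"
    by (simp add: sigma_Phi_def)
  from sat[OF this] show ?thesis by simp
qed

lemma measurable_sigma_Phi: "blinfun_apply (phi i) \<in> borel_measurable (sigma_Phi phi)"
  by (rule measurableI) (auto simp: sigma_Phi_def intro!: sigma_sets.Basic)

lemma L_Phi_borel_measurable: "v \<in> L_Phi phi \<Longrightarrow> v \<in> borel_measurable borel"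
proof -
  have "sets (sigma_Phi phi) \<subseteq> sets borel"
  proof -
    have "blinfun_apply (phi i) -` A \<in> sets borel" if "A \<in> sets borel" for i and A :: "real set"
    proof -
      have "blinfun_apply (phi i) \<in> borel_measurable borel"
        by (intro borel_measurable_continuous_onI continuous_intros)
      from measurable_sets[OF this that] show ?thesis by simp
    qed
    then show ?thesis
      unfolding sigma_Phi_def by (subst sets_measure_of) (auto intro!: sets.sigma_sets_subset[where M = borel, simplified])
  qed
  then show "v \<in> L_Phi phi \<Longrightarrow> v \<in> borel_measurable borel"
    unfolding L_Phi_def by (auto simp: measurable_def sigma_Phi_def)
qed

locale measurement_system = covariance_operator Q
  for Q :: "'b::{banach, second_countable_topology} dual \<Rightarrow> 'b" +
  fixes phi :: "'m::finite \<Rightarrow> 'b dual"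
  assumes phi_inj: "inj phi" and phi_independent: "independent (range phi)"
begin

text \<open>The quadratic form of \<open>Theta\<close> at \<open>c\<close> is
  \<open>f \<cdot> Q f\<close> for the combination \<open>f\<close> of the \<open>phi i\<close> with
  coefficients \<open>c\<close>. Positivity of \<open>Q\<close> gives \<open>f = 0\<close>, and
  independence gives \<open>c = 0\<close>.\<close>

lemma Theta_mult_eq_0:
  assumes "Theta Q phi *v c = 0"
  shows "c = 0"
proof -
  define f where "f = (\<Sum>i\<in>UNIV. (c $ i) *\<^sub>R phi i)"
  have Qf: "Q f = (\<Sum>i\<in>UNIV. (c $ i) *\<^sub>R Q (phi i))"
    by (simp add: f_def linear_sum[OF Q_linear] linear_scale[OF Q_linear])
  have "phi i \<cdot> Q f = (Theta Q phi *v c) $ i" for i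
    by (simp add: Qf Theta_def matrix_vector_mult_def blinfun.sum_right blinfun.scaleR_right mult.commute)
  then have "f \<cdot> Q f = 0"
    using assms by (subst (1) f_def) (simp add: blinfun.sum_left blinfun.scaleR_left)
  then have "f = 0" using Q_positive[of f] by force
  have "(\<Sum>g\<in>range phi. (c $ inv phi g) *\<^sub>R g) = f"
    unfolding f_def using phi_inj by (subst sum.reindex) auto
  then have "c $ inv phi (phi i) = 0" for i
    using independentD[OF phi_independent, of "range phi" "\<lambda>g. c $ inv phi g" "phi i"] \<open>f = 0\<close> by simp
  then show ?thesis using phi_inj by (simp add: vec_eq_iff)
qed

lemma Theta_inverse: "Theta Q phi ** matrix_inv (Theta Q phi) = mat 1"
    "matrix_inv (Theta Q phi) ** Theta Q phi = mat 1"
proof -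
  have "\<exists>B. B ** Theta Q phi = mat 1"
    using Theta_mult_eq_0 by (subst matrix_left_invertible_ker) blast
  then have "\<exists>B. Theta Q phi ** B = mat 1 \<and> B ** Theta Q phi = mat 1"
    using invertible_left_inverse unfolding invertible_def by blast
  then show "Theta Q phi ** matrix_inv (Theta Q phi) = mat 1"
    "matrix_inv (Theta Q phi) ** Theta Q phi = mat 1"
    unfolding matrix_inv_def by (metis (mono_tags, lifting) someI_ex)+
qed

abbreviation \<psi> :: "'m \<Rightarrow> 'b" where "\<psi> \<equiv> gamblet Q phi"

lemma phi_gamblet: "phi i \<cdot> \<psi> j = (if i = j then 1 else 0)"
proof -
  have "phi i \<cdot> \<psi> j = (matrix_inv (Theta Q phi) ** Theta Q phi) $ j $ i"
    using Q_symmetric[of "phi i"]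
    by (simp add: gamblet_def matrix_matrix_mult_def Theta_def blinfun.sum_right blinfun.scaleR_right)
  then show ?thesis by (simp add: Theta_inverse mat_def)
qed

lemma inv_Q_gamblet: "inv Q (\<psi> i) = (\<Sum>j\<in>UNIV. (matrix_inv (Theta Q phi) $ i $ j) *\<^sub>R phi j)"
  by (simp add: gamblet_def linear_sum[OF linear_inv_Q] linear_scale[OF linear_inv_Q])

text \<open>Expanding in the gamblets, which are biorthogonal to the \<open>phi i\<close>, shows
  that \<open>P u\<close> is a function of the measurements of \<open>u\<close>, so membership in
  \<open>L_Phi\<close> is immediate.\<close>

definition P :: "'b \<Rightarrow> 'b" where
  "P u = (\<Sum>i\<in>UNIV. (phi i \<cdot> u) *\<^sub>R \<psi> i)"

lemma linear_P: "linear P"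
  unfolding P_def
  by (intro linearI) (simp_all add: blinfun.add_right blinfun.scaleR_right scaleR_add_left sum.distrib scaleR_sum_right)

lemma P_simps [simp]: "P (u + w) = P u + P w" "P (u - w) = P u - P w" "P (- u) = - P u"
    "P (a *\<^sub>R u) = a *\<^sub>R P u" "P 0 = 0" "P (sum g I) = (\<Sum>i\<in>I. P (g i))"
  using linear_P by (simp_all add: linear_add linear_diff linear_neg linear_scale linear_0 linear_sum)

lemma phi_P [simp]: "phi i \<cdot> P u = phi i \<cdot> u"
proof -
  have "phi i \<cdot> P u = (\<Sum>j\<in>UNIV. if i = j then phi j \<cdot> u else 0)"
    unfolding P_def blinfun.sum_right blinfun.scaleR_right phi_gamblet
    by (intro sum.cong) auto
  then show ?thesis by simp
qed

lemma P_P [simp]: "P (P u) = P u"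
  by (subst (1 3) P_def) simp

lemma inv_Q_P_in_span: "inv Q (P u) \<in> span (range phi)"
  unfolding P_def
  by (simp add: linear_sum[OF linear_inv_Q] linear_scale[OF linear_inv_Q] inv_Q_gamblet)
     (intro span_sum span_scale span_base, auto)

text \<open>The functional \<open>inv Q (P u)\<close> is a combination of the \<open>phi i\<close>,
  all of which vanish on residuals \<open>w - P w\<close>.\<close>

lemma P_orthogonal: "ip (P u) (w - P w) = 0"
  by (simp add: P_def[of u] inv_Q_gamblet ip_eq_pairing[of "\<psi> _"] blinfun.sum_left blinfun.scaleR_left
      blinfun.diff_right del: ip_simps(2))

lemma P_symmetric: "ip (P u) w = ip u (P w)"
  using P_orthogonal[of u w] P_orthogonal[of w u] ip_commute[of "P w" u] ip_commute[of "P w" "P u"] by simp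

lemma ip_P_P: "ip (P u) (P u) + ip (u - P u) (u - P u) = ip u u"
  using P_orthogonal[of u u] ip_commute[of u "P u"] by simp

lemma ip_residual_le: "ip (u - P u) (u - P u) \<le> ip u u"
  using ip_P_P[of u] ip_nonneg[of "P u"] by linarith

lemma P_in_L_Phi: "P \<in> L_Phi phi"
  unfolding L_Phi_def P_def
  by (intro borel_measurable_sum borel_measurable_scaleR measurable_sigma_Phi borel_measurable_const)

lemma continuous_P [continuous_intros]: "continuous_on S f \<Longrightarrow> continuous_on S (\<lambda>x. P (f x))"
  unfolding P_def by (intro continuous_intros)

text \<open>The reflection \<open>u - P u \<mapsto> P u - u\<close> is invisible to the measurements; a strategy that only
  depends on them has to serve both points, and the parallelogram law bounds its loss.\<close>

lemma reflected_loss: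
  assumes "v \<in> L_Phi phi"
  shows "2 * ip (x - P x) (x - P x) \<le> ip (x - v x) (x - v x) + ip ((2 *\<^sub>R P x - x) - v (2 *\<^sub>R P x - x)) ((2 *\<^sub>R P x - x) - v (2 *\<^sub>R P x - x))"
proof -
  \<comment> \<open>The point and its reflection are \<open>P x + b\<close> and
    \<open>P x - b\<close>; the strategy has the same value at both, so the errors are
    \<open>a + b\<close> and \<open>a - b\<close>.\<close>
  define a b where "a = P x - v x" and "b = x - P x"
  have "v (2 *\<^sub>R P x - x) = v x"
    by (rule L_Phi_cong[OF assms]) (simp add: blinfun.diff_right blinfun.scaleR_right)
  then have "x - v x = a + b" "(2 *\<^sub>R P x - x) - v (2 *\<^sub>R P x - x) = a - b"
    by (simp_all add: a_def b_def scaleR_2)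
  moreover have "ip (a + b) (a + b) + ip (a - b) (a - b) = 2 * ip a a + 2 * ip b b" by simp
  ultimately show ?thesis using ip_nonneg[of a] by (simp only: b_def[symmetric])
qed

lemma minmax_optimal_P: "minmax_optimal Q phi P"
proof -
  have "worst_loss Q P \<le> worst_loss Q w" if w: "w \<in> L_Phi phi" for w
    unfolding worst_loss_def[of Q P]
  proof (rule SUP_least)
    fix u :: 'b assume "u \<in> - {0}"
    show "ennreal (qnorm Q (u - P u) / qnorm Q u) \<le> worst_loss Q w"
    proof (cases "u = P u")
      case True
      then show ?thesis by (simp add: qnorm_def)
    next
      case False
      define k where "k = u - P u"
      have k: "k \<noteq> 0" "P k = 0" using False by (auto simp: k_def)
      have qn: "qnorm Q (- k) = qnorm Q k" by (simp add: qnorm_def)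
      \<comment> \<open>Since \<open>P k = 0\<close>, the reflection of \<open>k\<close> is
        \<open>- k\<close>. At one of the two points \<open>w\<close> has a loss ratio of at least
        1, while the ratio of \<open>P\<close> never exceeds 1.\<close>
      have "\<exists>x\<in>{k, - k}. qnorm Q k \<le> qnorm Q (x - w x)"
      proof (rule ccontr)
        assume "\<not> ?thesis"
        then have "ip (x - w x) (x - w x) < ip k k" if "x \<in> {k, - k}" for x
          using that unfolding qnorm_def by force
        then have "ip (k - w k) (k - w k) < ip k k" "ip (- k - w (- k)) (- k - w (- k)) < ip k k" by blast+
        with reflected_loss[OF w, of k] k(2) show False by simp
      qed
      then obtain x where x: "x \<in> {k, - k}" "qnorm Q k \<le> qnorm Q (x - w x)" by blast
      have "qnorm Q (u - P u) / qnorm Q u \<le> 1"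
        using real_sqrt_le_mono[OF ip_residual_le[of u]] qnorm_pos[of u] \<open>u \<in> - {0}\<close>
        unfolding qnorm_def by (simp add: divide_le_eq_1)
      also have "1 \<le> qnorm Q (x - w x) / qnorm Q x"
        using x qn qnorm_pos[OF k(1)] by auto
      finally have "ennreal (qnorm Q (u - P u) / qnorm Q u) \<le> ennreal (qnorm Q (x - w x) / qnorm Q x)"
        by (rule ennreal_leI)
      also have "\<dots> \<le> worst_loss Q w"
        unfolding worst_loss_def using x(1) k(1) by (intro SUP_upper) auto
      finally show ?thesis .
    qed
  qed
  then show ?thesis
    unfolding minmax_optimal_def using P_in_L_Phi
    by (auto intro!: antisym INF_greatest INF_lower)
qed

section \<open>The short of \<open>Q\<close> as the covariance of residuals\<close>

lemma Q_nonneg: "f \<cdot> Q f \<ge> 0"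
  using ip_nonneg[of "Q f"] by (simp only: ip_Q)

text \<open>Polarization: a symmetric operator is determined by its quadratic form.\<close>

lemma is_short_unique:
  assumes "is_short Q A T" "is_short Q A T'"
  shows "T = T'"
proof
  fix g
  have T: "linear T" "linear T'" "\<And>f g. f \<cdot> T g = g \<cdot> T f" "\<And>f g. f \<cdot> T' g = g \<cdot> T' f"
    "\<And>f. f \<cdot> T f = f \<cdot> T' f"
    using assms unfolding is_short_def by auto
  have "f \<cdot> T g = f \<cdot> T' g" for f
    using T(5)[of "f + g"] T(5)[of f] T(5)[of g] T(3)[of g f] T(4)[of g f]
    by (simp add: linear_add[OF T(1)] linear_add[OF T(2)] blinfun.add_left blinfun.add_right)
  then show "T g = T' g" using dual_separates by blast
qed

text \<open>In the Q-norm the infimum is the squared distance of \<open>Q s\<close> from the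
  subspace \<open>Q\<close> applied to the span of the \<open>phi i\<close>, which is the range of
  \<open>P\<close>.\<close>

lemma is_short_residual: "is_short Q (span (range phi)) (\<lambda>f. Q f - P (Q f))"
  unfolding is_short_def
proof (intro conjI allI)
  show "linear (\<lambda>f. Q f - P (Q f))"
    by (rule linearI) (simp_all add: linear_add[OF Q_linear] linear_scale[OF Q_linear] scaleR_diff_right)
  show "f \<cdot> (Q g - P (Q g)) = g \<cdot> (Q f - P (Q f))" for f g :: "'b dual"
    using P_symmetric[of "Q f" "Q g"] Q_symmetric[of f g] ip_commute[of "P (Q f)" "Q g"]
    by (simp add: blinfun.diff_right)
  show "s \<cdot> (Q s - P (Q s)) = (INF t\<in>span (range phi). (s + t) \<cdot> Q (s + t))" for s
  proof (rule antisym)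
    have r: "s \<cdot> (Q s - P (Q s)) = ip (Q s - P (Q s)) (Q s - P (Q s))"
      using P_orthogonal[of "Q s" "Q s"] ip_Q[of s "Q s - P (Q s)"]
      by (simp add: blinfun.diff_right)
    show "s \<cdot> (Q s - P (Q s)) \<le> (INF t\<in>span (range phi). (s + t) \<cdot> Q (s + t))"
    proof (rule cINF_greatest)
      fix t assume t: "t \<in> span (range phi)"
      \<comment> \<open>The functional \<open>t\<close> vanishes on residuals, so the residual of
        \<open>Q t\<close> has norm 0; adding \<open>t\<close> to \<open>s\<close> does not change
        the residual of \<open>Q s\<close>.\<close>
      have "Q t - P (Q t) = 0"
      proof -
        have "t \<cdot> (w - P w) = 0" for w
          using t by (induction rule: span_induct_alt)
            (auto simp: blinfun.add_left blinfun.scaleR_left blinfun.diff_right)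
        then have "ip (Q t - P (Q t)) (Q t - P (Q t)) = 0"
          using P_orthogonal[of "Q t" "Q t"] by (simp only: ip_simps(8) ip_Q diff_self)
        then show ?thesis by (simp only: ip_eq_0_iff)
      qed
      then have "Q (s + t) - P (Q (s + t)) = Q s - P (Q s)"
        by (simp add: linear_add[OF Q_linear] algebra_simps)
      then show "s \<cdot> (Q s - P (Q s)) \<le> (s + t) \<cdot> Q (s + t)"
        using ip_residual_le[of "Q (s + t)"] by (simp only: r ip_Q)
    qed (use span_0 in auto)
    \<comment> \<open>Chosen so that \<open>Q (s + t)\<close> is the residual of \<open>Q s\<close>
      itself, which attains the infimum.\<close>
    define t where "t = - inv Q (P (Q s))"
    have "t \<in> span (range phi)" unfolding t_def by (intro span_neg inv_Q_P_in_span)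
    moreover have "(s + t) \<cdot> Q (s + t) = s \<cdot> (Q s - P (Q s))"
    proof -
      have "Q (s + t) = Q s - P (Q s)" by (simp add: t_def linear_diff[OF Q_linear])
      then show ?thesis using ip_Q[of "s + t" "Q (s + t)"] by (simp only: r)
    qed
    moreover have "bdd_below ((\<lambda>t. (s + t) \<cdot> Q (s + t)) ` span (range phi))"
      using Q_nonneg by (intro bdd_belowI[of _ 0]) blast
    ultimately show "(INF t\<in>span (range phi). (s + t) \<cdot> Q (s + t)) \<le> s \<cdot> (Q s - P (Q s))"
      using cINF_lower[of "\<lambda>t. (s + t) \<cdot> Q (s + t)" "span (range phi)" t] by simp
  qed
qed

lemma short_eq: "short Q (span (range phi)) = (\<lambda>f. Q f - P (Q f))"
  unfolding short_def using is_short_residual is_short_unique by blast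

end

section \<open>Finite Gaussian sums\<close>

abbreviation gauss_seq :: "(nat \<Rightarrow> real) measure" where
  "gauss_seq \<equiv> Pi\<^sub>M UNIV (\<lambda>_. std_normal_distribution)"

lemma prob_space_std_normal: "prob_space std_normal_distribution"
  by (rule prob_space_normal_density) simp

lemma prob_space_gauss_seq: "prob_space gauss_seq"
  by (intro prob_space_PiM prob_space_std_normal)

lemma measurable_gauss_seq [measurable]: "(\<lambda>\<omega>. \<omega> k) \<in> borel_measurable gauss_seq"
proof -
  have "(\<lambda>\<omega>. \<omega> k) \<in> gauss_seq \<rightarrow>\<^sub>M std_normal_distribution"
    by (rule measurable_component_singleton) simp
  then show ?thesis by (simp add: measurable_def)
qed

lemma distr_gauss_seq: "distr gauss_seq borel (\<lambda>\<omega>. \<omega> k) = std_normal_distribution"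
proof -
  have "distr gauss_seq borel (\<lambda>\<omega>. \<omega> k) = distr gauss_seq std_normal_distribution (\<lambda>\<omega>. \<omega> k)"
    by (intro distr_cong) auto
  then show ?thesis
    using distr_PiM_component[of UNIV "\<lambda>_. std_normal_distribution" k] prob_space_std_normal by simp
qed

lemma indep_vars_gauss_seq: "prob_space.indep_vars gauss_seq (\<lambda>_. borel) (\<lambda>k \<omega>. \<omega> k) UNIV"
proof -
  interpret prob_space gauss_seq by (rule prob_space_gauss_seq)
  have "distr gauss_seq (Pi\<^sub>M UNIV (\<lambda>_. borel)) (\<lambda>\<omega>. \<lambda>i\<in>UNIV. \<omega> i) = gauss_seq"
    unfolding restrict_UNIV by (rule distr_id2) (auto intro!: sets_PiM_cong)
  then show ?thesis
    by (subst indep_vars_iff_distr_eq_PiM) (auto simp: distr_gauss_seq)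
qed

text \<open>Characteristic functions multiply over independent summands, so the exponents, and hence
  the variances, add up.\<close>

lemma distr_gauss_seq_sum:
  "distr gauss_seq borel (\<lambda>\<omega>. \<Sum>k<n. a k * \<omega> k) = centered_normal (\<Sum>k<n. (a k)\<^sup>2)"
proof (rule Levy_uniqueness)
  interpret prob_space gauss_seq by (rule prob_space_gauss_seq)
  show "real_distribution (distr gauss_seq borel (\<lambda>\<omega>. \<Sum>k<n. a k * \<omega> k))"
    by (intro real_distribution_distr) simp
  show "real_distribution (centered_normal (\<Sum>k<n. (a k)\<^sup>2))"
    by (intro real_distribution_centered_normal sum_nonneg) simp
  have "indep_vars (\<lambda>_. borel) (\<lambda>k \<omega>. a k * \<omega> k) {..<n}"
    by (rule indep_vars_compose2[OF indep_vars_subset[OF indep_vars_gauss_seq]]) auto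
  from char_distr_sum[OF this]
  have "char (distr gauss_seq borel (\<lambda>\<omega>. \<Sum>k<n. a k * \<omega> k)) t = of_real (exp (- (t\<^sup>2 * (\<Sum>k<n. (a k)\<^sup>2)) / 2))" for t
  proof -
    have "char (distr gauss_seq borel (\<lambda>\<omega>. a k * \<omega> k)) t = of_real (exp (- (t\<^sup>2 * (a k)\<^sup>2) / 2))" for k
    proof -
      have "char (distr gauss_seq borel (\<lambda>\<omega>. a k * \<omega> k)) t = char (distr gauss_seq borel (\<lambda>\<omega>. \<omega> k)) (t * a k)"
        unfolding char_def by (subst (1 2) integral_distr) (auto simp: mult.assoc)
      then show ?thesis by (simp add: distr_gauss_seq char_std_normal_distribution power_mult_distrib)
    qed
    then show ?thesis
      using char_distr_sum[OF \<open>indep_vars (\<lambda>_. borel) (\<lambda>k \<omega>. a k * \<omega> k) {..<n}\<close>, of t]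
      by (simp add: exp_sum[symmetric] sum_negf sum_divide_distrib sum_distrib_left flip: of_real_prod)
  qed
  then show "char (distr gauss_seq borel (\<lambda>\<omega>. \<Sum>k<n. a k * \<omega> k)) = char (centered_normal (\<Sum>k<n. (a k)\<^sup>2))"
    by (auto simp: char_centered_normal sum_nonneg)
qed

text \<open>The centered Gaussian law whose covariance is the sum of the rank one forms of the
  \<open>d k\<close>. The vectors may be dependent or zero, so degenerate laws are included.\<close>

definition gauss_sum :: "(nat \<Rightarrow> 'a::{real_normed_vector, second_countable_topology}) \<Rightarrow> nat \<Rightarrow> 'a measure" where
  "gauss_sum d n = distr gauss_seq borel (\<lambda>\<omega>. \<Sum>k<n. \<omega> k *\<^sub>R d k)"

context
  fixes d :: "nat \<Rightarrow> 'a::{real_normed_vector, second_countable_topology}" and n :: nat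
begin

lemma measurable_gauss_sum: "(\<lambda>\<omega>. \<Sum>k<n. \<omega> k *\<^sub>R d k) \<in> borel_measurable gauss_seq"
  by measurable

lemma prob_space_gauss_sum: "prob_space (gauss_sum d n)"
  unfolding gauss_sum_def by (rule prob_space.prob_space_distr[OF prob_space_gauss_seq measurable_gauss_sum])

lemma sets_gauss_sum [simp]: "sets (gauss_sum d n) = sets borel" "space (gauss_sum d n) = UNIV"
  by (simp_all add: gauss_sum_def)

lemma distr_gauss_sum_linear:
  assumes "linear A" "continuous_on UNIV A"
  shows "distr (gauss_sum d n) borel A = gauss_sum (\<lambda>k. A (d k)) n"
proof -
  have "A \<in> borel_measurable borel" using assms(2) by (rule borel_measurable_continuous_onI)
  then show ?thesis
    unfolding gauss_sum_def
    by (subst distr_distr[OF _ measurable_gauss_sum])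
       (simp_all add: comp_def linear_sum[OF assms(1)] linear_scale[OF assms(1)])
qed

lemma distr_gauss_sum_functional:
  "distr (gauss_sum d n) borel (blinfun_apply h) = centered_normal (\<Sum>k<n. (h \<cdot> d k)\<^sup>2)"
proof -
  have "blinfun_apply h \<in> borel_measurable borel"
    by (intro borel_measurable_continuous_onI continuous_intros)
  then show ?thesis
    unfolding gauss_sum_def
    by (subst distr_distr[OF _ measurable_gauss_sum])
       (simp_all add: comp_def blinfun.sum_right blinfun.scaleR_right distr_gauss_seq_sum[symmetric] mult.commute)
qed

lemma AE_gauss_sum:
  assumes "{x. R x} \<in> sets borel" "\<And>x. x \<in> span (d ` {..<n}) \<Longrightarrow> R x"
  shows "AE x in gauss_sum d n. R x"
proof -
  have "(\<Sum>k<n. \<omega> k *\<^sub>R d k) \<in> span (d ` {..<n})" for \<omega>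
    by (intro span_sum span_scale) (auto intro: span_base)
  then show ?thesis
    unfolding gauss_sum_def using assms
    by (subst AE_distr_iff[OF measurable_gauss_sum]) auto
qed

end

context covariance_operator
begin

text \<open>On the span of the \<open>d k\<close> the squared norm is a finite sum of squared
  coordinates, each with a one-dimensional Gaussian law. After exchanging the sums, Parseval for
  every \<open>d k\<close> reassembles the squared norms.\<close>

lemma second_moment_gauss_sum:
  "(\<integral>\<^sup>+x. ennreal (ip x x) \<partial>gauss_sum d n) = ennreal (\<Sum>k<n. ip (d k) (d k))"
proof -
  obtain g m where "orthosystem g" "\<And>x. x \<in> span (d ` {..<n}) \<Longrightarrow> x = (\<Sum>i<m. ip (g i) x *\<^sub>R g i)"
    and g: "\<And>x. x \<in> span (d ` {..<n}) \<Longrightarrow> ip x x = (\<Sum>i<m. (ip (g i) x)\<^sup>2)"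
    by (rule finite_orthonormal[of "d ` {..<n}"]) auto
  have [measurable]: "ip u \<in> borel_measurable (gauss_sum d n)" for u
    by (auto intro!: borel_measurable_continuous_onI continuous_intros cong: measurable_cong_sets)
  have "closed {x. ip x x = (\<Sum>i<m. (ip (g i) x)\<^sup>2)}"
    by (intro closed_Collect_eq continuous_intros)
  then have "AE x in gauss_sum d n. ip x x = (\<Sum>i<m. (ip (g i) x)\<^sup>2)"
    using g by (intro AE_gauss_sum borel_closed)
  then have "(\<integral>\<^sup>+x. ennreal (ip x x) \<partial>gauss_sum d n) = (\<integral>\<^sup>+x. (\<Sum>i<m. ennreal ((ip (g i) x)\<^sup>2)) \<partial>gauss_sum d n)"
    by (intro nn_integral_cong_AE) (auto elim!: eventually_mono)
  also have "\<dots> = (\<Sum>i<m. \<integral>\<^sup>+x. ennreal ((ip (g i) x)\<^sup>2) \<partial>gauss_sum d n)"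
    by (intro nn_integral_sum) measurable
  also have "\<dots> = (\<Sum>i<m. ennreal (\<Sum>k<n. (ip (g i) (d k))\<^sup>2))"
  proof (intro sum.cong refl)
    fix i
    have "(\<integral>\<^sup>+x. ennreal ((inv Q (g i) \<cdot> x)\<^sup>2) \<partial>gauss_sum d n) = ennreal (\<Sum>k<n. (inv Q (g i) \<cdot> d k)\<^sup>2)"
      by (rule prob_space_distr_centered_normal(3)[OF distr_gauss_sum_functional])
         (auto intro!: sum_nonneg borel_measurable_continuous_onI continuous_intros cong: measurable_cong_sets)
    then show "(\<integral>\<^sup>+x. ennreal ((ip (g i) x)\<^sup>2) \<partial>gauss_sum d n) = ennreal (\<Sum>k<n. (ip (g i) (d k))\<^sup>2)"
      by (simp add: qinner_def)
  qed
  also have "\<dots> = ennreal (\<Sum>i<m. \<Sum>k<n. (ip (g i) (d k))\<^sup>2)"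
    by (simp add: sum_ennreal sum_nonneg)
  also have "(\<Sum>i<m. \<Sum>k<n. (ip (g i) (d k))\<^sup>2) = (\<Sum>k<n. ip (d k) (d k))"
    by (subst sum.swap) (auto intro!: sum.cong g[symmetric] span_base)
  finally show ?thesis .
qed

text \<open>Changing the sign of some \<open>d k\<close> leaves every variance
  \<open>\<Sum>k. (h \<cdot> d k)\<^sup>2\<close> unchanged, and these variances determine the
  law.\<close>

lemma gauss_sum_reflection:
  fixes A :: "'b \<Rightarrow> 'b" and d :: "nat \<Rightarrow> 'b"
  assumes A: "linear A" "continuous_on UNIV A" and d: "\<And>k. A (d k) = d k \<or> A (d k) = - d k"
  shows "distr (gauss_sum d n) borel A = gauss_sum d n"
proof -
  obtain g m where "orthosystem g"
    and g: "\<And>x. x \<in> span (d ` {..<n}) \<Longrightarrow> x = (\<Sum>i<m. ip (g i) x *\<^sub>R g i)"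
    and "\<And>x. x \<in> span (d ` {..<n}) \<Longrightarrow> ip x x = (\<Sum>i<m. (ip (g i) x)\<^sup>2)"
    by (rule finite_orthonormal[of "d ` {..<n}"]) auto
  have "AE x in gauss_sum d' n. x = (\<Sum>i<m. ip (g i) x *\<^sub>R g i)"
    if "\<And>k. d' k = d k \<or> d' k = - d k" for d'
  proof (rule AE_gauss_sum)
    have "closed {x. x = (\<Sum>i<m. ip (g i) x *\<^sub>R g i)}"
      by (intro closed_Collect_eq continuous_intros)
    then show "{x. x = (\<Sum>i<m. ip (g i) x *\<^sub>R g i)} \<in> sets borel" by (rule borel_closed)
    have "d' k \<in> span (d ` {..<n})" if "k < n" for k
    proof -
      have "d k \<in> span (d ` {..<n})" using that by (intro span_base) auto
      then show ?thesis using \<open>\<And>k. d' k = d k \<or> d' k = - d k\<close>[of k] span_neg by metis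
    qed
    then have "span (d' ` {..<n}) \<subseteq> span (d ` {..<n})" by (intro span_minimal) auto
    then show "x = (\<Sum>i<m. ip (g i) x *\<^sub>R g i)" if "x \<in> span (d' ` {..<n})" for x
      using g that by blast
  qed
  note rep = this
  have "gauss_sum (\<lambda>k. A (d k)) n = gauss_sum d n"
  proof (rule gaussian_measure_eqI[OF dual_separates prob_space_gauss_sum prob_space_gauss_sum])
    show "distr (gauss_sum d n) borel (blinfun_apply h) = centered_normal (\<Sum>k<n. (h \<cdot> d k)\<^sup>2)" for h
      by (rule distr_gauss_sum_functional)
    have "(h \<cdot> A (d k))\<^sup>2 = (h \<cdot> d k)\<^sup>2" for h :: "'b dual" and k
      using d[of k] by (auto simp: blinfun.minus_right)
    then show "distr (gauss_sum (\<lambda>k. A (d k)) n) borel (blinfun_apply h) = centered_normal (\<Sum>k<n. (h \<cdot> d k)\<^sup>2)" for h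
      by (simp add: distr_gauss_sum_functional)
    show "AE x in gauss_sum (\<lambda>k. A (d k)) n. x = (\<Sum>i<m. (inv Q (g i) \<cdot> x) *\<^sub>R g i)"
      "AE x in gauss_sum d n. x = (\<Sum>i<m. (inv Q (g i) \<cdot> x) *\<^sub>R g i)"
      using rep[of d] rep[of "\<lambda>k. A (d k)"] d by (simp_all add: qinner_def)
  qed (auto intro: sum_nonneg)
  then show ?thesis by (simp add: distr_gauss_sum_linear[OF A])
qed

end

context measurement_system
begin

text \<open>For Player I it suffices that the quotient of \<open>P\<close> never exceeds 1 and that,
  by the second alternative of \<open>eps\<close>, it is within \<epsilon> of 1 under \<mu>. If
  instead \<open>P\<close> is the identity, its loss vanishes under every measure.\<close>

lemma eps_saddle_point_reflection:
  assumes \<mu>: "prob_space \<mu>" "sets \<mu> = sets borel"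
    and fin: "(\<integral>\<^sup>+x. ennreal (ip x x) \<partial>\<mu>) < \<infinity>" "(\<integral>\<^sup>+x. ennreal (ip x x) \<partial>\<mu>) \<noteq> 0"
    and refl: "distr \<mu> borel (\<lambda>x. 2 *\<^sub>R P x - x) = \<mu>"
    and eps: "(\<forall>x. P x = x) \<or> (\<integral>\<^sup>+x. ennreal (ip x x) \<partial>\<mu>) \<le>
      (\<integral>\<^sup>+x. ennreal (ip (x - P x) (x - P x)) \<partial>\<mu>) + ennreal \<epsilon> * (\<integral>\<^sup>+x. ennreal (ip x x) \<partial>\<mu>)"
  shows "eps_saddle_point Q phi \<epsilon> P \<mu>"
proof -
  define S where "S = (\<integral>\<^sup>+x. ennreal (ip x x) \<partial>\<mu>)"
  define N where "N v = (\<integral>\<^sup>+x. ennreal (ip (x - v x) (x - v x)) \<partial>\<mu>)" for v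
  have sm: "second_moment Q \<mu>' = (\<integral>\<^sup>+x. ennreal (ip x x) \<partial>\<mu>')" for \<mu>'
    by (simp add: second_moment_def)
  have Psi: "Psi Q v \<mu>' = (\<integral>\<^sup>+x. ennreal (ip (x - v x) (x - v x)) \<partial>\<mu>') / (\<integral>\<^sup>+x. ennreal (ip x x) \<partial>\<mu>')" for v \<mu>'
    by (simp add: Psi_def sm del: ip_simps(2,8))
  have S: "S \<noteq> 0" "S < \<top>" using fin by (simp_all add: S_def)
  have dom: "\<mu> \<in> Psi_dom Q"
    using \<mu> fin by (simp add: Psi_dom_def M2_def sm)
  have 1: "Psi Q P \<mu>' \<le> Psi Q P \<mu> + ennreal \<epsilon>" if \<mu>': "\<mu>' \<in> Psi_dom Q" for \<mu>'
    using eps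
  proof
    assume "\<forall>x. P x = x"
    then show ?thesis by (simp add: Psi)
  next
    assume *: "(\<integral>\<^sup>+x. ennreal (ip x x) \<partial>\<mu>) \<le>
      (\<integral>\<^sup>+x. ennreal (ip (x - P x) (x - P x)) \<partial>\<mu>) + ennreal \<epsilon> * (\<integral>\<^sup>+x. ennreal (ip x x) \<partial>\<mu>)"
    have "Psi Q P \<mu>' \<le> (\<integral>\<^sup>+x. ennreal (ip x x) \<partial>\<mu>') / (\<integral>\<^sup>+x. ennreal (ip x x) \<partial>\<mu>')"
      unfolding Psi by (intro divide_right_mono_ennreal nn_integral_mono ennreal_leI ip_residual_le)
    also have "\<dots> = 1"
      using \<mu>' by (intro ennreal_divide_self) (auto simp: Psi_dom_def M2_def sm)
    also have "1 = S / S" using S by simp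
    also have "\<dots> \<le> (N P + ennreal \<epsilon> * S) / S"
      using * unfolding S_def N_def by (rule divide_right_mono_ennreal)
    also have "\<dots> = N P / S + ennreal \<epsilon>"
      using S by (simp add: add_divide_distrib_ennreal ennreal_times_divide[symmetric])
    finally show ?thesis by (simp only: Psi S_def N_def)
  qed
  have 2: "Psi Q P \<mu> \<le> Psi Q v \<mu> + ennreal \<epsilon>" if v: "v \<in> L_Phi phi" for v
  proof -
    let ?R = "\<lambda>x. 2 *\<^sub>R P x - x"
    note [measurable] = L_Phi_borel_measurable[OF v] L_Phi_borel_measurable[OF P_in_L_Phi]
    note [measurable_cong] = \<mu>(2)
    have [measurable]: "(\<lambda>x. ip x x) \<in> borel_measurable borel"
      by (intro borel_measurable_continuous_onI continuous_intros)
    have "2 * N P = (\<integral>\<^sup>+x. 2 * ennreal (ip (x - P x) (x - P x)) \<partial>\<mu>)"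
      unfolding N_def by (subst nn_integral_cmult) (auto simp del: ip_simps(2,8))
    also have "\<dots> \<le> (\<integral>\<^sup>+x. ennreal (ip (x - v x) (x - v x)) + ennreal (ip (?R x - v (?R x)) (?R x - v (?R x))) \<partial>\<mu>)"
    proof (rule nn_integral_mono)
      fix x
      have "2 * ennreal (ip (x - P x) (x - P x)) = ennreal (2 * ip (x - P x) (x - P x))"
        by (simp only: ennreal_mult' ennreal_numeral zero_le_numeral)
      also have "\<dots> \<le> ennreal (ip (x - v x) (x - v x) + ip (?R x - v (?R x)) (?R x - v (?R x)))"
        by (rule ennreal_leI[OF reflected_loss[OF v]])
      finally show "2 * ennreal (ip (x - P x) (x - P x)) \<le>
          ennreal (ip (x - v x) (x - v x)) + ennreal (ip (?R x - v (?R x)) (?R x - v (?R x)))"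
        by (simp only: ennreal_plus ip_nonneg)
    qed
    also have "\<dots> = N v + (\<integral>\<^sup>+x. ennreal (ip (?R x - v (?R x)) (?R x - v (?R x))) \<partial>\<mu>)"
      unfolding N_def by (rule nn_integral_add) (simp_all del: ip_simps(2,8))
    \<comment> \<open>Invariance of \<mu> turns the reflected term into a second copy of
      \<open>N v\<close>. Nothing is subtracted, so \<open>N v\<close> may be infinite.\<close>
    also have "(\<integral>\<^sup>+x. ennreal (ip (?R x - v (?R x)) (?R x - v (?R x))) \<partial>\<mu>) =
        (\<integral>\<^sup>+x. ennreal (ip (x - v x) (x - v x)) \<partial>distr \<mu> borel ?R)"
      by (rule nn_integral_distr[symmetric]) (simp_all del: ip_simps(2,8))
    also have "N v + \<dots> = 2 * N v"
      unfolding refl by (simp add: N_def mult_2)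
    finally have "N P \<le> N v" by (subst (asm) ennreal_mult_le_mult_iff) auto
    then have "Psi Q P \<mu> \<le> Psi Q v \<mu>"
      unfolding Psi N_def by (rule divide_right_mono_ennreal)
    then show ?thesis by (rule order_trans) simp
  qed
  show ?thesis
    unfolding eps_saddle_point_def using P_in_L_Phi dom 1 2 by blast
qed

end

section \<open>Images of cylinder measures under maps of finite rank\<close>

lemma push_emeasure: "sets M = sets borel \<Longrightarrow> push F (emeasure M) = distr M borel F"
  using sets_eq_imp_space_eq[of M borel] by (simp add: push_def distr_def)

text \<open>\<open>F\<close> factors through \<open>coords k f\<close>, where the cylinder measure
  induces a genuine measure \<open>E\<close> on real k-space. Hence \<open>push F \<mu>\<close> is
  the image of \<open>E\<close> under a measurable map, and the set function behind it is countably
  additive; otherwise \<open>measure_of\<close> would silently return the zero measure.\<close>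

lemma cylinder_push:
  fixes f :: "nat \<Rightarrow> 'b::real_normed_vector dual" and b :: "nat \<Rightarrow> 'c::{real_normed_vector, second_countable_topology}"
  assumes \<mu>: "cylinder_measure \<mu>" and F: "\<And>x. F x = (\<Sum>i<k. (f i \<cdot> x) *\<^sub>R b i)"
  shows "prob_space (push F \<mu>)" "sets (push F \<mu>) = sets borel"
    "A \<in> sets borel \<Longrightarrow> emeasure (push F \<mu>) A = \<mu> (F -` A)"
    "h \<in> borel_measurable borel \<Longrightarrow> distr (push F \<mu>) borel h = push (\<lambda>x. h (F x)) \<mu>"
proof -
  define E where "E = measure_of (space (euclid k)) (sets (euclid k)) (\<lambda>A. \<mu> (coords k f -` A))"
  have ms: "measure_space (space (euclid k)) (sets (euclid k)) (\<lambda>A. \<mu> (coords k f -` A))" and one: "\<mu> UNIV = 1"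
    using \<mu> unfolding cylinder_measure_def by auto
  have E: "emeasure E A = \<mu> (coords k f -` A)" if "A \<in> sets (euclid k)" for A
    using ms that unfolding E_def measure_space_def by (intro emeasure_measure_of_sigma) auto
  have sE: "sets E = sets (euclid k)" "space E = space (euclid k)"
    by (simp_all add: E_def space_measure_of_conv)
  have cs: "coords k f x \<in> space (euclid k)" for x
    by (auto simp: coords_def space_PiM)
  define L where "L y = (\<Sum>i<k. (y i :: real) *\<^sub>R b i)" for y
  have L: "L \<in> borel_measurable E"
    unfolding L_def measurable_cong_sets[OF sE(1) refl] by measurable
  have FL: "F x = L (coords k f x)" for x
    by (simp add: F L_def coords_def)
  have EL: "emeasure E (L -` A \<inter> space E) = \<mu> (F -` A)" if "A \<in> sets borel" for A
  proof -
    have "emeasure E (L -` A \<inter> space E) = \<mu> (coords k f -` (L -` A \<inter> space E))"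
      using measurable_sets[OF L that] sE by (intro E) simp
    also have "coords k f -` (L -` A \<inter> space E) = F -` A"
      using cs sE by (auto simp: FL)
    finally show ?thesis .
  qed
  have push: "push F \<mu> = distr E borel L"
    unfolding push_def distr_def space_borel
    by (rule measure_of_eq) (use EL sets.sigma_sets_eq[of "borel :: 'c measure"] in auto)
  show "sets (push F \<mu>) = sets borel" by (simp add: push)
  have "emeasure E (space E) = 1"
    using E[of "space (euclid k)"] cs one sE by (simp add: vimage_def)
  then have "prob_space E" by (rule prob_spaceI)
  then show "prob_space (push F \<mu>)" unfolding push using L by (rule prob_space.prob_space_distr)
  show em: "emeasure (push F \<mu>) A = \<mu> (F -` A)" if "A \<in> sets borel" for A
    unfolding push using L that EL by (simp add: emeasure_distr)
  show "distr (push F \<mu>) borel h = push (\<lambda>x. h (F x)) \<mu>" if h: "h \<in> borel_measurable borel"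
  proof -
    have "emeasure (push F \<mu>) (h -` A \<inter> space (push F \<mu>)) = \<mu> ((\<lambda>x. h (F x)) -` A)" if "A \<in> sets borel" for A
      using em[OF measurable_sets[OF h that]] by (simp add: push vimage_def)
    then show ?thesis
      unfolding push_def[of "\<lambda>x. h (F x)"] unfolding distr_def space_borel
      by (intro measure_of_eq) (simp_all add: sets.sigma_sets_eq[of borel, simplified])
  qed
qed

section \<open>Saddle points\<close>

context measurement_system
begin

text \<open>The common criterion for both saddle points. \<open>lim\<close> gives convergence after
  every finite rank projection, since all images are Gaussian on the same finite-dimensional range;
  \<open>P_d\<close> gives invariance under the reflection, \<open>pos\<close> excludes the Dirac
  measure at 0, and \<open>eps\<close> says that the trace sits almost entirely on the kernel of
  \<open>P\<close>, unless \<open>P\<close> is the identity.\<close>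

lemma saddle_point_gauss_sums:
  fixes d :: "nat \<Rightarrow> nat \<Rightarrow> 'b" and N :: "nat \<Rightarrow> nat"
  assumes \<mu>: "gaussian_cylinder_measure T \<mu>"
    and lim: "\<And>h. (\<lambda>n. \<Sum>k<N n. (h \<cdot> d n k)\<^sup>2) \<longlonglongrightarrow> h \<cdot> T h"
    and P_d: "\<And>n k. P (d n k) = 0 \<or> P (d n k) = d n k"
    and pos: "\<And>n. n \<ge> 1 \<Longrightarrow> 0 < (\<Sum>k<N n. ip (d n k) (d n k))"
    and eps: "(\<forall>x. P x = x) \<or> (\<forall>n\<ge>1. (\<Sum>k<N n. ip (d n k) (d n k)) \<le>
      (\<Sum>k<N n. ip (d n k - P (d n k)) (d n k - P (d n k))) + 1 / real n * (\<Sum>k<N n. ip (d n k) (d n k)))"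
  shows "saddle_point Q phi P \<mu>"
proof -
  define \<mu>s where "\<mu>s n = gauss_sum (d n) (N n)" for n
  have cyl: "cylinder_measure \<mu>"
    and law: "push (blinfun_apply f) \<mu> = centered_normal (f \<cdot> T f)" for f :: "'b dual"
    using \<mu> unfolding gaussian_cylinder_measure_def by auto
  have T_nonneg: "h \<cdot> T h \<ge> 0" for h
    by (rule LIMSEQ_le_const[OF lim]) (intro exI[of _ 0] allI impI sum_nonneg zero_le_power2)
  have "eps_saddle_point Q phi (1 / real n) P (\<mu>s n)" if n: "n \<ge> 1" for n
  proof (rule eps_saddle_point_reflection)
    show "prob_space (\<mu>s n)" "sets (\<mu>s n) = sets borel"
      by (simp_all add: \<mu>s_def prob_space_gauss_sum)
    have lin: "linear (\<lambda>x. 2 *\<^sub>R P x - x)" "linear (\<lambda>x. x - P x)"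
      by (rule linearI; simp add: algebra_simps)+
    have cont: "continuous_on UNIV (\<lambda>x. 2 *\<^sub>R P x - x)" "continuous_on UNIV (\<lambda>x. x - P x)"
      by (intro continuous_intros)+
    have S: "(\<integral>\<^sup>+x. ennreal (ip x x) \<partial>\<mu>s n) = ennreal (\<Sum>k<N n. ip (d n k) (d n k))"
      unfolding \<mu>s_def by (rule second_moment_gauss_sum)
    show "(\<integral>\<^sup>+x. ennreal (ip x x) \<partial>\<mu>s n) < \<infinity>" "(\<integral>\<^sup>+x. ennreal (ip x x) \<partial>\<mu>s n) \<noteq> 0"
      using pos[OF n] by (simp_all add: S)
    have "2 *\<^sub>R P (d n k) - d n k = d n k \<or> 2 *\<^sub>R P (d n k) - d n k = - d n k" for k
      using P_d[of n k] by (elim disjE) (simp_all add: scaleR_2)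
    then show "distr (\<mu>s n) borel (\<lambda>x. 2 *\<^sub>R P x - x) = \<mu>s n"
      unfolding \<mu>s_def by (intro gauss_sum_reflection lin cont)
    have "(\<integral>\<^sup>+x. ennreal (ip (x - P x) (x - P x)) \<partial>\<mu>s n) = (\<integral>\<^sup>+x. ennreal (ip x x) \<partial>distr (\<mu>s n) borel (\<lambda>x. x - P x))"
    proof (rule nn_integral_distr[symmetric])
      show "(\<lambda>x. x - P x) \<in> \<mu>s n \<rightarrow>\<^sub>M borel"
        using borel_measurable_continuous_onI[OF cont(2)] by (simp add: \<mu>s_def cong: measurable_cong_sets)
    qed (auto intro!: borel_measurable_continuous_onI continuous_intros)
    also have "\<dots> = ennreal (\<Sum>k<N n. ip (d n k - P (d n k)) (d n k - P (d n k)))"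
      unfolding \<mu>s_def distr_gauss_sum_linear[OF lin(2) cont(2)] by (rule second_moment_gauss_sum)
    finally have S': "(\<integral>\<^sup>+x. ennreal (ip (x - P x) (x - P x)) \<partial>\<mu>s n) =
      ennreal (\<Sum>k<N n. ip (d n k - P (d n k)) (d n k - P (d n k)))" .
    have "ennreal (\<Sum>k<N n. ip (d n k - P (d n k)) (d n k - P (d n k))) + ennreal (1 / real n) * ennreal (\<Sum>k<N n. ip (d n k) (d n k))
      = ennreal ((\<Sum>k<N n. ip (d n k - P (d n k)) (d n k - P (d n k))) + 1 / real n * (\<Sum>k<N n. ip (d n k) (d n k)))"
    proof -
      have "ennreal a + ennreal c * ennreal s = ennreal (a + c * s)" if "0 \<le> a" "0 \<le> c" "0 \<le> s" for a c s
        using that by (simp add: ennreal_mult)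
      then show ?thesis by this (auto intro!: sum_nonneg simp del: ip_simps(2,8))
    qed
    note eq = this
    show "(\<forall>x. P x = x) \<or> (\<integral>\<^sup>+x. ennreal (ip x x) \<partial>\<mu>s n) \<le>
      (\<integral>\<^sup>+x. ennreal (ip (x - P x) (x - P x)) \<partial>\<mu>s n) + ennreal (1 / real n) * (\<integral>\<^sup>+x. ennreal (ip x x) \<partial>\<mu>s n)"
      using eps n unfolding S S' eq by (blast intro: ennreal_leI)
  qed
  moreover have "cylinder_converges (\<lambda>n. emeasure (\<mu>s n)) \<mu>"
    unfolding cylinder_converges_def
  proof (intro allI impI)
    fix F :: "'b \<Rightarrow>\<^sub>L 'b" assume "finite_rank_projection F"
    then obtain S where S: "finite S" "range (blinfun_apply F) \<subseteq> span S"
      unfolding finite_rank_projection_def by blast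
    obtain b k where "orthosystem b" and b: "\<And>x. x \<in> span S \<Longrightarrow> x = (\<Sum>i<k. ip (b i) x *\<^sub>R b i)"
      and "\<And>x. x \<in> span S \<Longrightarrow> ip x x = (\<Sum>i<k. (ip (b i) x)\<^sup>2)"
      by (rule finite_orthonormal[OF S(1)]) auto
    \<comment> \<open>Orthonormal coordinates on the range, composed with \<open>F\<close>, are
      functionals on the whole space; this is the form in which \<open>cylinder_push\<close>
      applies.\<close>
    have F: "blinfun_apply F x = (\<Sum>i<k. ((inv Q (b i) o\<^sub>L F) \<cdot> x) *\<^sub>R b i)" for x
    proof -
      have "blinfun_apply F x \<in> span S" using S(2) by blast
      from b[OF this] show ?thesis by (simp add: qinner_def)
    qed
    note push = cylinder_push[OF cyl F]
    have closed: "closed {x. x = (\<Sum>i<k. (inv Q (b i) \<cdot> x) *\<^sub>R b i)}"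
      by (intro closed_Collect_eq continuous_intros)
    have pushs: "push (blinfun_apply F) (emeasure (\<mu>s n)) = gauss_sum (\<lambda>j. blinfun_apply F (d n j)) (N n)" for n
      unfolding \<mu>s_def
      by (subst push_emeasure, simp, rule distr_gauss_sum_linear)
         (auto intro!: continuous_intros bounded_linear.linear blinfun.bounded_linear_right)
    show "weakly_converges (\<lambda>n. push (blinfun_apply F) (emeasure (\<mu>s n))) (push (blinfun_apply F) \<mu>)"
      unfolding pushs
    proof (rule weakly_converges_gaussian[OF dual_separates])
      show "distr (gauss_sum (\<lambda>j. blinfun_apply F (d n j)) (N n)) borel (blinfun_apply h) =
          centered_normal (\<Sum>j<N n. ((h o\<^sub>L F) \<cdot> d n j)\<^sup>2)" for n h
        by (simp add: distr_gauss_sum_functional)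
      show "distr (push (blinfun_apply F) \<mu>) borel (blinfun_apply h) = centered_normal ((h o\<^sub>L F) \<cdot> T (h o\<^sub>L F))" for h
      proof -
        have "blinfun_apply h \<in> borel_measurable borel"
          by (intro borel_measurable_continuous_onI continuous_intros)
        moreover have "(\<lambda>x. h \<cdot> blinfun_apply F x) = blinfun_apply (h o\<^sub>L F)"
          by (rule ext) simp
        ultimately have "distr (push (blinfun_apply F) \<mu>) borel (blinfun_apply h) = push (blinfun_apply (h o\<^sub>L F)) \<mu>"
          using push(4) by metis
        then show ?thesis by (simp only: law)
      qed
      show "AE x in gauss_sum (\<lambda>j. blinfun_apply F (d n j)) (N n). x = (\<Sum>i<k. (inv Q (b i) \<cdot> x) *\<^sub>R b i)" for n
      proof (rule AE_gauss_sum[OF borel_closed[OF closed]])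
        fix x assume "x \<in> span ((\<lambda>j. blinfun_apply F (d n j)) ` {..<N n})"
        moreover have "span ((\<lambda>j. blinfun_apply F (d n j)) ` {..<N n}) \<subseteq> span S"
          using S(2) by (intro span_minimal) auto
        ultimately show "x = (\<Sum>i<k. (inv Q (b i) \<cdot> x) *\<^sub>R b i)"
          using b[of x] by (auto simp: qinner_def)
      qed
      show "AE x in push (blinfun_apply F) \<mu>. x = (\<Sum>i<k. (inv Q (b i) \<cdot> x) *\<^sub>R b i)"
      proof -
        interpret prob_space "push (blinfun_apply F) \<mu>" by (rule push(1))
        have "emeasure (push (blinfun_apply F) \<mu>) {x. x = (\<Sum>i<k. (inv Q (b i) \<cdot> x) *\<^sub>R b i)} = \<mu> UNIV"
          using F by (subst push(3)[OF borel_closed[OF closed]]) (simp add: vimage_def)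
        also have "\<dots> = 1" using cyl by (simp add: cylinder_measure_def)
        finally have "prob {x. x = (\<Sum>i<k. (inv Q (b i) \<cdot> x) *\<^sub>R b i)} = 1"
          by (simp add: measure_def)
        then have "AE x in push (blinfun_apply F) \<mu>. x \<in> {x. x = (\<Sum>i<k. (inv Q (b i) \<cdot> x) *\<^sub>R b i)}"
          using borel_closed[OF closed] push(2) by (subst (asm) prob_eq_1) auto
        then show ?thesis by simp
      qed
      show "(\<lambda>n. \<Sum>j<N n. ((h o\<^sub>L F) \<cdot> d n j)\<^sup>2) \<longlonglongrightarrow> (h o\<^sub>L F) \<cdot> T (h o\<^sub>L F)" for h by (rule lim)
    qed (simp_all only: push(1,2) sets_gauss_sum prob_space_gauss_sum T_nonneg sum_nonneg zero_le_power2
        not_False_eq_True)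
  qed
  ultimately show ?thesis
    unfolding saddle_point_def using P_in_L_Phi cyl by blast
qed

lemma gamblet_nonzero: "\<psi> i \<noteq> 0"
  using phi_gamblet[of i i] by auto

text \<open>By symmetry of \<open>P\<close> the terms are the squared coefficients of
  \<open>Q h - P (Q h)\<close> and of \<open>P (Q h)\<close>, so both claims are Parseval.\<close>

lemma sums_residual:
  assumes e: "\<And>u. (\<lambda>k. (ip (e k) u)\<^sup>2) sums ip u u"
  shows "(\<lambda>k. (h \<cdot> (e k - P (e k)))\<^sup>2) sums (h \<cdot> (Q h - P (Q h)))"
    "(\<lambda>k. (h \<cdot> P (e k))\<^sup>2) sums (h \<cdot> P (Q h))"
proof -
  have "h \<cdot> P (e k) = ip (e k) (P (Q h))" for k
    using P_symmetric[of "Q h" "e k"] ip_commute[of "P (Q h)" "e k"] by simp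
  moreover have "h \<cdot> e k = ip (e k) (Q h)" for k
    using ip_commute[of "Q h" "e k"] by simp
  moreover have "ip (P (Q h)) (P (Q h)) = h \<cdot> P (Q h)"
    using P_symmetric[of "Q h" "P (Q h)"] by simp
  moreover have "ip (Q h - P (Q h)) (Q h - P (Q h)) = h \<cdot> (Q h - P (Q h))"
    using P_orthogonal[of "Q h" "Q h"] by (simp only: ip_simps(8) ip_Q diff_zero)
  ultimately show "(\<lambda>k. (h \<cdot> (e k - P (e k)))\<^sup>2) sums (h \<cdot> (Q h - P (Q h)))"
    "(\<lambda>k. (h \<cdot> P (e k))\<^sup>2) sums (h \<cdot> P (Q h))"
    using e[of "Q h - P (Q h)"] e[of "P (Q h)"] by (simp_all add: blinfun.diff_right)
qed

text \<open>The residuals \<open>e k - P (e k)\<close> lie in the kernel of \<open>P\<close>, where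
  the loss of \<open>P\<close> is the full squared norm, so \<open>eps\<close> holds trivially; by
  Parseval their covariances add up to the short.\<close>

lemma saddle_point_short:
  assumes "gaussian_cylinder_measure (short Q (span (range phi))) \<mu>"
  shows "saddle_point Q phi P \<mu>"
proof -
  obtain e where e: "orthosystem e" "\<And>u. (\<lambda>k. (ip (e k) u)\<^sup>2) sums ip u u"
    by (rule exists_orthonormal_basis) blast
  define T where "T h = Q h - P (Q h)" for h
  have \<mu>: "gaussian_cylinder_measure T \<mu>" using assms unfolding short_eq T_def by simp
  show ?thesis
  proof (cases "\<exists>k. e k \<noteq> P (e k)")
    case True
    then obtain k0 where k0: "e k0 - P (e k0) \<noteq> 0" by auto
    define d where "d k = e k - P (e k)" for k
    have Pd: "P (d k) = 0" for k by (simp add: d_def)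
    \<comment> \<open>The offset \<open>Suc k0\<close> puts the nonzero residual at
      \<open>k0\<close> into every partial sum, which makes the second moments positive.\<close>
    show ?thesis
    proof (rule saddle_point_gauss_sums[OF \<mu>, where d = "\<lambda>_. d" and N = "\<lambda>n. n + Suc k0"])
      have "filterlim (\<lambda>n. n + Suc k0) sequentially sequentially"
        by (intro filterlim_at_top_mono[OF filterlim_ident]) auto
      then show "(\<lambda>n. \<Sum>k<n + Suc k0. (h \<cdot> d k)\<^sup>2) \<longlonglongrightarrow> h \<cdot> T h" for h
        using sums_residual(1)[OF e(2), of h] unfolding sums_def T_def d_def
        by (rule filterlim_compose[rotated])
      show "0 < (\<Sum>k<n + Suc k0. ip (d k) (d k))" for n
        using k0 by (intro sum_pos2[of _ k0]) (auto simp: d_def[of k0] intro!: ip_pos simp del: ip_simps)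
    qed (simp_all add: Pd sum_nonneg)
  next
    case False
    have PI: "P x = x" for x
    proof -
      have "ip (e k) (x - P x) = 0" for k
        using P_orthogonal[of "e k" x] False by simp
      then have "(\<lambda>k. 0 :: real) sums ip (x - P x) (x - P x)"
        using e(2)[of "x - P x"] by (simp del: ip_simps)
      then have "ip (x - P x) (x - P x) = 0"
        using sums_unique2[OF _ sums_zero] by blast
      then have "x - P x = 0" by (simp only: ip_eq_0_iff)
      then show ?thesis by simp
    qed
    \<comment> \<open>Here the short is 0 and its cylinder measure gives every functional the Dirac
      law at 0. Gaussians along a fixed nonzero vector with vanishing variance approximate it; any
      gamblet supplies such a vector.\<close>
    define w where "w = \<psi> undefined"
    have w: "w \<noteq> 0" unfolding w_def by (rule gamblet_nonzero)
    show ?thesis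
    \<comment> \<open>At \<open>n = 0\<close> the convention \<open>1 / 0 = 0\<close> gives the
      Dirac measure; positivity is only asked for from \<open>n = 1\<close> on.\<close>
    proof (rule saddle_point_gauss_sums[OF \<mu>, where d = "\<lambda>n _. (1 / real n) *\<^sub>R w" and N = "\<lambda>n. Suc 0"])
      have "(\<lambda>n. (1 / real n * (h \<cdot> w))\<^sup>2) \<longlonglongrightarrow> (0 * (h \<cdot> w))\<^sup>2" for h :: "'b dual"
        by (intro tendsto_intros lim_1_over_n)
      then show "(\<lambda>n. \<Sum>k<Suc 0. (h \<cdot> (1 / real n) *\<^sub>R w)\<^sup>2) \<longlonglongrightarrow> h \<cdot> T h" for h
        by (simp add: T_def PI blinfun.scaleR_right del: times_divide_eq_left mult_1_left)
      show "0 < (\<Sum>k<Suc 0. ip ((1 / real n) *\<^sub>R w) ((1 / real n) *\<^sub>R w))" if "n \<ge> 1" for n :: nat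
        using ip_pos[OF w] that by simp
    qed (use PI in auto)
  qed
qed

lemma sum_orthosystem_unbounded:
  assumes e: "orthosystem e" "infinite {k. e k \<noteq> 0}"
  shows "\<exists>M\<ge>n. B \<le> (\<Sum>k<M. ip (e k) (e k))"
proof -
  obtain F where F: "F \<subseteq> {k. e k \<noteq> 0}" "finite F" "card F = nat \<lceil>B\<rceil>"
    using infinite_arbitrarily_large[OF e(2)] by blast
  obtain m where m: "F \<subseteq> {..<m}" using finite_nat_bounded[OF F(2)] by blast
  have "B \<le> real (card F)" using F(3) by (simp add: of_nat_ceiling)
  also have "\<dots> = (\<Sum>k\<in>F. ip (e k) (e k))"
    using F(1) e(1) unfolding orthosystem_def by (subst sum.cong[where h = "\<lambda>_. 1"]) auto
  also have "\<dots> \<le> (\<Sum>k<max n m. ip (e k) (e k))"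
    using m by (intro sum_mono2) auto
  finally show ?thesis by (intro exI[of _ "max n m"]) simp
qed

text \<open>The trace of \<open>P\<close> is finite, so it is negligible against that of the identity if the space has
  infinite dimension.\<close>

lemma P_trace_bounded:
  assumes e: "\<And>u. (\<lambda>k. (ip (e k) u)\<^sup>2) sums ip u u"
  shows "\<exists>C. \<forall>M. (\<Sum>k<M. ip (P (e k)) (P (e k))) \<le> C"
proof -
  have bessel: "(\<Sum>k<M. (ip u (e k))\<^sup>2) \<le> ip u u" for M u
    using sum_le_suminf[OF sums_summable[OF e[of u]], of "{..<M}"] sums_unique[OF e[of u]]
    by (simp add: ip_commute[of u "e _"])
  \<comment> \<open>The inequality between products and squares turns the finite expansion of
    \<open>P x\<close> into squared coefficients of fixed vectors, to which Bessel applies after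
    summation over the basis.\<close>
  have "ip (P x) (P x) \<le> (\<Sum>i\<in>UNIV. ((ip (Q (phi i)) x)\<^sup>2 + (ip (\<psi> i) x)\<^sup>2) / 2)" for x
  proof -
    have "ip (P x) (P x) = ip (P x) x"
      using P_orthogonal[of x x] by simp
    also have "\<dots> = (\<Sum>i\<in>UNIV. (phi i \<cdot> x) * ip (\<psi> i) x)"
      by (simp add: P_def)
    also have "\<dots> \<le> (\<Sum>i\<in>UNIV. ((ip (Q (phi i)) x)\<^sup>2 + (ip (\<psi> i) x)\<^sup>2) / 2)"
    proof (intro sum_mono)
      fix i show "(phi i \<cdot> x) * ip (\<psi> i) x \<le> ((ip (Q (phi i)) x)\<^sup>2 + (ip (\<psi> i) x)\<^sup>2) / 2"
        using sum_squares_bound[of "phi i \<cdot> x" "ip (\<psi> i) x"] by simp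
    qed
    finally show ?thesis .
  qed
  then have "(\<Sum>k<M. ip (P (e k)) (P (e k))) \<le> (\<Sum>k<M. \<Sum>i\<in>UNIV. ((ip (Q (phi i)) (e k))\<^sup>2 + (ip (\<psi> i) (e k))\<^sup>2) / 2)" for M
    by (rule sum_mono)
  moreover have "(\<Sum>k<M. \<Sum>i\<in>UNIV. ((ip (Q (phi i)) (e k))\<^sup>2 + (ip (\<psi> i) (e k))\<^sup>2) / 2)
     \<le> (\<Sum>i\<in>UNIV. (ip (Q (phi i)) (Q (phi i)) + ip (\<psi> i) (\<psi> i)) / 2)" for M
    by (subst sum.swap) (intro sum_mono, simp only: sum_divide_distrib[symmetric] sum.distrib,
      intro divide_right_mono add_mono bessel, simp)
  ultimately show ?thesis by (meson order_trans)
qed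

lemma sum_even_odd: "(\<Sum>k<2 * (n::nat). f k) = (\<Sum>k<n. f (2 * k) + f (Suc (2 * k)) :: real)"
  by (induction n) auto

text \<open>Each basis vector enters through its two components as separate vectors with independent
  coefficients. The reflection then only flips signs, while traces and limiting variances remain
  those of the basis because the components are orthogonal.\<close>

lemma saddle_point_Q:
  assumes inf: "infinite_dimensional TYPE('b)" and \<mu>: "gaussian_cylinder_measure Q \<mu>"
  shows "saddle_point Q phi P \<mu>"
proof -
  obtain e where e: "orthosystem e" "\<And>u. (\<lambda>k. (ip (e k) u)\<^sup>2) sums ip u u" "infinite {k. e k \<noteq> 0}"
    by (rule exists_orthonormal_basis) (use inf in blast)
  obtain C where C: "\<And>M. (\<Sum>k<M. ip (P (e k)) (P (e k))) \<le> C"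
    using P_trace_bounded[OF e(2)] by blast
  define d where "d k = (if even k then P (e (k div 2)) else e (k div 2) - P (e (k div 2)))" for k
  \<comment> \<open>The range of \<open>P\<close> carries trace at most \<open>C\<close>, so a total
    above \<open>real n * C\<close> makes its share at most \<open>1 / real n\<close>. The summand 1
    ensures positivity, and \<open>M n \<ge> n\<close> exhausts the basis.\<close>
  have "\<forall>n. \<exists>M\<ge>n. real n * C + 1 \<le> (\<Sum>k<M. ip (e k) (e k))"
    using sum_orthosystem_unbounded[OF e(1,3)] by blast
  from choice[OF this] obtain M
    where M: "\<And>n. M n \<ge> n" "\<And>n. real n * C + 1 \<le> (\<Sum>k<M n. ip (e k) (e k))"
    by blast
  have sum_d: "(\<Sum>k<2 * m. f (d k)) = (\<Sum>k<m. f (P (e k)) + f (e k - P (e k)))" for f :: "'b \<Rightarrow> real" and m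
    by (simp add: sum_even_odd d_def)
  have dd: "(\<Sum>k<2 * m. ip (d k) (d k)) = (\<Sum>k<m. ip (e k) (e k))" for m
    using sum_d[of "\<lambda>x. ip x x" m] by (simp only: ip_P_P)
  have rr: "(\<Sum>k<2 * m. ip (d k - P (d k)) (d k - P (d k))) = (\<Sum>k<m. ip (e k - P (e k)) (e k - P (e k)))" for m
    using sum_d[of "\<lambda>x. ip (x - P x) (x - P x)" m] by simp
  show ?thesis
  proof (rule saddle_point_gauss_sums[OF \<mu>, where d = "\<lambda>_. d" and N = "\<lambda>n. 2 * M n"])
    have "filterlim M at_top sequentially"
      using M(1) by (intro filterlim_at_top_mono[OF filterlim_ident]) auto
    moreover have "(\<lambda>m. \<Sum>k<m. (h \<cdot> P (e k))\<^sup>2 + (h \<cdot> (e k - P (e k)))\<^sup>2) \<longlonglongrightarrow> h \<cdot> P (Q h) + h \<cdot> (Q h - P (Q h))" for h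
      using sums_add[OF sums_residual(2,1)[OF e(2)], of h h] unfolding sums_def .
    ultimately have "(\<lambda>n. \<Sum>k<M n. (h \<cdot> P (e k))\<^sup>2 + (h \<cdot> (e k - P (e k)))\<^sup>2) \<longlonglongrightarrow> h \<cdot> P (Q h) + h \<cdot> (Q h - P (Q h))" for h
      by (rule filterlim_compose[rotated])
    then show "(\<lambda>n. \<Sum>k<2 * M n. (h \<cdot> d k)\<^sup>2) \<longlonglongrightarrow> h \<cdot> Q h" for h
      using sum_d[of "\<lambda>x. (h \<cdot> x)\<^sup>2"] by (simp add: blinfun.diff_right)
    have C0: "C \<ge> 0" using C[of 0] by simp
    show "0 < (\<Sum>k<2 * M n. ip (d k) (d k))" for n
      using M(2)[of n] C0 unfolding dd by (smt (verit) mult_nonneg_nonneg of_nat_0_le_iff)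
    have "(\<Sum>k<m. ip (e k) (e k)) = (\<Sum>k<m. ip (P (e k)) (P (e k))) + (\<Sum>k<m. ip (e k - P (e k)) (e k - P (e k)))" for m
      by (simp only: sum.distrib[symmetric] ip_P_P)
    moreover have "C \<le> 1 / real n * (\<Sum>k<M n. ip (e k) (e k))" if "n \<ge> 1" for n
      using M(2)[of n] that by (simp add: field_simps)
    ultimately have "(\<Sum>k<2 * M n. ip (d k) (d k)) \<le> (\<Sum>k<2 * M n. ip (d k - P (d k)) (d k - P (d k)))
        + 1 / real n * (\<Sum>k<2 * M n. ip (d k) (d k))" if "n \<ge> 1" for n
      using C[of "M n"] that unfolding dd rr by fastforce
    then show "(\<forall>x. P x = x) \<or> (\<forall>n\<ge>1. (\<Sum>k<2 * M n. ip (d k) (d k)) \<le> (\<Sum>k<2 * M n. ip (d k - P (d k)) (d k - P (d k)))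
        + 1 / real n * (\<Sum>k<2 * M n. ip (d k) (d k)))" by blast
    show "P (d k) = 0 \<or> P (d k) = d k" for k by (simp add: d_def)
  qed
qed

end

section \<open>Existence of the Gaussian field\<close>

text \<open>The variance of the absolute value is nonnegative.\<close>

lemma (in prob_space) integral_abs_le_sqrt:
  fixes X :: "'a \<Rightarrow> real"
  assumes [measurable]: "X \<in> borel_measurable M" and X: "integrable M (\<lambda>x. (X x)\<^sup>2)"
  shows "integrable M X" "(\<integral>x. \<bar>X x\<bar> \<partial>M) \<le> sqrt (\<integral>x. (X x)\<^sup>2 \<partial>M)"
proof -
  show i: "integrable M X" using square_integrable_imp_integrable[OF assms] .
  have "0 \<le> variance (\<lambda>x. \<bar>X x\<bar>)" by simp
  also have "\<dots> = (\<integral>x. (X x)\<^sup>2 \<partial>M) - (\<integral>x. \<bar>X x\<bar> \<partial>M)\<^sup>2"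
    using i X by (subst variance_eq) auto
  finally show "(\<integral>x. \<bar>X x\<bar> \<partial>M) \<le> sqrt (\<integral>x. (X x)\<^sup>2 \<partial>M)"
    by (intro real_le_rsqrt) simp
qed

lemma power2_sum_le: "(a + b + c)\<^sup>2 \<le> 3 * (a\<^sup>2 + b\<^sup>2 + (c::real)\<^sup>2)"
  using sum_squares_bound[of a b] sum_squares_bound[of b c] sum_squares_bound[of a c]
  by (simp add: power2_eq_square algebra_simps)

lemma power2_diff_le: "(a - b)\<^sup>2 \<le> 2 * (a\<^sup>2 + (b::real)\<^sup>2)"
  using zero_le_power2[of "a + b"] by (simp add: power2_sum power2_diff)

text \<open>Riesz-Fischer at the level of functions: an L2 Cauchy sequence is L1 Cauchy, a
  subsequence converges almost everywhere, and Fatou carries the Cauchy estimate over to the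
  limit.\<close>

lemma (in prob_space) L2_complete:
  fixes S :: "nat \<Rightarrow> 'a \<Rightarrow> real"
  assumes S[measurable]: "\<And>n. S n \<in> borel_measurable M" and S2: "\<And>n. integrable M (\<lambda>x. (S n x)\<^sup>2)"
    and cauchy: "\<And>e. e > 0 \<Longrightarrow> \<exists>N. \<forall>i\<ge>N. \<forall>j\<ge>N. (\<integral>x. (S i x - S j x)\<^sup>2 \<partial>M) < e"
  shows "\<exists>X. X \<in> borel_measurable M \<and> integrable M (\<lambda>x. (X x)\<^sup>2) \<and>
    (\<forall>n. integrable M (\<lambda>x. (S n x - X x)\<^sup>2)) \<and> (\<lambda>n. \<integral>x. (S n x - X x)\<^sup>2 \<partial>M) \<longlonglongrightarrow> 0"
proof -
  have diff: "integrable M (\<lambda>x. (S i x - S j x)\<^sup>2)" for i j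
  proof (rule Bochner_Integration.integrable_bound)
    show "integrable M (\<lambda>x. 2 * ((S i x)\<^sup>2 + (S j x)\<^sup>2))" using S2 by simp
    show "AE x in M. norm ((S i x - S j x)\<^sup>2) \<le> norm (2 * ((S i x)\<^sup>2 + (S j x)\<^sup>2))"
      using power2_diff_le by (intro AE_I2) simp
  qed simp
  obtain r where r: "strict_mono r" "AE x in M. Cauchy (\<lambda>i. S (r i) x)"
  proof (rule cauchy_L1_AE_cauchy_subseq)
    show "integrable M (S n)" for n by (rule integral_abs_le_sqrt[OF S S2])
    show "\<exists>N. \<forall>i\<ge>N. \<forall>j\<ge>N. (\<integral>x. norm (S i x - S j x) \<partial>M) < e" if "e > 0" for e
    proof -
      have "e\<^sup>2 > 0" using that by simp
      from cauchy[OF this] obtain N where N: "\<forall>i\<ge>N. \<forall>j\<ge>N. (\<integral>x. (S i x - S j x)\<^sup>2 \<partial>M) < e\<^sup>2"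
        by blast
      have "(\<integral>x. norm (S i x - S j x) \<partial>M) < e" if "i \<ge> N" "j \<ge> N" for i j
      proof -
        have "(\<integral>x. norm (S i x - S j x) \<partial>M) \<le> sqrt (\<integral>x. (S i x - S j x)\<^sup>2 \<partial>M)"
          using integral_abs_le_sqrt(2)[OF _ diff[of i j]] by simp
        also have "\<dots> < sqrt (e\<^sup>2)" using N that by (intro real_sqrt_less_mono) simp
        finally show ?thesis using \<open>e > 0\<close> by simp
      qed
      then show ?thesis by blast
    qed
  qed
  define X where "X x = lim (\<lambda>i. S (r i) x)" for x
  have [measurable]: "X \<in> borel_measurable M" unfolding X_def by measurable
  have lim: "AE x in M. (\<lambda>i. S (r i) x) \<longlonglongrightarrow> X x"
    using r(2) by eventually_elim (simp add: X_def Cauchy_convergent_iff convergent_LIMSEQ_iff)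
  have bound: "\<exists>N. \<forall>n\<ge>N. (\<integral>\<^sup>+x. ennreal ((S n x - X x)\<^sup>2) \<partial>M) \<le> ennreal e" if e: "e > 0" for e
  proof -
    obtain N where N: "\<And>i j. i \<ge> N \<Longrightarrow> j \<ge> N \<Longrightarrow> (\<integral>x. (S i x - S j x)\<^sup>2 \<partial>M) < e"
      using cauchy[OF e] by blast
    have "(\<integral>\<^sup>+x. ennreal ((S n x - X x)\<^sup>2) \<partial>M) \<le> ennreal e" if n: "n \<ge> N" for n
    proof -
      have "AE x in M. ennreal ((S n x - X x)\<^sup>2) = liminf (\<lambda>i. ennreal ((S n x - S (r i) x)\<^sup>2))"
        using lim
      proof eventually_elim
        case (elim x)
        have "(\<lambda>i. ennreal ((S n x - S (r i) x)\<^sup>2)) \<longlonglongrightarrow> ennreal ((S n x - X x)\<^sup>2)"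
          by (intro tendsto_ennrealI tendsto_intros elim)
        then show ?case by (rule lim_imp_Liminf[OF sequentially_bot, symmetric])
      qed
      then have "(\<integral>\<^sup>+x. ennreal ((S n x - X x)\<^sup>2) \<partial>M) = (\<integral>\<^sup>+x. liminf (\<lambda>i. ennreal ((S n x - S (r i) x)\<^sup>2)) \<partial>M)"
        by (rule nn_integral_cong_AE)
      also have "\<dots> \<le> liminf (\<lambda>i. \<integral>\<^sup>+x. ennreal ((S n x - S (r i) x)\<^sup>2) \<partial>M)"
        by (intro nn_integral_liminf) simp
      also have "\<dots> \<le> ennreal e"
      proof (rule Liminf_le[OF trivial_limit_sequentially])
        show "\<forall>\<^sub>F i in sequentially. (\<integral>\<^sup>+x. ennreal ((S n x - S (r i) x)\<^sup>2) \<partial>M) \<le> ennreal e"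
        proof (rule eventually_sequentiallyI)
          fix i assume "N \<le> i"
          then have "r i \<ge> N" using seq_suble[OF r(1), of i] by simp
          have "(\<integral>\<^sup>+x. ennreal ((S n x - S (r i) x)\<^sup>2) \<partial>M) = ennreal (\<integral>x. (S n x - S (r i) x)\<^sup>2 \<partial>M)"
            using diff by (intro nn_integral_eq_integral) auto
          then show "(\<integral>\<^sup>+x. ennreal ((S n x - S (r i) x)\<^sup>2) \<partial>M) \<le> ennreal e"
            using N[OF n \<open>r i \<ge> N\<close>] by (simp add: ennreal_leI)
        qed
      qed
      finally show ?thesis .
    qed
    then show ?thesis by blast
  qed
  obtain N where N: "(\<integral>\<^sup>+x. ennreal ((S N x - X x)\<^sup>2) \<partial>M) \<le> ennreal 1" using bound[of 1] by auto
  have iN: "integrable M (\<lambda>x. (S N x - X x)\<^sup>2)"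
    by (rule integrableI_bounded) (use N in \<open>auto simp: less_top[symmetric] top_unique\<close>)
  have X2: "integrable M (\<lambda>x. (X x)\<^sup>2)"
  proof (rule Bochner_Integration.integrable_bound)
    show "integrable M (\<lambda>x. 2 * ((S N x)\<^sup>2 + (S N x - X x)\<^sup>2))" using S2 iN by simp
    show "AE x in M. norm ((X x)\<^sup>2) \<le> norm (2 * ((S N x)\<^sup>2 + (S N x - X x)\<^sup>2))"
    proof (rule AE_I2)
      fix x show "norm ((X x)\<^sup>2) \<le> norm (2 * ((S N x)\<^sup>2 + (S N x - X x)\<^sup>2))"
        using power2_diff_le[of "S N x" "S N x - X x"] by simp
    qed
  qed simp
  have i: "integrable M (\<lambda>x. (S n x - X x)\<^sup>2)" for n
  proof (rule Bochner_Integration.integrable_bound)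
    show "integrable M (\<lambda>x. 2 * ((S n x)\<^sup>2 + (X x)\<^sup>2))" using S2 X2 by simp
    show "AE x in M. norm ((S n x - X x)\<^sup>2) \<le> norm (2 * ((S n x)\<^sup>2 + (X x)\<^sup>2))"
      using power2_diff_le by (intro AE_I2) simp
  qed simp
  have "(\<lambda>n. \<integral>x. (S n x - X x)\<^sup>2 \<partial>M) \<longlonglongrightarrow> 0"
  proof (rule LIMSEQ_I)
    fix e :: real assume e: "e > 0"
    obtain N where N: "\<And>n. n \<ge> N \<Longrightarrow> (\<integral>\<^sup>+x. ennreal ((S n x - X x)\<^sup>2) \<partial>M) \<le> ennreal (e / 2)"
      using bound[of "e / 2"] e by auto
    have "norm ((\<integral>x. (S n x - X x)\<^sup>2 \<partial>M) - 0) < e" if "n \<ge> N" for n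
    proof -
      have "ennreal (\<integral>x. (S n x - X x)\<^sup>2 \<partial>M) \<le> ennreal (e / 2)"
        using N[OF that] i by (subst (asm) nn_integral_eq_integral) auto
      then show ?thesis using e by (simp add: ennreal_le_iff)
    qed
    then show "\<exists>N. \<forall>n\<ge>N. norm ((\<integral>x. (S n x - X x)\<^sup>2 \<partial>M) - 0) < e" by blast
  qed
  with X2 i show ?thesis by (intro exI[of _ X]) simp
qed

text \<open>The map \<open>x \<mapsto> iexp (t * x)\<close> is Lipschitz with constant
  \<open>\<bar>t\<bar>\<close>, so L2 convergence entails convergence of characteristic
  functions.\<close>

lemma (in prob_space) distr_centered_normal_L2_limit:
  fixes S :: "nat \<Rightarrow> 'a \<Rightarrow> real"
  assumes [measurable]: "\<And>n. S n \<in> borel_measurable M" "X \<in> borel_measurable M"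
    and i: "\<And>n. integrable M (\<lambda>x. (S n x - X x)\<^sup>2)" and lim: "(\<lambda>n. \<integral>x. (S n x - X x)\<^sup>2 \<partial>M) \<longlonglongrightarrow> 0"
    and law: "\<And>n. distr M borel (S n) = centered_normal (s n)" and s: "\<And>n. s n \<ge> 0" "s \<longlonglongrightarrow> s'"
  shows "distr M borel X = centered_normal s'"
proof (rule Levy_uniqueness)
  have s': "s' \<ge> 0" using s by (intro LIMSEQ_le_const[OF s(2)]) auto
  then show "real_distribution (distr M borel X)" "real_distribution (centered_normal s')"
    by (auto intro: real_distribution_distr real_distribution_centered_normal)
  show "char (distr M borel X) = char (centered_normal s')"
  proof
    fix t
    have ch: "char (distr M borel Y) t = (CLINT x|M. iexp (t * Y x))" if [measurable]: "Y \<in> borel_measurable M" for Y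
      unfolding char_def by (subst integral_distr) auto
    have ii: "integrable M (\<lambda>x. iexp (t * Y x))" if [measurable]: "Y \<in> borel_measurable M" for Y :: "'a \<Rightarrow> real"
      by (intro integrable_const_bound[where B = 1]) auto
    have "norm (char (distr M borel (S n)) t - char (distr M borel X) t) \<le> \<bar>t\<bar> * sqrt (\<integral>x. (S n x - X x)\<^sup>2 \<partial>M)" for n
    proof -
      have lip: "norm (iexp (t * a) - iexp (t * b)) \<le> \<bar>t\<bar> * \<bar>a - b\<bar>" for a b
      proof -
        have "iexp (t * a) - iexp (t * b) = iexp (t * b) * (iexp (t * (a - b)) - 1)"
          by (simp add: algebra_simps flip: exp_add)
        then have "norm (iexp (t * a) - iexp (t * b)) = norm (iexp (t * (a - b)) - 1)"
          by (simp add: norm_mult)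
        also have "\<dots> \<le> \<bar>t * (a - b)\<bar>" using iexp_approx1[of "t * (a - b)" 0] by simp
        finally show ?thesis by (simp add: abs_mult)
      qed
      have i1: "integrable M (\<lambda>x. S n x - X x)" by (rule integral_abs_le_sqrt[OF _ i]) simp
      have "norm (char (distr M borel (S n)) t - char (distr M borel X) t) = norm (CLINT x|M. iexp (t * S n x) - iexp (t * X x))"
        using ii by (simp add: ch)
      also have "\<dots> \<le> (\<integral>x. norm (iexp (t * S n x) - iexp (t * X x)) \<partial>M)" by (rule integral_norm_bound)
      also have "\<dots> \<le> (\<integral>x. \<bar>t\<bar> * \<bar>S n x - X x\<bar> \<partial>M)"
        using ii i1 lip by (intro integral_mono) auto
      also have "\<dots> \<le> \<bar>t\<bar> * sqrt (\<integral>x. (S n x - X x)\<^sup>2 \<partial>M)"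
        using integral_abs_le_sqrt(2)[OF _ i[of n]] by (simp add: mult_left_mono)
      finally show ?thesis .
    qed
    note b = this
    have l: "(\<lambda>n. \<bar>t\<bar> * sqrt (\<integral>x. (S n x - X x)\<^sup>2 \<partial>M)) \<longlonglongrightarrow> 0"
      using tendsto_mult[OF tendsto_const tendsto_real_sqrt[OF lim], of "\<bar>t\<bar>"] by simp
    have "(\<lambda>n. char (distr M borel (S n)) t - char (distr M borel X) t) \<longlonglongrightarrow> 0"
      by (rule Lim_null_comparison[OF always_eventually[OF allI[OF b]] l])
    then have "(\<lambda>n. char (distr M borel (S n)) t) \<longlonglongrightarrow> char (distr M borel X) t" by (rule Lim_null[THEN iffD2])
    moreover have "(\<lambda>n. char (distr M borel (S n)) t) \<longlonglongrightarrow> char (centered_normal s') t"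
      unfolding law char_centered_normal[OF s(1)] char_centered_normal[OF s']
      by (intro tendsto_of_real tendsto_intros s(2)) auto
    ultimately show "char (distr M borel X) t = char (centered_normal s') t" by (rule LIMSEQ_unique)
  qed
qed

text \<open>The field is the L2 limit of \<open>\<Sum>k<n. (f \<cdot> e k) * \<omega> k\<close>. The
  squared L2 distance of two partial sums is the difference of their variances, and these converge
  to \<open>f \<cdot> Q f\<close> by Parseval.\<close>

lemma (in covariance_operator) gaussian_field_exists:
  "\<exists>(M :: (nat \<Rightarrow> real) measure) \<xi>. gaussian_field Q M \<xi>"
proof -
  interpret G: prob_space gauss_seq by (rule prob_space_gauss_seq)
  obtain e where e: "orthosystem e" "\<And>u. (\<lambda>k. (ip (e k) u)\<^sup>2) sums ip u u"
    by (rule exists_orthonormal_basis) blast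
  define S where "S f n \<omega> = (\<Sum>k<n. (f \<cdot> e k) * \<omega> k)" for f :: "'b dual" and n and \<omega> :: "nat \<Rightarrow> real"
  define s where "s f n = (\<Sum>k<n. (f \<cdot> e k)\<^sup>2)" for f :: "'b dual" and n
  have Sm[measurable]: "S f n \<in> borel_measurable gauss_seq" for f n
    unfolding S_def by measurable
  have s0: "s f n \<ge> 0" for f n unfolding s_def by (intro sum_nonneg) simp
  have sconv: "s f \<longlonglongrightarrow> f \<cdot> Q f" for f
    using e(2)[of "Q f"] unfolding sums_def s_def by (simp add: ip_commute[of "e _" "Q f"])
  have law: "distr gauss_seq borel (S f n) = centered_normal (s f n)" for f n
    unfolding S_def s_def by (rule distr_gauss_seq_sum)
  have S2: "integrable gauss_seq (\<lambda>\<omega>. (S f n \<omega>)\<^sup>2)" for f n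
    by (rule prob_space_distr_centered_normal(1)[OF law s0 Sm])
  have diff: "(\<integral>\<omega>. (S f i \<omega> - S f j \<omega>)\<^sup>2 \<partial>gauss_seq) = \<bar>s f i - s f j\<bar>" for f i j
  proof -
    have *: "(\<integral>\<omega>. (S f i \<omega> - S f j \<omega>)\<^sup>2 \<partial>gauss_seq) = \<bar>s f i - s f j\<bar>" if "j \<le> i" for i j
    proof -
      have cut: "(\<Sum>k<i. g k) - (\<Sum>k<j. g k) = (\<Sum>k<i. if k < j then 0 else g k)" for g :: "nat \<Rightarrow> real"
        using that by (induction rule: dec_induct) (simp_all add: sum.neutral)
      define a where "a k = (if k < j then 0 else f \<cdot> e k)" for k
      have "S f i \<omega> - S f j \<omega> = (\<Sum>k<i. a k * \<omega> k)" "s f i - s f j = (\<Sum>k<i. (a k)\<^sup>2)" for \<omega>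
        unfolding S_def s_def cut by (intro sum.cong refl; simp add: a_def)+
      moreover have "(\<integral>\<omega>. (\<Sum>k<i. a k * \<omega> k)\<^sup>2 \<partial>gauss_seq) = (\<Sum>k<i. (a k)\<^sup>2)"
        by (rule prob_space_distr_centered_normal(2)[OF distr_gauss_seq_sum]) (auto intro: sum_nonneg)
      ultimately show ?thesis by (simp add: sum_nonneg)
    qed
    show ?thesis
    proof (cases "j \<le> i")
      case False
      then show ?thesis using *[of i j] by (simp add: power2_commute[of "S f i _"] abs_minus_commute)
    qed (rule *)
  qed
  have "\<exists>X. X \<in> borel_measurable gauss_seq \<and> integrable gauss_seq (\<lambda>\<omega>. (X \<omega>)\<^sup>2) \<and>
    (\<forall>n. integrable gauss_seq (\<lambda>\<omega>. (S f n \<omega> - X \<omega>)\<^sup>2)) \<and>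
    (\<lambda>n. \<integral>\<omega>. (S f n \<omega> - X \<omega>)\<^sup>2 \<partial>gauss_seq) \<longlonglongrightarrow> 0" for f
  proof (rule G.L2_complete[OF Sm S2])
    fix r :: real assume "r > 0"
    then show "\<exists>N. \<forall>i\<ge>N. \<forall>j\<ge>N. (\<integral>\<omega>. (S f i \<omega> - S f j \<omega>)\<^sup>2 \<partial>gauss_seq) < r"
      using metric_CauchyD[OF LIMSEQ_imp_Cauchy[OF sconv[of f]], of r] by (auto simp: diff dist_real_def)
  qed
  then have "\<exists>\<xi>. \<forall>f. \<xi> f \<in> borel_measurable gauss_seq \<and> integrable gauss_seq (\<lambda>\<omega>. (\<xi> f \<omega>)\<^sup>2) \<and>
    (\<forall>n. integrable gauss_seq (\<lambda>\<omega>. (S f n \<omega> - \<xi> f \<omega>)\<^sup>2)) \<and>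
    (\<lambda>n. \<integral>\<omega>. (S f n \<omega> - \<xi> f \<omega>)\<^sup>2 \<partial>gauss_seq) \<longlonglongrightarrow> 0"
    by (intro choice allI)
  then obtain \<xi> where \<xi>[measurable]: "\<And>f. \<xi> f \<in> borel_measurable gauss_seq"
    and \<xi>2: "\<And>f. integrable gauss_seq (\<lambda>\<omega>. (\<xi> f \<omega>)\<^sup>2)"
    and Si: "\<And>f n. integrable gauss_seq (\<lambda>\<omega>. (S f n \<omega> - \<xi> f \<omega>)\<^sup>2)"
    and Sl: "\<And>f. (\<lambda>n. \<integral>\<omega>. (S f n \<omega> - \<xi> f \<omega>)\<^sup>2 \<partial>gauss_seq) \<longlonglongrightarrow> 0" by blast
  have \<xi>law: "distr gauss_seq borel (\<xi> f) = centered_normal (f \<cdot> Q f)" for f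
    by (rule G.distr_centered_normal_L2_limit[OF Sm \<xi> Si Sl law s0 sconv])
  have Q_nonneg: "f \<cdot> Q f \<ge> 0" for f
    using ip_nonneg[of "Q f"] by (simp only: ip_Q)
  have lin: "AE \<omega> in gauss_seq. \<xi> (a *\<^sub>R f + b *\<^sub>R g) \<omega> = a * \<xi> f \<omega> + b * \<xi> g \<omega>" for a b f g
  proof -
    let ?h = "a *\<^sub>R f + b *\<^sub>R g"
    define Z where "Z \<omega> = \<xi> ?h \<omega> - a * \<xi> f \<omega> - b * \<xi> g \<omega>" for \<omega>
    have [measurable]: "Z \<in> borel_measurable gauss_seq" unfolding Z_def by measurable
    define D where "D h n \<omega> = (S h n \<omega> - \<xi> h \<omega>)\<^sup>2" for h n \<omega>
    have Sh: "S ?h n \<omega> = a * S f n \<omega> + b * S g n \<omega>" for n \<omega>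
      by (simp add: S_def blinfun.add_left blinfun.scaleR_left algebra_simps sum.distrib sum_distrib_left)
    \<comment> \<open>Partial sums are exactly linear in the functional, so the defect
      \<open>Z\<close> is a sum of three approximation errors, whose L2 norms tend to 0.\<close>
    have le: "(Z \<omega>)\<^sup>2 \<le> 3 * (D ?h n \<omega> + a\<^sup>2 * D f n \<omega> + b\<^sup>2 * D g n \<omega>)" for n \<omega>
    proof -
      have "Z \<omega> = - (S ?h n \<omega> - \<xi> ?h \<omega>) + a * (S f n \<omega> - \<xi> f \<omega>) + b * (S g n \<omega> - \<xi> g \<omega>)"
        by (simp add: Z_def Sh algebra_simps)
      then show ?thesis
        using power2_sum_le[of "- (S ?h n \<omega> - \<xi> ?h \<omega>)" "a * (S f n \<omega> - \<xi> f \<omega>)" "b * (S g n \<omega> - \<xi> g \<omega>)"]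
        by (simp only: D_def power_mult_distrib power2_minus)
    qed
    have Di: "integrable gauss_seq (D h n)" for h n unfolding D_def by (rule Si)
    then have i3: "integrable gauss_seq (\<lambda>\<omega>. 3 * (D ?h n \<omega> + a\<^sup>2 * D f n \<omega> + b\<^sup>2 * D g n \<omega>))" for n by simp
    have Z2: "integrable gauss_seq (\<lambda>\<omega>. (Z \<omega>)\<^sup>2)"
      by (rule Bochner_Integration.integrable_bound[OF i3[of 0]])
         (use le[of _ 0] in \<open>auto intro: order_trans[OF _ abs_ge_self]\<close>)
    have "(\<integral>\<omega>. (Z \<omega>)\<^sup>2 \<partial>gauss_seq) \<le> 3 * ((\<integral>\<omega>. D ?h n \<omega> \<partial>gauss_seq) + a\<^sup>2 * (\<integral>\<omega>. D f n \<omega> \<partial>gauss_seq) + b\<^sup>2 * (\<integral>\<omega>. D g n \<omega> \<partial>gauss_seq))" for n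
      using integral_mono[OF Z2 i3 le] Di by simp
    moreover have "(\<lambda>n. 3 * ((\<integral>\<omega>. D ?h n \<omega> \<partial>gauss_seq) + a\<^sup>2 * (\<integral>\<omega>. D f n \<omega> \<partial>gauss_seq) + b\<^sup>2 * (\<integral>\<omega>. D g n \<omega> \<partial>gauss_seq)))
      \<longlonglongrightarrow> 3 * (0 + a\<^sup>2 * 0 + b\<^sup>2 * 0)"
      unfolding D_def by (intro tendsto_intros Sl)
    ultimately have "(\<integral>\<omega>. (Z \<omega>)\<^sup>2 \<partial>gauss_seq) \<le> 3 * (0 + a\<^sup>2 * 0 + b\<^sup>2 * 0)"
      by (intro LIMSEQ_le_const) auto
    then have "(\<integral>\<omega>. (Z \<omega>)\<^sup>2 \<partial>gauss_seq) = 0"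
      by (intro antisym integral_nonneg_AE) auto
    then have "AE \<omega> in gauss_seq. (Z \<omega>)\<^sup>2 = 0"
      using integral_nonneg_eq_0_iff_AE[OF Z2] by simp
    then show ?thesis by eventually_elim (simp add: Z_def)
  qed
  have cov: "(\<integral>\<omega>. \<xi> f \<omega> * \<xi> g \<omega> \<partial>gauss_seq) = f \<cdot> Q g" for f g
  proof -
    have var: "(\<integral>\<omega>. (\<xi> f \<omega>)\<^sup>2 \<partial>gauss_seq) = f \<cdot> Q f" for f
      by (rule prob_space_distr_centered_normal(2)[OF \<xi>law Q_nonneg \<xi>])
    \<comment> \<open>Polarization reduces covariances to the variances already known.\<close>
    have "AE \<omega> in gauss_seq. \<xi> f \<omega> * \<xi> g \<omega> = ((\<xi> (f + g) \<omega>)\<^sup>2 - (\<xi> f \<omega>)\<^sup>2 - (\<xi> g \<omega>)\<^sup>2) / 2"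
      using lin[of 1 f 1 g] by eventually_elim (simp add: power2_sum)
    then have "(\<integral>\<omega>. \<xi> f \<omega> * \<xi> g \<omega> \<partial>gauss_seq) = (\<integral>\<omega>. ((\<xi> (f + g) \<omega>)\<^sup>2 - (\<xi> f \<omega>)\<^sup>2 - (\<xi> g \<omega>)\<^sup>2) / 2 \<partial>gauss_seq)"
      by (intro integral_cong_AE) auto
    also have "\<dots> = ((f + g) \<cdot> Q (f + g) - f \<cdot> Q f - g \<cdot> Q g) / 2"
      using \<xi>2 by (simp add: var)
    also have "\<dots> = f \<cdot> Q g"
      using Q_symmetric[of g f] by (simp add: linear_add[OF Q_linear] blinfun.add_left blinfun.add_right)
    finally show ?thesis .
  qed
  have "gaussian_field Q gauss_seq \<xi>"
    unfolding gaussian_field_def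
    using prob_space_gauss_seq \<xi> \<xi>2 lin cov \<xi>law Q_nonneg by blast
  then show ?thesis by blast
qed

section \<open>The Gaussian cylinder measure of a field\<close>

lemma coords_measurable: "coords k f \<in> borel \<rightarrow>\<^sub>M euclid k"
  unfolding coords_def
  by (intro measurable_restrict borel_measurable_continuous_onI continuous_intros)

context covariance_operator
begin

context
  fixes M :: "'w measure" and \<eta> :: "'b dual \<Rightarrow> 'w \<Rightarrow> real"
  assumes \<eta>_lin: "\<And>a b f g. AE \<omega> in M. \<eta> (a *\<^sub>R f + b *\<^sub>R g) \<omega> = a * \<eta> f \<omega> + b * \<eta> g \<omega>"
    and \<eta>_meas: "\<And>f. \<eta> f \<in> borel_measurable M"
begin

lemma AE_field_sum:
  assumes "finite I"
  shows "AE \<omega> in M. \<eta> (\<Sum>i\<in>I. c i *\<^sub>R g i) \<omega> = (\<Sum>i\<in>I. c i * \<eta> (g i) \<omega>)"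
  using assms
proof (induction rule: finite_induct)
  case empty
  show ?case using \<eta>_lin[of 0 0 0 0] by simp
next
  case (insert i I)
  from insert.IH \<eta>_lin[of "c i" "g i" 1 "\<Sum>i\<in>I. c i *\<^sub>R g i"] show ?case
    by eventually_elim (use insert.hyps in simp)
qed

lemma field_representation:
  assumes "finite G"
  obtains X where "X \<in> borel_measurable M" "\<And>g. g \<in> G \<Longrightarrow> AE \<omega> in M. \<eta> g \<omega> = g \<cdot> X \<omega>"
proof -
  obtain b k where "orthosystem b" and b: "\<And>x. x \<in> span (Q ` G) \<Longrightarrow> x = (\<Sum>i<k. ip (b i) x *\<^sub>R b i)"
    and "\<And>x. x \<in> span (Q ` G) \<Longrightarrow> ip x x = (\<Sum>i<k. (ip (b i) x)\<^sup>2)"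
    by (rule finite_orthonormal[OF finite_imageI[OF assms]]) auto
  define X where "X \<omega> = (\<Sum>i<k. \<eta> (inv Q (b i)) \<omega> *\<^sub>R b i)" for \<omega>
  show ?thesis
  proof (rule that)
    show "X \<in> borel_measurable M" unfolding X_def using \<eta>_meas by measurable
    show "AE \<omega> in M. \<eta> g \<omega> = g \<cdot> X \<omega>" if "g \<in> G" for g
    proof -
      have "Q g = (\<Sum>i<k. ip (b i) (Q g) *\<^sub>R b i)" using that by (intro b span_base) auto
      then have "inv Q (Q g) = inv Q (\<Sum>i<k. ip (b i) (Q g) *\<^sub>R b i)" by simp
      then have g: "g = (\<Sum>i<k. (g \<cdot> b i) *\<^sub>R inv Q (b i))"
        by (simp add: linear_sum[OF linear_inv_Q] linear_scale[OF linear_inv_Q] ip_commute[of "b _" "Q g"])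
      have "AE \<omega> in M. \<eta> (\<Sum>i<k. (g \<cdot> b i) *\<^sub>R inv Q (b i)) \<omega> = (\<Sum>i<k. (g \<cdot> b i) * \<eta> (inv Q (b i)) \<omega>)"
        by (rule AE_field_sum) simp
      then show ?thesis
        by eventually_elim (simp add: g[symmetric] X_def blinfun.sum_right blinfun.scaleR_right mult.commute)
    qed
  qed
qed

definition field_coords :: "nat \<Rightarrow> (nat \<Rightarrow> 'b dual) \<Rightarrow> 'w \<Rightarrow> nat \<Rightarrow> real" where
  "field_coords k f \<omega> = (\<lambda>i\<in>{..<k}. \<eta> (f i) \<omega>)"

lemma field_coords_measurable: "field_coords k f \<in> M \<rightarrow>\<^sub>M euclid k"
  unfolding field_coords_def by (intro measurable_restrict \<eta>_meas)

lemma emeasure_field_coords: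
  assumes X: "X \<in> borel_measurable M" "\<And>i. i < k \<Longrightarrow> AE \<omega> in M. \<eta> (f i) \<omega> = f i \<cdot> X \<omega>"
    and A: "A \<in> sets (euclid k)"
  shows "emeasure M (field_coords k f -` A \<inter> space M) = emeasure M (X -` (coords k f -` A) \<inter> space M)"
proof (rule emeasure_eq_AE)
  have "AE \<omega> in M. \<forall>i\<in>{..<k}. \<eta> (f i) \<omega> = f i \<cdot> X \<omega>"
    using X(2) by (intro AE_finite_allI) auto
  then show "AE \<omega> in M. \<omega> \<in> field_coords k f -` A \<inter> space M \<longleftrightarrow> \<omega> \<in> X -` (coords k f -` A) \<inter> space M"
  proof eventually_elim
    case (elim \<omega>)
    then have "field_coords k f \<omega> = coords k f (X \<omega>)"
      by (auto simp: field_coords_def coords_def)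
    then show ?case by simp
  qed
  show "field_coords k f -` A \<inter> space M \<in> sets M"
    by (rule measurable_sets[OF field_coords_measurable A])
  show "X -` (coords k f -` A) \<inter> space M \<in> sets M"
    using measurable_sets[OF measurable_compose[OF X(1) coords_measurable] A] by (simp add: vimage_def)
qed

text \<open>A cylinder set has many presentations by functionals and a base. Representing the field
  by a single random vector on the functionals of both presentations shows that they yield the same
  probability, which makes the definite description legitimate.\<close>

lemma gaussian_cylinder_measure_of_field:
  assumes M: "prob_space M" and law: "\<And>f. distr M borel (\<eta> f) = centered_normal (f \<cdot> T f)"
  shows "\<exists>\<mu>. gaussian_cylinder_measure T \<mu>"
proof -
  interpret prob_space M by fact
  define \<mu> where "\<mu> C = (THE p. \<exists>k f A. A \<in> sets (euclid k) \<and> C = coords k f -` A \<and>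
    p = emeasure M (field_coords k f -` A \<inter> space M))" for C
  have eq: "\<mu> (coords k f -` A) = emeasure M (field_coords k f -` A \<inter> space M)" if A: "A \<in> sets (euclid k)" for k f A
    unfolding \<mu>_def
  proof (rule the_equality)
    show "\<exists>k' f' A'. A' \<in> sets (euclid k') \<and> coords k f -` A = coords k' f' -` A' \<and>
      emeasure M (field_coords k f -` A \<inter> space M) = emeasure M (field_coords k' f' -` A' \<inter> space M)"
      using A by blast
    fix p assume "\<exists>k' f' A'. A' \<in> sets (euclid k') \<and> coords k f -` A = coords k' f' -` A' \<and>
      p = emeasure M (field_coords k' f' -` A' \<inter> space M)"
    then obtain k' f' A' where A': "A' \<in> sets (euclid k')" "coords k f -` A = coords k' f' -` A'"
      "p = emeasure M (field_coords k' f' -` A' \<inter> space M)" by blast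
    obtain X where X: "X \<in> borel_measurable M" "\<And>g. g \<in> f ` {..<k} \<union> f' ` {..<k'} \<Longrightarrow> AE \<omega> in M. \<eta> g \<omega> = g \<cdot> X \<omega>"
      by (rule field_representation[of "f ` {..<k} \<union> f' ` {..<k'}"]) auto
    show "p = emeasure M (field_coords k f -` A \<inter> space M)"
      using emeasure_field_coords[OF X(1) _ A, of f] emeasure_field_coords[OF X(1) _ A'(1), of f'] X(2) A'(2,3)
      by auto
  qed
  have distr: "\<mu> (coords k f -` A) = emeasure (distr M (euclid k) (field_coords k f)) A" if "A \<in> sets (euclid k)" for k f A
    using that by (simp add: eq emeasure_distr[OF field_coords_measurable])
  have "cylinder_measure \<mu>"
    unfolding cylinder_measure_def
  proof (intro conjI allI)
    show "additive cylinder_sets \<mu>"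
      unfolding additive_def
    proof (intro ballI impI)
      fix C D :: "'b set" assume C: "C \<in> cylinder_sets" and D: "D \<in> cylinder_sets" and "C \<inter> D = {}"
      obtain k f A where A: "A \<in> sets (euclid k)" "C = coords k f -` A" using C unfolding cylinder_sets_def by blast
      obtain l g B where B: "B \<in> sets (euclid l)" "D = coords l g -` B" using D unfolding cylinder_sets_def by blast
      \<comment> \<open>Concatenating the two families of functionals presents both cylinder sets
        over a common base space, where additivity is that of a measure.\<close>
      define h where "h i = (if i < k then f i else g (i - k))" for i
      define A' where "A' = {y \<in> space (euclid (k + l)). (\<lambda>i\<in>{..<k}. y i) \<in> A}"
      define B' where "B' = {y \<in> space (euclid (k + l)). (\<lambda>i\<in>{..<l}. y (i + k)) \<in> B}"
      have "(\<lambda>y. \<lambda>i\<in>{..<k}. y i) \<in> euclid (k + l) \<rightarrow>\<^sub>M euclid k"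
        by (intro measurable_restrict measurable_component_singleton) auto
      from measurable_sets[OF this A(1)] have A': "A' \<in> sets (euclid (k + l))"
        unfolding A'_def by (simp add: vimage_def Int_def conj_commute)
      have "(\<lambda>y. \<lambda>i\<in>{..<l}. y (i + k)) \<in> euclid (k + l) \<rightarrow>\<^sub>M euclid l"
        by (intro measurable_restrict measurable_component_singleton) auto
      from measurable_sets[OF this B(1)] have B': "B' \<in> sets (euclid (k + l))"
        unfolding B'_def by (simp add: vimage_def Int_def conj_commute)
      have sp: "coords n w x \<in> space (euclid n)" for n w and x :: 'b
        by (auto simp: coords_def space_PiM)
      have "(\<lambda>i\<in>{..<k}. coords (k + l) h x i) = coords k f x" "(\<lambda>i\<in>{..<l}. coords (k + l) h x (i + k)) = coords l g x" for x
        by (auto simp: coords_def h_def fun_eq_iff restrict_def)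
      then have CD: "C = coords (k + l) h -` A'" "D = coords (k + l) h -` B'"
        unfolding A(2) B(2) A'_def B'_def using sp by auto
      obtain X where X: "X \<in> borel_measurable M" "\<And>i. i < k + l \<Longrightarrow> AE \<omega> in M. \<eta> (h i) \<omega> = h i \<cdot> X \<omega>"
        by (rule field_representation[of "h ` {..<k + l}"]) auto
      have em: "\<mu> (coords (k + l) h -` E) = emeasure M (X -` (coords (k + l) h -` E) \<inter> space M)" if "E \<in> sets (euclid (k + l))" for E
        using emeasure_field_coords[OF X that] that by (simp add: eq)
      have Xs: "X -` (coords (k + l) h -` E) \<inter> space M \<in> sets M" if "E \<in> sets (euclid (k + l))" for E
        using measurable_sets[OF measurable_compose[OF X(1) coords_measurable] that] by (simp add: vimage_def)
      have "\<mu> (C \<union> D) = \<mu> (coords (k + l) h -` (A' \<union> B'))" by (simp add: CD vimage_Un)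
      also have "\<dots> = emeasure M ((X -` C \<inter> space M) \<union> (X -` D \<inter> space M))"
        using A' B' by (subst em) (auto simp: CD intro!: arg_cong[where f = "emeasure M"])
      also have "\<dots> = emeasure M (X -` C \<inter> space M) + emeasure M (X -` D \<inter> space M)"
        using Xs[OF A'] Xs[OF B'] \<open>C \<inter> D = {}\<close> by (intro plus_emeasure[symmetric]) (auto simp: CD)
      also have "\<dots> = \<mu> C + \<mu> D" using em[OF A'] em[OF B'] by (simp add: CD)
      finally show "\<mu> (C \<union> D) = \<mu> C + \<mu> D" .
    qed
    show "measure_space (space (euclid k)) (sets (euclid k)) (\<lambda>A. \<mu> (coords k f -` A))" for k f
    proof -
      have "measure_space (space (euclid k)) (sets (euclid k)) (emeasure (distr M (euclid k) (field_coords k f)))"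
        using measure_space[of "distr M (euclid k) (field_coords k f)"] by simp
      moreover have "measure_space (space (euclid k)) (sets (euclid k)) (\<lambda>A. \<mu> (coords k f -` A)) =
        measure_space (space (euclid k)) (sets (euclid k)) (emeasure (distr M (euclid k) (field_coords k f)))"
        using distr[of _ k f] measure_space_eq[of "sets (euclid k)" "space (euclid k)"
            "\<lambda>A. \<mu> (coords k f -` A)" "emeasure (distr M (euclid k) (field_coords k f))"]
        by (simp add: sets.space_closed sets.sigma_sets_eq)
      ultimately show ?thesis by simp
    qed
    \<comment> \<open>The whole space is the cylinder over the one-point product with no
      coordinates.\<close>
    have "\<mu> (coords 0 (\<lambda>_. 0) -` space (euclid 0)) = 1"
      using emeasure_space_1 field_coords_measurable[of 0 "\<lambda>_. 0"]
      by (subst eq) (auto simp: measurable_def intro!: arg_cong[where f = "emeasure M"] elim!: trans[rotated])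
    moreover have "coords 0 (\<lambda>_. 0) -` space (euclid 0) = (UNIV :: 'b set)"
      by (auto simp: coords_def space_PiM)
    ultimately show "\<mu> UNIV = 1" by simp
  qed
  moreover have "push (blinfun_apply f) \<mu> = centered_normal (f \<cdot> T f)" for f
  proof -
    have "push (blinfun_apply f) \<mu> = distr M borel (\<eta> f)"
      unfolding push_def distr_def space_borel
    proof (rule measure_of_eq)
      fix A :: "real set" assume "A \<in> sigma_sets UNIV (sets borel)"
      then have A: "A \<in> sets borel" using sets.sigma_sets_eq[of "borel :: real measure"] by simp
      define A' where "A' = {y \<in> space (euclid 1). y 0 \<in> A}"
      have "(\<lambda>y. y 0) \<in> euclid 1 \<rightarrow>\<^sub>M borel" by (intro measurable_component_singleton) simp
      from measurable_sets[OF this A] have A': "A' \<in> sets (euclid 1)"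
        unfolding A'_def by (simp add: vimage_def Int_def conj_commute)
      have "blinfun_apply f -` A = coords 1 (\<lambda>_. f) -` A'"
        by (auto simp: A'_def coords_def space_PiM)
      moreover have "field_coords 1 (\<lambda>_. f) -` A' \<inter> space M = \<eta> f -` A \<inter> space M"
        by (auto simp: A'_def field_coords_def space_PiM)
      ultimately show "\<mu> (blinfun_apply f -` A) = emeasure M (\<eta> f -` A \<inter> space M)"
        using eq[OF A', of "\<lambda>_. f"] by simp
    qed simp
    then show ?thesis by (simp add: law)
  qed
  ultimately show ?thesis unfolding gaussian_cylinder_measure_def by blast
qed

end

end

section \<open>Full support and independence\<close>

lemma integral_density_pos_part:
  fixes \<eta> g :: "'w \<Rightarrow> real"
  assumes [measurable]: "\<eta> \<in> borel_measurable M" "g \<in> borel_measurable M"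
  shows "(\<integral>\<omega>. g \<omega> \<partial>density M (\<lambda>\<omega>. ennreal (max 0 (\<eta> \<omega>)))) = (\<integral>\<omega>. max 0 (\<eta> \<omega>) * g \<omega> \<partial>M)"
  using integral_density[of g M "\<lambda>\<omega>. max 0 (\<eta> \<omega>)"] by simp

lemma compl_cball_inter: "(\<Inter>n. - cball (0::'a::real_normed_vector) (real n)) = {}"
proof -
  have "x \<notin> (\<Inter>n. - cball (0::'a) (real n))" for x
    using real_arch_simple[of "norm x"] by (simp add: dist_norm)
  then show ?thesis by blast
qed

lemma range_compl_cball_sets:
  fixes m :: "'a::euclidean_space measure"
  assumes sets: "sets m = sets borel"
  shows "range (\<lambda>n. - cball (0::'a) (real n)) \<subseteq> sets m"
  unfolding sets by (intro image_subsetI borel_comp borel_closed closed_cball)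

lemma decseq_compl_cball: "decseq (\<lambda>n. - cball (0::'a::real_normed_vector) (real n))"
  by (intro decseq_SucI) auto

lemma finite_measure_tight:
  fixes m :: "'a::euclidean_space measure"
  assumes fin: "finite_measure m" and sets: "sets m = sets borel" and d: "d > 0"
  shows "\<exists>N. \<forall>n\<ge>N. measure m (- cball 0 (real n)) \<le> d"
proof -
  let ?A = "\<lambda>n. - cball (0::'a) (real n)"
  have "(\<lambda>n. measure m (?A n)) \<longlonglongrightarrow> measure m (\<Inter>n. ?A n)"
    by (rule finite_measure.finite_Lim_measure_decseq[OF fin range_compl_cball_sets[OF sets] decseq_compl_cball])
  then have "(\<lambda>n. measure m (?A n)) \<longlonglongrightarrow> 0"
    unfolding compl_cball_inter by simp
  from LIMSEQ_D[OF this d] obtain N where N: "\<forall>n\<ge>N. norm (measure m (?A n) - 0) < d" by blast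
  show ?thesis
  proof (intro exI allI impI)
    fix n assume "N \<le> n"
    with N have "norm (measure m (?A n) - 0) < d" by blast
    then show "measure m (?A n) \<le> d" by simp
  qed
qed

lemma finite_measure_eqI_trig_euclidean:
  fixes m1 m2 :: "'a::euclidean_space measure"
  assumes fin: "finite_measure m1" "finite_measure m2"
    and sets: "sets m1 = sets borel" "sets m2 = sets borel"
    and eq: "\<And>p. trig p \<Longrightarrow> (\<integral>x. p x \<partial>m1) = (\<integral>x. p x \<partial>m2)"
  shows "m1 = m2"
proof (rule finite_measure_eqI_trig[OF _ fin sets _ eq])
  show "\<exists>f::'a dual. f \<cdot> x \<noteq> f \<cdot> y" if "x \<noteq> y" for x y :: 'a
    using that inner_eq_zero_iff[of "x - y"] inner_diff_left[of x y "x - y"]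
    by (intro exI[of _ "blinfun_inner_left (x - y)"]) simp
  show "\<exists>K. compact K \<and> measure m1 (- K) \<le> d \<and> measure m2 (- K) \<le> d" if d: "d > 0" for d
  proof -
    obtain N1 N2 where "\<forall>n\<ge>N1. measure m1 (- cball 0 (real n)) \<le> d" "\<forall>n\<ge>N2. measure m2 (- cball 0 (real n)) \<le> d"
      using finite_measure_tight[OF fin(1) sets(1) d] finite_measure_tight[OF fin(2) sets(2) d] by blast
    then have "measure m1 (- cball 0 (real (max N1 N2))) \<le> d" "measure m2 (- cball 0 (real (max N1 N2))) \<le> d"
      using max.cobounded1 max.cobounded2 by blast+
    then show ?thesis
      by (intro exI[of _ "cball 0 (real (max N1 N2))"] conjI compact_cball)
  qed
qed

text \<open>The symmetry kills the integral of
  \<open>cos (W \<omega> + b) * sin (s * \<eta> \<omega>)\<close>; dividing by \<open>s\<close> and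
  letting \<open>s\<close> tend to 0, with \<open>\<bar>\<eta> \<omega>\<bar>\<close> as dominating
  function, replaces the sine by \<open>\<eta> \<omega>\<close>.\<close>

lemma (in prob_space) integral_wave_eq_0:
  fixes W \<eta> :: "'a \<Rightarrow> real"
  assumes [measurable]: "W \<in> borel_measurable M" "\<eta> \<in> borel_measurable M" and i: "integrable M \<eta>"
    and sym: "\<And>s b. (\<integral>\<omega>. cos (W \<omega> + s * \<eta> \<omega> + b) \<partial>M) = (\<integral>\<omega>. cos (W \<omega> - s * \<eta> \<omega> + b) \<partial>M)"
  shows "(\<integral>\<omega>. \<eta> \<omega> * cos (W \<omega> + b) \<partial>M) = 0"
proof -
  have sin: "(\<integral>\<omega>. cos (W \<omega> + b) * sin (s * \<eta> \<omega>) \<partial>M) = 0" for s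
  proof -
    have ii1: "integrable M (\<lambda>\<omega>. cos (W \<omega> + s * \<eta> \<omega> + c))" for s c
      by (rule integrable_const_bound[where B = 1]) auto
    have ii: "integrable M (\<lambda>\<omega>. cos (W \<omega> + s * \<eta> \<omega> + c))" "integrable M (\<lambda>\<omega>. cos (W \<omega> - s * \<eta> \<omega> + c))" for c
      using ii1[of s c] ii1[of "- s" c] by simp_all
    \<comment> \<open>The phase shift by \<open>pi / 2\<close> turns the cosines into sines, whose
      difference is the required product up to the factor \<open>- 2\<close>.\<close>
    have "cos (W \<omega> + b) * sin (s * \<eta> \<omega>) =
      (cos (W \<omega> - s * \<eta> \<omega> + (b - pi / 2)) - cos (W \<omega> + s * \<eta> \<omega> + (b - pi / 2))) * (- 1 / 2)" for \<omega>
    proof -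
      have c: "cos (x - pi / 2) = sin x" for x :: real by (simp add: cos_diff)
      have "W \<omega> - s * \<eta> \<omega> + (b - pi / 2) = ((W \<omega> + b) - s * \<eta> \<omega>) - pi / 2"
        "W \<omega> + s * \<eta> \<omega> + (b - pi / 2) = ((W \<omega> + b) + s * \<eta> \<omega>) - pi / 2" by linarith+
      then show ?thesis
        by (simp only: c) (simp only: sin_diff sin_add, simp)
    qed
    then have "(\<integral>\<omega>. cos (W \<omega> + b) * sin (s * \<eta> \<omega>) \<partial>M) =
      ((\<integral>\<omega>. cos (W \<omega> - s * \<eta> \<omega> + (b - pi / 2)) \<partial>M) - (\<integral>\<omega>. cos (W \<omega> + s * \<eta> \<omega> + (b - pi / 2)) \<partial>M)) * (- 1 / 2)"
      using ii by simp
    then show ?thesis by (simp add: sym)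
  qed
  have "(\<lambda>n. \<integral>\<omega>. cos (W \<omega> + b) * (real (Suc n) * sin (inverse (real (Suc n)) * \<eta> \<omega>)) \<partial>M) \<longlonglongrightarrow> (\<integral>\<omega>. cos (W \<omega> + b) * \<eta> \<omega> \<partial>M)"
  proof (rule integral_dominated_convergence[where w = "\<lambda>\<omega>. \<bar>\<eta> \<omega>\<bar>"])
    show "AE \<omega> in M. (\<lambda>n. cos (W \<omega> + b) * (real (Suc n) * sin (inverse (real (Suc n)) * \<eta> \<omega>))) \<longlonglongrightarrow> cos (W \<omega> + b) * \<eta> \<omega>"
    proof (intro AE_I2 tendsto_mult tendsto_const)
      fix \<omega>
      have "((\<lambda>h. sin (h * \<eta> \<omega>)) has_real_derivative \<eta> \<omega>) (at 0)"
        by (auto intro!: derivative_eq_intros)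
      then have "((\<lambda>h. sin (h * \<eta> \<omega>) / h) \<longlongrightarrow> \<eta> \<omega>) (at 0)"
        unfolding DERIV_def by simp
      moreover have "filterlim (\<lambda>n. inverse (real (Suc n))) (at 0) sequentially"
        unfolding filterlim_at using LIMSEQ_inverse_real_of_nat by auto
      ultimately have "(\<lambda>n. sin (inverse (real (Suc n)) * \<eta> \<omega>) / inverse (real (Suc n))) \<longlonglongrightarrow> \<eta> \<omega>"
        by (rule filterlim_compose)
      then show "(\<lambda>n. real (Suc n) * sin (inverse (real (Suc n)) * \<eta> \<omega>)) \<longlonglongrightarrow> \<eta> \<omega>"
        by (simp add: divide_inverse mult.commute)
    qed
    show "AE \<omega> in M. norm (cos (W \<omega> + b) * (real (Suc n) * sin (inverse (real (Suc n)) * \<eta> \<omega>))) \<le> \<bar>\<eta> \<omega>\<bar>" for n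
    proof (rule AE_I2)
      fix \<omega>
      have "\<bar>sin (inverse (real (Suc n)) * \<eta> \<omega>)\<bar> \<le> \<bar>inverse (real (Suc n)) * \<eta> \<omega>\<bar>" by (rule abs_sin_x_le_abs_x)
      then have "real (Suc n) * \<bar>sin (inverse (real (Suc n)) * \<eta> \<omega>)\<bar> \<le> \<bar>\<eta> \<omega>\<bar>"
        by (simp add: abs_mult field_simps)
      then have "\<bar>cos (W \<omega> + b)\<bar> * (real (Suc n) * \<bar>sin (inverse (real (Suc n)) * \<eta> \<omega>)\<bar>) \<le> 1 * \<bar>\<eta> \<omega>\<bar>"
        by (intro mult_mono) auto
      then show "norm (cos (W \<omega> + b) * (real (Suc n) * sin (inverse (real (Suc n)) * \<eta> \<omega>))) \<le> \<bar>\<eta> \<omega>\<bar>"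
        by (simp add: abs_mult)
    qed
  qed (use i in auto)
  moreover have "(\<integral>\<omega>. cos (W \<omega> + b) * (real (Suc n) * sin (inverse (real (Suc n)) * \<eta> \<omega>)) \<partial>M) = 0" for n
  proof -
    have "(\<integral>\<omega>. cos (W \<omega> + b) * (real (Suc n) * sin (inverse (real (Suc n)) * \<eta> \<omega>)) \<partial>M) =
      (\<integral>\<omega>. real (Suc n) * (cos (W \<omega> + b) * sin (inverse (real (Suc n)) * \<eta> \<omega>)) \<partial>M)"
      by (intro Bochner_Integration.integral_cong) auto
    then show ?thesis using sin by simp
  qed
  ultimately show ?thesis by (simp add: LIMSEQ_const_iff mult.commute)
qed

lemma emeasure_std_normal_ball_pos:
  assumes "\<delta> > 0"
  shows "emeasure std_normal_distribution (ball z \<delta>) \<noteq> 0"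
proof
  assume 0: "emeasure std_normal_distribution (ball z \<delta>) = 0"
  have [measurable]: "ball z \<delta> \<in> sets borel" by simp
  with 0 have "(\<integral>\<^sup>+x. ennreal (std_normal_density x) * indicator (ball z \<delta>) x \<partial>lborel) = 0"
    by (simp add: emeasure_density)
  then have "AE x in lborel. ennreal (std_normal_density x) * indicator (ball z \<delta>) x = 0"
    by (subst (asm) nn_integral_0_iff_AE) auto
  then have "AE x in lborel. x \<notin> ball z \<delta>"
  proof eventually_elim
    case (elim x)
    have "std_normal_density x > 0" by (simp add: normal_density_pos)
    with elim show ?case by (auto simp: indicator_def split: if_splits)
  qed
  then have "emeasure lborel (ball z \<delta>) = 0"
    by (subst (asm) AE_iff_measurable[of "ball z \<delta>"]) auto
  then show False using emeasure_lborel_ball_finite assms by (simp add: ball_eq_greaterThanLessThan)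
qed

text \<open>The sum depends continuously on \<open>k\<close> independent normal variables, so a
  product of small balls around the \<open>z j\<close>, which has positive probability, is mapped
  into \<open>U\<close>.\<close>

lemma gauss_sum_open_pos:
  fixes a :: "nat \<Rightarrow> 'a::{real_normed_vector, second_countable_topology}"
  assumes U: "open U" "(\<Sum>j<k. z j *\<^sub>R a j) \<in> U"
  shows "emeasure (gauss_sum a k) U \<noteq> 0"
proof
  assume 0: "emeasure (gauss_sum a k) U = 0"
  interpret product_prob_space "\<lambda>_::nat. std_normal_distribution" UNIV
    using prob_space_std_normal by (simp add: product_prob_spaceI)
  obtain e where e: "e > 0" "ball (\<Sum>j<k. z j *\<^sub>R a j) e \<subseteq> U" by (rule openE[OF U])
  define A where "A = (\<Sum>j<k. norm (a j))"
  have A: "A \<ge> 0" unfolding A_def by (intro sum_nonneg) simp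
  \<comment> \<open>Moving each coefficient by less than \<delta> moves the sum by at most
    \<open>\<delta> * A\<close>, which is less than \<open>e\<close>; the summand 1 guards against
    \<open>A = 0\<close>.\<close>
  define \<delta> where "\<delta> = e / (1 + A)"
  have \<delta>: "\<delta> > 0" "\<delta> * A < e"
  proof -
    show "\<delta> > 0" unfolding \<delta>_def using e A by simp
    then have "\<delta> * A < \<delta> * (1 + A)" by simp
    also have "\<dots> = e" using A by (simp add: \<delta>_def)
    finally show "\<delta> * A < e" .
  qed
  let ?B = "{\<omega> \<in> space gauss_seq. \<forall>j\<in>{..<k}. \<omega> j \<in> ball (z j) \<delta>}"
  have "?B \<subseteq> (\<lambda>\<omega>. \<Sum>j<k. \<omega> j *\<^sub>R a j) -` U \<inter> space gauss_seq"
  proof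
    fix \<omega> assume w: "\<omega> \<in> ?B"
    have "norm ((\<Sum>j<k. z j *\<^sub>R a j) - (\<Sum>j<k. \<omega> j *\<^sub>R a j)) = norm (\<Sum>j<k. (z j - \<omega> j) *\<^sub>R a j)"
      by (simp add: sum_subtractf scaleR_diff_left)
    also have "\<dots> \<le> (\<Sum>j<k. \<delta> * norm (a j))"
    proof (rule sum_norm_le)
      fix j assume "j \<in> {..<k}"
      then have "\<bar>z j - \<omega> j\<bar> < \<delta>" using w by (auto simp: dist_real_def)
      then show "norm ((z j - \<omega> j) *\<^sub>R a j) \<le> \<delta> * norm (a j)" by (simp add: mult_right_mono)
    qed
    also have "\<dots> = \<delta> * A" by (simp add: A_def sum_distrib_left)
    finally have "(\<Sum>j<k. \<omega> j *\<^sub>R a j) \<in> ball (\<Sum>j<k. z j *\<^sub>R a j) e"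
      using \<delta>(2) by (simp add: dist_norm)
    then show "\<omega> \<in> (\<lambda>\<omega>. \<Sum>j<k. \<omega> j *\<^sub>R a j) -` U \<inter> space gauss_seq" using e(2) w by auto
  qed
  then have "emeasure gauss_seq ?B \<le> emeasure gauss_seq ((\<lambda>\<omega>. \<Sum>j<k. \<omega> j *\<^sub>R a j) -` U \<inter> space gauss_seq)"
    using measurable_sets[OF measurable_gauss_sum borel_open[OF U(1)]] by (intro emeasure_mono)
  also have "\<dots> = 0"
    using 0 U(1) measurable_gauss_sum[where n = k and d = a] unfolding gauss_sum_def by (subst (asm) emeasure_distr) auto
  finally have "emeasure gauss_seq ?B = 0" by simp
  moreover have "emeasure gauss_seq ?B = (\<Prod>j<k. emeasure std_normal_distribution (ball (z j) \<delta>))"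
    by (rule emeasure_PiM_Collect) auto
  ultimately show False using emeasure_std_normal_ball_pos[OF \<delta>(1)] by simp
qed

section \<open>Regression on the measurements\<close>

context measurement_system
begin

lemma P_Q_phi: "P (Q (phi j)) = Q (phi j)"
proof -
  let ?q = "Q (phi j)"
  have "phi j \<cdot> (?q - P ?q) = 0" by (simp add: blinfun.diff_right)
  then have "ip (?q - P ?q) (?q - P ?q) = 0"
    using P_orthogonal[of ?q ?q] by (simp only: ip_simps(8) ip_Q diff_self)
  then show ?thesis by (simp only: ip_eq_0_iff right_minus_eq)
qed

context
  fixes M :: "'w measure" and \<xi> :: "'b dual \<Rightarrow> 'w \<Rightarrow> real"
  assumes field: "gaussian_field Q M \<xi>"
begin

interpretation M: prob_space M
  by (rule field[unfolded gaussian_field_def, THEN conjunct1])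

lemma field_measurable [measurable]: "\<xi> f \<in> borel_measurable M"
  and field_square_integrable: "integrable M (\<lambda>\<omega>. (\<xi> f \<omega>)\<^sup>2)"
  and field_linear: "AE \<omega> in M. \<xi> (a *\<^sub>R f + b *\<^sub>R g) \<omega> = a * \<xi> f \<omega> + b * \<xi> g \<omega>"
  and field_covariance: "(\<integral>\<omega>. \<xi> f \<omega> * \<xi> g \<omega> \<partial>M) = f \<cdot> Q g"
  and field_normal: "\<exists>s\<ge>0. distr M borel (\<xi> f) = centered_normal s"
  using field unfolding gaussian_field_def by blast+

lemma field_law: "distr M borel (\<xi> f) = centered_normal (f \<cdot> Q f)"
proof -
  obtain s where s: "s \<ge> 0" "distr M borel (\<xi> f) = centered_normal s"
    using field_normal by blast
  have "f \<cdot> Q f = (\<integral>\<omega>. (\<xi> f \<omega>)\<^sup>2 \<partial>M)"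
    using field_covariance[of f f] by (simp only: power2_eq_square)
  also have "\<dots> = s"
    by (rule prob_space_distr_centered_normal(2)[OF s(2,1) field_measurable])
  finally show ?thesis using s(2) by simp
qed

lemma field_integrable: "integrable M (\<xi> f)"
  by (rule M.square_integrable_imp_integrable[OF field_measurable field_square_integrable])

definition observed :: "'w \<Rightarrow> real ^ 'm" where "observed \<omega> = (\<chi> i. \<xi> (phi i) \<omega>)"

lemma observed_measurable [measurable]: "observed \<in> borel_measurable M"
proof (rule borel_measurable_euclidean_space[THEN iffD2], intro ballI)
  fix i :: "real ^ 'm" assume "i \<in> Basis"
  then obtain j where "i = axis j 1" by (auto simp: Basis_vec_def)
  then show "(\<lambda>\<omega>. observed \<omega> \<bullet> i) \<in> borel_measurable M"
    by (simp add: observed_def inner_axis)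
qed

text \<open>The adjoint of the measurement map: it turns functionals of the observed vector into
  elements of the span of the \<open>phi i\<close>.\<close>

definition pullback :: "(real ^ 'm) dual \<Rightarrow> 'b dual" where
  "pullback h = (\<Sum>i\<in>UNIV. (h \<cdot> axis i 1) *\<^sub>R phi i)"

lemma functional_axis: "h \<cdot> x = (\<Sum>i\<in>UNIV. (h \<cdot> axis i 1) * x $ i)" for h :: "(real ^ 'm) dual"
proof -
  have "h \<cdot> x = h \<cdot> (\<Sum>i\<in>UNIV. (x $ i) *\<^sub>R axis i 1)"
    using basis_expansion[of x] by (simp add: scalar_mult_eq_scaleR)
  then show ?thesis by (simp add: blinfun.sum_right blinfun.scaleR_right mult.commute)
qed

lemma pullback_apply: "pullback h \<cdot> u = h \<cdot> measure_vec phi u"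
  by (subst functional_axis) (simp add: pullback_def measure_vec_def blinfun.sum_left blinfun.scaleR_left)

lemma AE_pullback: "AE \<omega> in M. \<xi> (pullback h) \<omega> = h \<cdot> observed \<omega>"
  using AE_field_sum[OF field_linear, of UNIV "\<lambda>i. h \<cdot> axis i 1" phi]
  by (simp add: pullback_def observed_def functional_axis[of h "vec_lambda _"])

text \<open>Here Gaussianity turns missing correlation into independence: without a cross term, the
  variance of \<open>?t + r *\<^sub>R f\<close> is even in \<open>r\<close>, so flipping the sign of
  \<open>\<xi> f\<close> changes no wave integral.\<close>

lemma integral_uncorrelated_wave:
  assumes f: "\<And>i. f \<cdot> Q (phi i) = 0"
  shows "(\<integral>\<omega>. \<xi> f \<omega> * cos (h \<cdot> observed \<omega> + b) \<partial>M) = 0"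
proof -
  let ?t = "pullback h"
  have "phi i \<cdot> Q f = 0" for i using f[of i] Q_symmetric[of f "phi i"] by simp
  then have tf: "?t \<cdot> Q f = 0"
    by (simp add: pullback_def blinfun.sum_left blinfun.scaleR_left)
  have ft: "f \<cdot> Q ?t = 0" using tf Q_symmetric[of f ?t] by simp
  have "(\<integral>\<omega>. \<xi> f \<omega> * cos (\<xi> ?t \<omega> + b) \<partial>M) = 0"
  proof (rule M.integral_wave_eq_0)
    fix s b
    have cosint: "(\<integral>\<omega>. cos (\<xi> ?t \<omega> + r * \<xi> f \<omega> + b) \<partial>M) = cos b * exp (- (?t \<cdot> Q ?t + r\<^sup>2 * (f \<cdot> Q f)) / 2)" for r
    proof -
      let ?g = "1 *\<^sub>R ?t + r *\<^sub>R f"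
      have "(\<integral>\<omega>. cos (\<xi> ?t \<omega> + r * \<xi> f \<omega> + b) \<partial>M) = (\<integral>\<omega>. cos (\<xi> ?g \<omega> + b) \<partial>M)"
      proof (rule integral_cong_AE)
        show "AE \<omega> in M. cos (\<xi> ?t \<omega> + r * \<xi> f \<omega> + b) = cos (\<xi> ?g \<omega> + b)"
          using field_linear[of 1 ?t r f] by eventually_elim simp
      qed measurable
      also have "\<dots> = cos b * exp (- (?g \<cdot> Q ?g) / 2)"
        by (rule prob_space_distr_centered_normal(4)[OF field_law Q_nonneg field_measurable])
      also have "?g \<cdot> Q ?g = ?t \<cdot> Q ?t + r\<^sup>2 * (f \<cdot> Q f)"
        by (simp add: linear_add[OF Q_linear] linear_scale[OF Q_linear] blinfun.add_left blinfun.add_right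
            blinfun.scaleR_left blinfun.scaleR_right tf ft power2_eq_square)
      finally show ?thesis .
    qed
    show "(\<integral>\<omega>. cos (\<xi> ?t \<omega> + s * \<xi> f \<omega> + b) \<partial>M) = (\<integral>\<omega>. cos (\<xi> ?t \<omega> - s * \<xi> f \<omega> + b) \<partial>M)"
      using cosint[of s] cosint[of "- s"] by simp
  qed (use field_integrable in auto)
  moreover have "(\<integral>\<omega>. \<xi> f \<omega> * cos (h \<cdot> observed \<omega> + b) \<partial>M) = (\<integral>\<omega>. \<xi> f \<omega> * cos (\<xi> ?t \<omega> + b) \<partial>M)"
  proof (rule integral_cong_AE)
    show "AE \<omega> in M. \<xi> f \<omega> * cos (h \<cdot> observed \<omega> + b) = \<xi> f \<omega> * cos (\<xi> ?t \<omega> + b)"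
      using AE_pullback[of h] by eventually_elim simp
    have [measurable]: "blinfun_apply h \<in> borel_measurable borel"
      by (intro borel_measurable_continuous_onI continuous_intros)
    show "(\<lambda>\<omega>. \<xi> f \<omega> * cos (h \<cdot> observed \<omega> + b)) \<in> borel_measurable M" by measurable
  qed measurable
  ultimately show ?thesis by simp
qed

text \<open>The signed measure with density \<open>\<xi> f\<close>, pushed to the observations, is
  the difference of the finite measures \<open>m 1\<close> and \<open>m (- 1)\<close> built from the
  positive and negative parts. They agree on waves, hence on all Borel sets.\<close>

lemma integral_uncorrelated_indicator:
  assumes f: "\<And>i. f \<cdot> Q (phi i) = 0" and A: "A \<in> sets borel"
  shows "(\<integral>\<omega>. indicator (observed -` A \<inter> space M) \<omega> * \<xi> f \<omega> \<partial>M) = 0"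
proof -
  define m where "m s = distr (density M (\<lambda>\<omega>. ennreal (max 0 (s * \<xi> f \<omega>)))) borel observed" for s
  have Xm: "observed \<in> borel_measurable (density M (\<lambda>\<omega>. ennreal (max 0 (s * \<xi> f \<omega>))))" for s by simp
  have imax: "integrable M (\<lambda>\<omega>. max 0 (s * \<xi> f \<omega>))" for s
    using field_integrable by (intro integrable_max) auto
  have fin: "finite_measure (m s)" for s
  proof -
    have "(\<integral>\<^sup>+\<omega>. ennreal (max 0 (s * \<xi> f \<omega>)) \<partial>M) \<noteq> \<infinity>"
      using imax by (subst nn_integral_eq_integral) auto
    then have "finite_measure (density M (\<lambda>\<omega>. ennreal (max 0 (s * \<xi> f \<omega>))))"
      by (intro finite_measureI) (simp add: emeasure_density cong: nn_integral_cong)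
    then show ?thesis unfolding m_def using Xm by (rule finite_measure.finite_measure_distr)
  qed
  have sets: "sets (m s) = sets borel" for s by (simp add: m_def)
  have int_m: "(\<integral>x. g x \<partial>m s) = (\<integral>\<omega>. max 0 (s * \<xi> f \<omega>) * g (observed \<omega>) \<partial>M)"
    if g: "g \<in> borel_measurable borel" for g :: "real ^ 'm \<Rightarrow> real" and s
  proof -
    have s: "(\<lambda>\<omega>. s * \<xi> f \<omega>) \<in> borel_measurable M" by simp
    have "(\<integral>x. g x \<partial>m s) = (\<integral>\<omega>. g (observed \<omega>) \<partial>density M (\<lambda>\<omega>. ennreal (max 0 (s * \<xi> f \<omega>))))"
      unfolding m_def by (rule integral_distr[OF Xm g])
    also have "\<dots> = (\<integral>\<omega>. max 0 (s * \<xi> f \<omega>) * g (observed \<omega>) \<partial>M)"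
      by (rule integral_density_pos_part[OF s measurable_compose[OF observed_measurable g]])
    finally show ?thesis .
  qed
  have diff: "(\<integral>x. g x \<partial>m 1) - (\<integral>x. g x \<partial>m (- 1)) = (\<integral>\<omega>. g (observed \<omega>) * \<xi> f \<omega> \<partial>M)"
    if g: "g \<in> borel_measurable borel" and C: "\<And>x. \<bar>g x\<bar> \<le> C" for g :: "real ^ 'm \<Rightarrow> real" and C
  proof -
    have [measurable]: "(\<lambda>\<omega>. g (observed \<omega>)) \<in> borel_measurable M"
      by (rule measurable_compose[OF observed_measurable g])
    have i: "integrable M (\<lambda>\<omega>. max 0 (s * \<xi> f \<omega>) * g (observed \<omega>))" for s
    proof (rule Bochner_Integration.integrable_bound)
      show "integrable M (\<lambda>\<omega>. C * max 0 (s * \<xi> f \<omega>))" using imax by simp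
      have "C \<ge> 0" using C[of 0] by linarith
      show "AE \<omega> in M. norm (max 0 (s * \<xi> f \<omega>) * g (observed \<omega>)) \<le> norm (C * max 0 (s * \<xi> f \<omega>))"
      proof (rule AE_I2)
        fix \<omega>
        have "\<bar>max 0 (s * \<xi> f \<omega>)\<bar> * \<bar>g (observed \<omega>)\<bar> \<le> \<bar>max 0 (s * \<xi> f \<omega>)\<bar> * C"
          by (intro mult_left_mono C) simp
        then show "norm (max 0 (s * \<xi> f \<omega>) * g (observed \<omega>)) \<le> norm (C * max 0 (s * \<xi> f \<omega>))"
          using \<open>C \<ge> 0\<close> by (simp add: abs_mult mult.commute)
      qed
    qed measurable
    have "(\<integral>x. g x \<partial>m 1) - (\<integral>x. g x \<partial>m (- 1)) =
      (\<integral>\<omega>. max 0 (1 * \<xi> f \<omega>) * g (observed \<omega>) - max 0 (- 1 * \<xi> f \<omega>) * g (observed \<omega>) \<partial>M)"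
      using i by (simp only: int_m[OF g] Bochner_Integration.integral_diff)
    also have "\<dots> = (\<integral>\<omega>. g (observed \<omega>) * \<xi> f \<omega> \<partial>M)"
      by (intro Bochner_Integration.integral_cong) (auto simp: max_def)
    finally show ?thesis .
  qed
  have "m 1 = m (- 1)"
  proof (rule finite_measure_eqI_trig_euclidean[OF fin fin sets sets])
    fix p :: "real ^ 'm \<Rightarrow> real" assume "trig p"
    then have "integrable (m 1) p \<and> integrable (m (- 1)) p \<and> (\<integral>x. p x \<partial>m 1) = (\<integral>x. p x \<partial>m (- 1))"
    proof (induction rule: trig.induct)
      case (wave a h b)
      have w: "trig (\<lambda>x. a * cos (h \<cdot> x + b))" by (rule trig.wave)
      have bd: "\<bar>a * cos (h \<cdot> x + b)\<bar> \<le> \<bar>a\<bar>" for x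
        using mult_left_mono[OF abs_cos_le_one[of "h \<cdot> x + b"], of "\<bar>a\<bar>"] by (simp add: abs_mult)
      have "(\<integral>x. a * cos (h \<cdot> x + b) \<partial>m 1) - (\<integral>x. a * cos (h \<cdot> x + b) \<partial>m (- 1)) =
        (\<integral>\<omega>. a * cos (h \<cdot> observed \<omega> + b) * \<xi> f \<omega> \<partial>M)"
        using bd by (intro diff borel_measurable_continuous_onI trig_continuous w)
      also have "\<dots> = a * (\<integral>\<omega>. \<xi> f \<omega> * cos (h \<cdot> observed \<omega> + b) \<partial>M)"
        by (simp add: ac_simps)
      also have "\<dots> = 0" using integral_uncorrelated_wave[OF f] by simp
      finally show ?case using trig_integrable[OF fin sets w bd] by simp
    next
      case (add p q)
      then show ?case by simp
    qed
    then show "(\<integral>x. p x \<partial>m 1) = (\<integral>x. p x \<partial>m (- 1))" by blast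
  qed
  then have "(\<integral>\<omega>. indicator A (observed \<omega>) * \<xi> f \<omega> \<partial>M) = 0"
    using diff[of "indicator A" 1] A by (simp add: indicator_def)
  moreover have "(\<integral>\<omega>. indicator (observed -` A \<inter> space M) \<omega> * \<xi> f \<omega> \<partial>M) = (\<integral>\<omega>. indicator A (observed \<omega>) * \<xi> f \<omega> \<partial>M)"
    by (intro Bochner_Integration.integral_cong) (auto simp: indicator_def)
  ultimately show ?thesis by simp
qed

text \<open>Subtracting \<open>t\<close>, the combination of the \<open>phi i\<close> with
  coefficients \<open>f \<cdot> \<psi> i\<close>, leaves a functional uncorrelated with the
  measurements, because \<open>t \<cdot> u = f \<cdot> P u\<close> and \<open>P\<close> fixes every
  \<open>Q (phi j)\<close>.\<close>

lemma linear_regression: "continuous_regression M observed (\<xi> f) (\<lambda>c. f \<cdot> (\<Sum>i\<in>UNIV. (c $ i) *\<^sub>R \<psi> i))"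
  unfolding continuous_regression_def
proof
  let ?F = "vimage_algebra (space M) observed borel" and ?r = "\<lambda>c. f \<cdot> (\<Sum>i\<in>UNIV. (c $ i) *\<^sub>R \<psi> i)"
  show r: "continuous_on UNIV ?r" by (intro continuous_intros)
  have sF: "sets ?F = {observed -` A \<inter> space M | A. A \<in> sets borel}" by (rule sets_vimage_algebra2) simp
  have sub: "subalgebra M ?F"
    using measurable_sets[OF observed_measurable] unfolding subalgebra_def sF by auto
  interpret finite_measure_subalgebra M ?F by unfold_locales (rule sub)
  define t where "t = (\<Sum>i\<in>UNIV. (f \<cdot> \<psi> i) *\<^sub>R phi i)"
  define f' where "f' = 1 *\<^sub>R f + (- 1) *\<^sub>R t"
  have t: "AE \<omega> in M. \<xi> t \<omega> = ?r (observed \<omega>)"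
    using AE_field_sum[OF field_linear, of UNIV "\<lambda>i. f \<cdot> \<psi> i" phi]
    by (simp add: t_def observed_def blinfun.sum_right blinfun.scaleR_right mult.commute)
  have f': "AE \<omega> in M. \<xi> f' \<omega> = \<xi> f \<omega> - ?r (observed \<omega>)"
    using t field_linear[of 1 f "- 1" t] unfolding f'_def[symmetric] by eventually_elim simp
  have uncorr: "f' \<cdot> Q (phi j) = 0" for j
  proof -
    have "t \<cdot> u = f \<cdot> P u" for u
      by (simp add: t_def P_def blinfun.sum_left blinfun.scaleR_left blinfun.sum_right blinfun.scaleR_right mult.commute)
    then show ?thesis by (simp add: f'_def blinfun.diff_left P_Q_phi)
  qed
  have rX: "integrable M (\<lambda>\<omega>. ?r (observed \<omega>))"
  proof (rule integrable_cong_AE_imp[OF field_integrable[of t]])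
    have "?r \<in> borel_measurable borel" by (rule borel_measurable_continuous_onI[OF r])
    then show "(\<lambda>\<omega>. ?r (observed \<omega>)) \<in> borel_measurable M" by measurable
  qed (use t in \<open>auto elim: eventually_mono\<close>)
  show "AE \<omega> in M. real_cond_exp M ?F (\<xi> f) \<omega> = ?r (observed \<omega>)"
  proof (rule real_cond_exp_charact)
    fix B assume "B \<in> sets ?F"
    then obtain A where A: "A \<in> sets borel" "B = observed -` A \<inter> space M" unfolding sF by blast
    have B: "B \<in> sets M" using measurable_sets[OF observed_measurable A(1)] A(2) by simp
    have "(\<integral>\<omega>. indicator B \<omega> * \<xi> f \<omega> \<partial>M) - (\<integral>\<omega>. indicator B \<omega> * ?r (observed \<omega>) \<partial>M) =
      (\<integral>\<omega>. indicator B \<omega> * \<xi> f \<omega> - indicator B \<omega> * ?r (observed \<omega>) \<partial>M)"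
      using B field_integrable rX
      by (intro Bochner_Integration.integral_diff[symmetric] integrable_real_mult_indicator[unfolded mult.commute[of _ "indicator _ _"]])
    also have "\<dots> = (\<integral>\<omega>. indicator B \<omega> * \<xi> f' \<omega> \<partial>M)"
    proof (rule integral_cong_AE)
      show "AE \<omega> in M. indicator B \<omega> * \<xi> f \<omega> - indicator B \<omega> * ?r (observed \<omega>) = indicator B \<omega> * \<xi> f' \<omega>"
        using f' by eventually_elim (simp add: right_diff_distrib)
    qed (use B rX in \<open>auto intro!: borel_measurable_diff borel_measurable_times borel_measurable_indicator dest: borel_measurable_integrable\<close>)
    also have "\<dots> = 0" using integral_uncorrelated_indicator[OF uncorr A(1)] A(2) by simp
    finally show "(\<integral>\<omega>\<in>B. \<xi> f \<omega> \<partial>M) = (\<integral>\<omega>\<in>B. ?r (observed \<omega>) \<partial>M)"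
      by (simp add: set_lebesgue_integral_def)
  next
    have "?r \<in> borel_measurable borel" by (rule borel_measurable_continuous_onI[OF r])
    moreover have "observed \<in> ?F \<rightarrow>\<^sub>M borel" by (rule measurable_vimage_algebra1) simp
    ultimately show "(\<lambda>\<omega>. ?r (observed \<omega>)) \<in> borel_measurable ?F" by (rule measurable_compose[rotated])
  qed (rule field_integrable rX)+
qed

text \<open>The observed vector has the law of a finite Gaussian sum. Since combinations of gamblets
  realize every value of the measurements, the vectors \<open>a j\<close> span the whole space and
  \<open>gauss_sum_open_pos\<close> reaches every open set.\<close>

lemma observed_open_pos:
  assumes "open U" "U \<noteq> {}"
  shows "emeasure M (observed -` U \<inter> space M) \<noteq> 0"
proof -
  obtain e k where "orthosystem e"
    and e: "\<And>x. x \<in> span (range (\<lambda>i. Q (phi i))) \<Longrightarrow> x = (\<Sum>j<k. ip (e j) x *\<^sub>R e j)"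
    and e2: "\<And>x. x \<in> span (range (\<lambda>i. Q (phi i))) \<Longrightarrow> ip x x = (\<Sum>j<k. (ip (e j) x)\<^sup>2)"
    by (rule finite_orthonormal[of "range (\<lambda>i. Q (phi i))"]) auto
  define a where "a j = measure_vec phi (e j)" for j
  have "distr M borel observed = gauss_sum a k"
  proof (rule finite_measure_eqI_trig_euclidean)
    interpret G: prob_space "gauss_sum a k" by (rule prob_space_gauss_sum)
    show fin: "finite_measure (distr M borel observed)" "finite_measure (gauss_sum a k)"
      by (auto intro: M.finite_measure_distr observed_measurable G.finite_measure_axioms)
    fix p :: "real ^ 'm \<Rightarrow> real" assume "trig p"
    then have "integrable (distr M borel observed) p \<and> integrable (gauss_sum a k) p \<and>
      (\<integral>x. p x \<partial>distr M borel observed) = (\<integral>x. p x \<partial>gauss_sum a k)"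
    proof (induction rule: trig.induct)
      case (wave c h b)
      have w: "trig (\<lambda>x. c * cos (h \<cdot> x + b))" by (rule trig.wave)
      have bd: "\<bar>c * cos (h \<cdot> x + b)\<bar> \<le> \<bar>c\<bar>" for x
        using mult_left_mono[OF abs_cos_le_one[of "h \<cdot> x + b"], of "\<bar>c\<bar>"] by (simp add: abs_mult)
      have hm[measurable]: "blinfun_apply h \<in> borel_measurable borel"
        by (intro borel_measurable_continuous_onI continuous_intros)
      let ?t = "pullback h"
      have "(\<integral>x. cos (h \<cdot> x + b) \<partial>distr M borel observed) = (\<integral>\<omega>. cos (h \<cdot> observed \<omega> + b) \<partial>M)"
        by (subst integral_distr) auto
      also have "\<dots> = (\<integral>\<omega>. cos (\<xi> ?t \<omega> + b) \<partial>M)"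
      proof (rule integral_cong_AE)
        show "AE \<omega> in M. cos (h \<cdot> observed \<omega> + b) = cos (\<xi> ?t \<omega> + b)"
          using AE_pullback[of h] by eventually_elim simp
      qed measurable
      also have "\<dots> = cos b * exp (- (?t \<cdot> Q ?t) / 2)"
        by (rule prob_space_distr_centered_normal(4)[OF field_law Q_nonneg field_measurable])
      \<comment> \<open>Parseval on the span of the \<open>Q (phi i)\<close>, to which
        \<open>Q ?t\<close> belongs.\<close>
      also have "?t \<cdot> Q ?t = (\<Sum>j<k. (h \<cdot> a j)\<^sup>2)"
      proof -
        have "Q ?t = (\<Sum>i\<in>UNIV. (h \<cdot> axis i 1) *\<^sub>R Q (phi i))"
          by (simp add: pullback_def linear_sum[OF Q_linear] linear_scale[OF Q_linear])
        also have "\<dots> \<in> span (range (\<lambda>i. Q (phi i)))" by (intro span_sum span_scale) (auto intro: span_base)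
        finally have "ip (Q ?t) (Q ?t) = (\<Sum>j<k. (ip (e j) (Q ?t))\<^sup>2)" by (rule e2)
        then show ?thesis by (simp add: ip_commute[of "e _" "Q ?t"] pullback_apply a_def)
      qed
      also have "cos b * exp (- (\<Sum>j<k. (h \<cdot> a j)\<^sup>2) / 2) = (\<integral>x. cos (h \<cdot> x + b) \<partial>gauss_sum a k)"
      proof (rule prob_space_distr_centered_normal(4)[OF distr_gauss_sum_functional, symmetric])
        show "0 \<le> (\<Sum>j<k. (h \<cdot> a j)\<^sup>2)" by (intro sum_nonneg) simp
        show "blinfun_apply h \<in> borel_measurable (gauss_sum a k)" using hm by (simp cong: measurable_cong_sets)
      qed
      finally show ?case
        using trig_integrable[OF fin(1) _ w bd] trig_integrable[OF fin(2) _ w bd] by simp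
    next
      case (add p q)
      then show ?case by simp
    qed
    then show "(\<integral>x. p x \<partial>distr M borel observed) = (\<integral>x. p x \<partial>gauss_sum a k)" by blast
  qed simp_all
  moreover have "emeasure (gauss_sum a k) U \<noteq> 0"
  proof -
    obtain c where c: "c \<in> U" using assms(2) by blast
    define u where "u = (\<Sum>i\<in>UNIV. (c $ i) *\<^sub>R \<psi> i)"
    have "u \<in> span (range (\<lambda>i. Q (phi i)))"
      unfolding u_def gamblet_def by (intro span_sum span_scale) (auto intro: span_base)
    then have "u = (\<Sum>j<k. ip (e j) u *\<^sub>R e j)" by (rule e)
    then have "measure_vec phi u = (\<Sum>j<k. ip (e j) u *\<^sub>R a j)"
    proof -
      have "phi i \<cdot> u = (\<Sum>j<k. ip (e j) u * (phi i \<cdot> e j))" for i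
        using arg_cong[OF \<open>u = (\<Sum>j<k. ip (e j) u *\<^sub>R e j)\<close>, of "\<lambda>x. phi i \<cdot> x"] by (simp only: blinfun.sum_right blinfun.scaleR_right real_scaleR_def)
      then show ?thesis by (simp add: measure_vec_def a_def vec_eq_iff)
    qed
    moreover have "measure_vec phi u = c"
      by (simp add: vec_eq_iff measure_vec_def u_def blinfun.sum_right blinfun.scaleR_right phi_gamblet
          if_distrib cong: if_cong)
    ultimately show ?thesis using c by (intro gauss_sum_open_pos[OF assms(1), of "\<lambda>j. ip (e j) u"]) simp
  qed
  ultimately show ?thesis
    using assms(1) emeasure_distr[OF observed_measurable, of U] by simp
qed

text \<open>Two continuous versions differ on an open set; it is null for the observed vector, hence
  empty.\<close>

lemma continuous_regression_unique:
  assumes r: "continuous_regression M observed Y r" "continuous_regression M observed Y r'"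
  shows "r = r'"
proof (rule ccontr)
  assume "r \<noteq> r'"
  then obtain c where "r c \<noteq> r' c" by blast
  define U where "U = {c. r c \<noteq> r' c}"
  have "open U"
    using r unfolding U_def continuous_regression_def by (intro open_Collect_neq) auto
  moreover have "U \<noteq> {}" using \<open>r c \<noteq> r' c\<close> by (auto simp: U_def)
  ultimately have "emeasure M (observed -` U \<inter> space M) \<noteq> 0" by (rule observed_open_pos)
  moreover have "AE \<omega> in M. real_cond_exp M (vimage_algebra (space M) observed borel) Y \<omega> = r (observed \<omega>)"
    "AE \<omega> in M. real_cond_exp M (vimage_algebra (space M) observed borel) Y \<omega> = r' (observed \<omega>)"
    using r by (simp_all add: continuous_regression_def)
  then have "AE \<omega> in M. r (observed \<omega>) = r' (observed \<omega>)"
    by eventually_elim simp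
  then have "AE \<omega> in M. \<omega> \<notin> observed -` U \<inter> space M"
    by eventually_elim (simp add: U_def)
  then have "emeasure M (observed -` U \<inter> space M) = 0"
    using measurable_sets[OF observed_measurable borel_open[OF \<open>open U\<close>]]
    by (subst (asm) AE_iff_measurable[OF _ refl]) (auto simp: Int_def conj_commute)
  ultimately show False by simp
qed

lemma is_field_cond_exp_iff:
  "is_field_cond_exp M \<xi> phi c v \<longleftrightarrow> v = (\<Sum>i\<in>UNIV. (c $ i) *\<^sub>R \<psi> i)"
proof -
  have obs: "(\<lambda>\<omega>. \<chi> i. \<xi> (phi i) \<omega>) = observed" by (simp add: observed_def fun_eq_iff)
  have "(\<exists>r. continuous_regression M observed (\<xi> f) r \<and> f \<cdot> v = r c) \<longleftrightarrow> f \<cdot> v = f \<cdot> (\<Sum>i\<in>UNIV. (c $ i) *\<^sub>R \<psi> i)" for f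
  proof
    assume "\<exists>r. continuous_regression M observed (\<xi> f) r \<and> f \<cdot> v = r c"
    then obtain r where r: "continuous_regression M observed (\<xi> f) r" "f \<cdot> v = r c" by blast
    show "f \<cdot> v = f \<cdot> (\<Sum>i\<in>UNIV. (c $ i) *\<^sub>R \<psi> i)"
      using r(2) by (simp only: continuous_regression_unique[OF r(1) linear_regression])
  next
    assume "f \<cdot> v = f \<cdot> (\<Sum>i\<in>UNIV. (c $ i) *\<^sub>R \<psi> i)"
    with linear_regression show "\<exists>r. continuous_regression M observed (\<xi> f) r \<and> f \<cdot> v = r c"
      by (intro exI conjI)
  qed
  then have "is_field_cond_exp M \<xi> phi c v \<longleftrightarrow> (\<forall>f :: 'b dual. f \<cdot> v = f \<cdot> (\<Sum>i\<in>UNIV. (c $ i) *\<^sub>R \<psi> i))"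
    by (simp only: is_field_cond_exp_def obs)
  also have "\<dots> \<longleftrightarrow> v = (\<Sum>i\<in>UNIV. (c $ i) *\<^sub>R \<psi> i)"
    using dual_separates by blast
  finally show ?thesis .
qed

lemma field_cond_exp_eq: "field_cond_exp M \<xi> phi c = (\<Sum>i\<in>UNIV. (c $ i) *\<^sub>R \<psi> i)"
  unfolding field_cond_exp_def is_field_cond_exp_iff by simp

lemma u_II_eq: "u_II M \<xi> phi = P"
  by (rule ext) (simp add: u_II_def field_cond_exp_eq measure_vec_def P_def)

lemma gamblet_eq: "\<psi> i = field_cond_exp M \<xi> phi (\<chi> j. if i = j then 1 else 0)"
  by (simp add: field_cond_exp_eq if_distrib[of "\<lambda>x. x *\<^sub>R _"] cong: if_cong)

end

lemma gaussian_cylinder_measures_exist: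
  "\<exists>\<mu>. gaussian_cylinder_measure Q \<mu>"
  "\<exists>\<mu>. gaussian_cylinder_measure (short Q (span (range phi))) \<mu>"
proof -
  from gaussian_field_exists obtain M :: "(nat \<Rightarrow> real) measure" and \<xi>
    where field: "gaussian_field Q M \<xi>"
    by (elim exE)
  have M: "prob_space M" by (rule field[unfolded gaussian_field_def, THEN conjunct1])
  note \<xi> = field_linear[OF field] field_measurable[OF field]
  show "\<exists>\<mu>. gaussian_cylinder_measure Q \<mu>"
    by (intro gaussian_cylinder_measure_of_field[where M = M and \<eta> = \<xi>] \<xi> M field_law[OF field])
  \<comment> \<open>This is \<open>f\<close> minus its regression onto the measurements. The field
    \<open>f \<mapsto> \<xi> (r f)\<close> has the short as its covariance and so induces the
    cylinder measure of the short.\<close>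
  define r where "r f = f - inv Q (P (Q f))" for f
  have r: "r (a *\<^sub>R f + b *\<^sub>R g) = a *\<^sub>R r f + b *\<^sub>R r g" for a b f g
    by (simp add: r_def linear_add[OF Q_linear] linear_scale[OF Q_linear] linear_add[OF linear_inv_Q]
        linear_scale[OF linear_inv_Q] algebra_simps)
  have Qr: "Q (r f) = Q f - P (Q f)" for f by (simp add: r_def linear_diff[OF Q_linear])
  have q: "r f \<cdot> Q (r f) = f \<cdot> (Q f - P (Q f))" for f
  proof -
    have "ip (Q f - P (Q f)) (Q f - P (Q f)) = f \<cdot> (Q f - P (Q f))"
      using P_orthogonal[of "Q f" "Q f"] by (simp only: ip_simps(8) ip_Q diff_zero)
    then show ?thesis using ip_Q[of "r f" "Q (r f)"] by (simp only: Qr)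
  qed
  have law: "distr M borel (\<xi> (r f)) = centered_normal (f \<cdot> (Q f - P (Q f)))" for f
    unfolding q[symmetric] by (rule field_law[OF field])
  have lin: "AE \<omega> in M. \<xi> (r (a *\<^sub>R f + b *\<^sub>R g)) \<omega> = a * \<xi> (r f) \<omega> + b * \<xi> (r g) \<omega>" for a b f g
    unfolding r by (rule \<xi>(1))
  show "\<exists>\<mu>. gaussian_cylinder_measure (short Q (span (range phi))) \<mu>"
    unfolding short_eq
    by (intro gaussian_cylinder_measure_of_field[where M = M and \<eta> = "\<lambda>f. \<xi> (r f)"] \<xi>(2) M lin law)
qed

end

text \<open>The existence clauses keep the universally quantified ones from being vacuous: fields
  exist on a concrete sample space, both Gaussian cylinder measures exist, and the definite
  descriptions behind \<open>short\<close> and \<open>field_cond_exp\<close> denote.\<close>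

theorem theorem5p6:
  fixes Q :: "'b::{banach, second_countable_topology} dual \<Rightarrow> 'b"
    and phi :: "'m::finite \<Rightarrow> 'b dual"
  assumes reflexive: "reflexive_space TYPE('b)"
    and Q_linear: "linear Q"
    and Q_bij: "bij Q"
    and Q_symmetric: "\<And>f g :: 'b dual. f \<cdot> Q g = g \<cdot> Q f"
    and Q_positive: "\<And>f :: 'b dual. f \<noteq> 0 \<Longrightarrow> f \<cdot> Q f > 0"
    and phi_independent: "inj phi" "independent (range phi)"
  shows
    "(\<exists>(M :: (nat \<Rightarrow> real) measure) \<xi>. gaussian_field Q M \<xi>) \<and>
     is_short Q (span (range phi)) (short Q (span (range phi))) \<and>
     (\<exists>\<mu>. gaussian_cylinder_measure Q \<mu>) \<and>
     (\<exists>\<mu>. gaussian_cylinder_measure (short Q (span (range phi))) \<mu>) \<and>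
     (\<forall>(M :: 'w measure) \<xi>. gaussian_field Q M \<xi> \<longrightarrow>
        (\<forall>c. \<exists>!v. is_field_cond_exp M \<xi> phi c v) \<and>
        (\<forall>\<mu>. gaussian_cylinder_measure (short Q (span (range phi))) \<mu> \<longrightarrow>
              saddle_point Q phi (u_II M \<xi> phi) \<mu>) \<and>
        (infinite_dimensional TYPE('b) \<longrightarrow>
           (\<forall>\<mu>. gaussian_cylinder_measure Q \<mu> \<longrightarrow> saddle_point Q phi (u_II M \<xi> phi) \<mu>)) \<and>
        minmax_optimal Q phi (u_II M \<xi> phi) \<and>
        (\<forall>i. gamblet Q phi i = field_cond_exp M \<xi> phi (\<chi> j. if i = j then 1 else 0)))"
proof -
  interpret measurement_system Q phi
    by (intro measurement_system.intro covariance_operator.intro measurement_system_axioms.intro)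
      (fact Q_linear Q_bij Q_symmetric Q_positive phi_independent)+
  show ?thesis
  proof (intro conjI allI impI)
    show "\<exists>(M :: (nat \<Rightarrow> real) measure) \<xi>. gaussian_field Q M \<xi>" by (rule gaussian_field_exists)
    show "is_short Q (span (range phi)) (short Q (span (range phi)))"
      unfolding short_eq by (rule is_short_residual)
    show "\<exists>\<mu>. gaussian_cylinder_measure Q \<mu>" "\<exists>\<mu>. gaussian_cylinder_measure (short Q (span (range phi))) \<mu>"
      by (rule gaussian_cylinder_measures_exist)+
    fix M :: "'w measure" and \<xi> assume field: "gaussian_field Q M \<xi>"
    show "\<exists>!v. is_field_cond_exp M \<xi> phi c v" for c
      by (simp add: is_field_cond_exp_iff[OF field])
    show "saddle_point Q phi (u_II M \<xi> phi) \<mu>"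
      if "gaussian_cylinder_measure (short Q (span (range phi))) \<mu>" for \<mu>
      unfolding u_II_eq[OF field] using that by (rule saddle_point_short)
    show "saddle_point Q phi (u_II M \<xi> phi) \<mu>"
      if "infinite_dimensional TYPE('b)" "gaussian_cylinder_measure Q \<mu>" for \<mu>
      unfolding u_II_eq[OF field] using that by (rule saddle_point_Q)
    show "minmax_optimal Q phi (u_II M \<xi> phi)"
      unfolding u_II_eq[OF field] by (rule minmax_optimal_P)
    show "gamblet Q phi i = field_cond_exp M \<xi> phi (\<chi> j. if i = j then 1 else 0)" for i
      by (rule gamblet_eq[OF field])
  qed
qed

end
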